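(* Let $(M,g)$ be an oriented $2$-dimensional Riemannian manifold and let $\mathcal R(M)=TM\setminus s_o$, where $s_o$ is the zero section. For $(x_0,R_0)\in\mathcal R(M)$ let $$\mathcal D(M,g)_{(x_0,R_0)}=\left\langle\left\{\tfrac{d}{dt}(\gamma,R_g(\gamma))(0):\ \gamma(0)=x_0,\ R_g(\gamma)(0)=R_0\right\}\right\rangle,$$ where $\gamma$ ranges over regular curves in $M$ with never vanishing geodesic curvature. Then the collection of vector spaces $\mathcal D(M,g)$ is a smooth Engel distribution over $\mathcal R(M)$. Moreover a curve $(\gamma,R):[0,T]\to\mathcal R(M)$ is in the image of the lift $\gamma\mapsto(\gamma,R_g(\gamma))$ if and only if it is tangent to $\mathcal D(M,g)$ and $\gamma$ is a regular curve. A basis for $\mathcal D(M,g)$ is given by two vector fields $f_1^g,f_2^g$, characterized by the ODEs satisfied by their integral curves $(x,R)(t)$: $$f_1^g:\ \begin{cases}\dot x=R^{\perp_g},\\ D_tR=-R^{\perp_g},\end{cases}\qquad f_2^g:\ \begin{cases}\dot x=0,\\ \dot R=R.\end{cases}$$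
   Context: All curves are smooth. $D_t$ is the Levi-Civita covariant derivative along a curve (for $D_tR$, along the base curve $x(t)$). For a regular curve $\gamma$ ($\dot\gamma$ never zero), $\pi_{\dot\gamma^\perp}$ is the orthogonal projection onto $\{\dot\gamma(t)\}^\perp$, the geodesic curvature is $\kappa_g(\gamma)=|\pi_{\dot\gamma^\perp}(D_t\dot\gamma)|/|\dot\gamma|^2$, and if it never vanishes the radius of curvature is $R_g(\gamma)=\frac{1}{\kappa_g(\gamma)}\frac{\pi_{\dot\gamma^\perp}(D_t\dot\gamma)}{|\pi_{\dot\gamma^\perp}(D_t\dot\gamma)|}$. The lift $\gamma\mapsto(\gamma,R_g(\gamma))$ is defined on regular curves with never vanishing geodesic curvature. For $R\in T_xM\setminus\{0\}$, $R^{\perp_g}$ is the unique vector orthogonal to $R$, with $|R^{\perp_g}|_g=|R|_g$, such that $(R,R^{\perp_g})$ is positively oriented. $\langle S\rangle$ denotes the linear span of $S$. An Engel distribution is a rank-$2$ distribution $\mathcal D$ on a $4$-manifold such that $\mathcal D^2=\mathcal D+[\mathcal D,\mathcal D]$ has constant rank $3$ and $\mathcal D^3=\mathcal D^2+[\mathcal D,\mathcal D^2]$ has rank $4$. *)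

theory Defs
  imports "HOL-Analysis.Analysis" "HOL-Library.Function_Algebras"
begin

text \<open>Pointwise scalar multiplication, so that \<open>span\<close>, \<open>dim\<close>, \<open>subspace\<close> and
  \<open>independent\<close> apply to tangent vectors, which are encoded below as functions on charts.\<close>

instantiation "fun" :: (type, real_vector) real_vector
begin

definition scaleR_fun_def: "r *\<^sub>R f = (\<lambda>x. r *\<^sub>R f x)"

instance
  by standard (simp_all add: scaleR_fun_def fun_eq_iff scaleR_add_right scaleR_add_left)

end

section \<open>Smooth maps between Euclidean spaces\<close>

text \<open>\<open>C_on k S f\<close> says that \<open>f\<close> is $C^k$ on \<open>S\<close>. It is used only for open subsets \<open>S\<close> of a Euclidean
  space and for relatively open subsets \<open>S\<close> of a nondegenerate real interval. In both cases
  derivatives within \<open>S\<close> are unique; at an endpoint of an interval they are one-sided.\<close>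

primrec C_on :: "nat \<Rightarrow> 'a::euclidean_space set \<Rightarrow> ('a \<Rightarrow> 'b::real_normed_vector) \<Rightarrow> bool" where
  "C_on 0 S f \<longleftrightarrow> continuous_on S f"
| "C_on (Suc k) S f \<longleftrightarrow> f differentiable_on S \<and>
     (\<forall>v. C_on k S (\<lambda>x. frechet_derivative f (at x within S) v))"

definition smooth_on :: "'a::euclidean_space set \<Rightarrow> ('a \<Rightarrow> 'b::real_normed_vector) \<Rightarrow> bool" where
  "smooth_on S f \<longleftrightarrow> (\<forall>k. C_on k S f)"

section \<open>Smooth manifolds\<close>

text \<open>A manifold modelled on the Euclidean space \<open>'e\<close> is given by an atlas. A chart is a pair of its
  domain and its coordinate map; values of the map outside the domain carry no meaning.\<close>

type_synonym ('p, 'e) chart = "'p set \<times> ('p \<Rightarrow> 'e)"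

abbreviation chart_inv :: "('p, 'e) chart \<Rightarrow> 'e \<Rightarrow> 'p" where
  "chart_inv c \<equiv> inv_into (fst c) (snd c)"

abbreviation transition :: "('p, 'e) chart \<Rightarrow> ('p, 'e) chart \<Rightarrow> 'e \<Rightarrow> 'e" where
  "transition c d \<equiv> (\<lambda>u. snd d (chart_inv c u))"

definition mcarrier :: "('p, 'e) chart set \<Rightarrow> 'p set" where
  "mcarrier A = (\<Union>c\<in>A. fst c)"

definition smooth_atlas :: "('p, 'e::euclidean_space) chart set \<Rightarrow> bool" where
  "smooth_atlas A \<longleftrightarrow>
     (\<forall>c\<in>A. inj_on (snd c) (fst c) \<and> open (snd c ` fst c)) \<and>
     (\<forall>c\<in>A. \<forall>d\<in>A. open (snd c ` (fst c \<inter> fst d)) \<and>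
        smooth_on (snd c ` (fst c \<inter> fst d)) (transition c d))"

definition manifold_topology :: "('p, 'e::euclidean_space) chart set \<Rightarrow> 'p topology" where
  "manifold_topology A =
     topology (\<lambda>W. W \<subseteq> mcarrier A \<and> (\<forall>c\<in>A. open (snd c ` (W \<inter> fst c))))"

definition smooth_manifold :: "('p, 'e::euclidean_space) chart set \<Rightarrow> bool" where
  "smooth_manifold A \<longleftrightarrow> smooth_atlas A \<and>
     Hausdorff_space (manifold_topology A) \<and> second_countable (manifold_topology A)"

text \<open>An orientation of a surface is given by an atlas whose transition maps have positive Jacobian
  determinant; the charts of the atlas are the positive ones.\<close>

definition oriented_surface :: "('p, real^2) chart set \<Rightarrow> bool" where
  "oriented_surface A \<longleftrightarrow> smooth_manifold A \<and>
     (\<forall>c\<in>A. \<forall>d\<in>A. \<forall>u \<in> snd c ` (fst c \<inter> fst d). det (jacobian (transition c d) (at u)) > 0)"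

section \<open>Tangent vectors, curves and vector fields\<close>

text \<open>A tangent vector at \<open>x\<close> assigns to each chart of the atlas around \<open>x\<close> a coordinate vector, and
  the coordinate vectors are related by the differentials of the transition maps. The value at all
  other arguments is fixed to be \<open>0\<close>, so that equality of tangent vectors is equality of functions.\<close>

type_synonym ('p, 'e) tangent = "('p, 'e) chart \<Rightarrow> 'e"

definition tangent_space ::
    "('p, 'e::euclidean_space) chart set \<Rightarrow> 'p \<Rightarrow> ('p, 'e) tangent set" where
  "tangent_space A x = {v.
     (\<forall>c. \<not> (c \<in> A \<and> x \<in> fst c) \<longrightarrow> v c = 0) \<and>
     (\<forall>c\<in>A. \<forall>d\<in>A. x \<in> fst c \<inter> fst d \<longrightarrow>
        v d = frechet_derivative (transition c d) (at (snd c x)) (v c))}"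

text \<open>The tangent vector at \<open>x\<close> with coordinates \<open>e\<close> in the chart \<open>c\<close>.\<close>

definition coord_vec ::
    "('p, 'e::euclidean_space) chart set \<Rightarrow> ('p, 'e) chart \<Rightarrow> 'p \<Rightarrow> 'e \<Rightarrow> ('p, 'e) tangent" where
  "coord_vec A c x e = (\<lambda>d. if d \<in> A \<and> x \<in> fst d
     then frechet_derivative (transition c d) (at (snd c x)) e else 0)"

definition curve_interval :: "real set \<Rightarrow> bool" where
  "curve_interval I \<longleftrightarrow> is_interval I \<and> interior I \<noteq> {}"

definition smooth_curve ::
    "('p, 'e::euclidean_space) chart set \<Rightarrow> real set \<Rightarrow> (real \<Rightarrow> 'p) \<Rightarrow> bool" where
  "smooth_curve A I \<gamma> \<longleftrightarrow> continuous_map (top_of_set I) (manifold_topology A) \<gamma> \<and>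
     (\<forall>c\<in>A. smooth_on {t\<in>I. \<gamma> t \<in> fst c} (\<lambda>t. snd c (\<gamma> t)))"

definition velocity ::
    "('p, 'e::euclidean_space) chart set \<Rightarrow> real set \<Rightarrow> (real \<Rightarrow> 'p) \<Rightarrow> real \<Rightarrow> ('p, 'e) tangent" where
  "velocity A I \<gamma> t = (\<lambda>c. if c \<in> A \<and> \<gamma> t \<in> fst c
     then vector_derivative (\<lambda>s. snd c (\<gamma> s)) (at t within I) else 0)"

definition regular_curve ::
    "('p, 'e::euclidean_space) chart set \<Rightarrow> real set \<Rightarrow> (real \<Rightarrow> 'p) \<Rightarrow> bool" where
  "regular_curve A I \<gamma> \<longleftrightarrow> smooth_curve A I \<gamma> \<and> (\<forall>t\<in>I. velocity A I \<gamma> t \<noteq> 0)"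

definition smooth_vector_field ::
    "('p, 'e::euclidean_space) chart set \<Rightarrow> 'p set \<Rightarrow> ('p \<Rightarrow> ('p, 'e) tangent) \<Rightarrow> bool" where
  "smooth_vector_field A W X \<longleftrightarrow> openin (manifold_topology A) W \<and>
     (\<forall>p\<in>W. X p \<in> tangent_space A p) \<and>
     (\<forall>c\<in>A. smooth_on (snd c ` (W \<inter> fst c)) (\<lambda>u. X (chart_inv c u) c))"

definition integral_curve ::
    "('p, 'e::euclidean_space) chart set \<Rightarrow> ('p \<Rightarrow> ('p, 'e) tangent) \<Rightarrow> real set \<Rightarrow> (real \<Rightarrow> 'p) \<Rightarrow> bool"
  where
  "integral_curve A X I \<gamma> \<longleftrightarrow> smooth_curve A I \<gamma> \<and> (\<forall>t\<in>I. velocity A I \<gamma> t = X (\<gamma> t))"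

text \<open>In each chart $[X,Y] = DY(X) - DX(Y)$.\<close>

definition lie_bracket ::
    "('p, 'e::euclidean_space) chart set \<Rightarrow> ('p \<Rightarrow> ('p, 'e) tangent) \<Rightarrow> ('p \<Rightarrow> ('p, 'e) tangent)
       \<Rightarrow> 'p \<Rightarrow> ('p, 'e) tangent" where
  "lie_bracket A X Y p = (\<lambda>c. if c \<in> A \<and> p \<in> fst c
     then frechet_derivative (\<lambda>u. Y (chart_inv c u) c) (at (snd c p)) (X p c)
        - frechet_derivative (\<lambda>u. X (chart_inv c u) c) (at (snd c p)) (Y p c)
     else 0)"

section \<open>Distributions\<close>

definition smooth_distribution ::
    "('p, 'e::euclidean_space) chart set \<Rightarrow> nat \<Rightarrow> ('p \<Rightarrow> ('p, 'e) tangent set) \<Rightarrow> bool" where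
  "smooth_distribution A k D \<longleftrightarrow>
     (\<forall>p\<in>mcarrier A. subspace (D p) \<and> D p \<subseteq> tangent_space A p \<and> dim (D p) = k) \<and>
     (\<forall>p\<in>mcarrier A. \<exists>W X. p \<in> W \<and> (\<forall>i<k. smooth_vector_field A W (X i)) \<and>
        (\<forall>q\<in>W. D q = span ((\<lambda>i. X i q) ` {..<k})))"

definition local_section ::
    "('p, 'e::euclidean_space) chart set \<Rightarrow> ('p \<Rightarrow> ('p, 'e) tangent set) \<Rightarrow> 'p set
       \<Rightarrow> ('p \<Rightarrow> ('p, 'e) tangent) \<Rightarrow> bool" where
  "local_section A D W X \<longleftrightarrow> smooth_vector_field A W X \<and> (\<forall>p\<in>W. X p \<in> D p)"

text \<open>The fibre at \<open>p\<close> of $E + [D,E]$; brackets are taken of sections near \<open>p\<close>.\<close>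

definition bracket_sum ::
    "('p, 'e::euclidean_space) chart set \<Rightarrow> ('p \<Rightarrow> ('p, 'e) tangent set)
       \<Rightarrow> ('p \<Rightarrow> ('p, 'e) tangent set) \<Rightarrow> 'p \<Rightarrow> ('p, 'e) tangent set" where
  "bracket_sum A D E p = span (E p \<union>
     {lie_bracket A X Y p | X Y. \<exists>W. p \<in> W \<and> local_section A D W X \<and> local_section A E W Y})"

definition engel_distribution ::
    "('p, 'e::euclidean_space) chart set \<Rightarrow> ('p \<Rightarrow> ('p, 'e) tangent set) \<Rightarrow> bool" where
  "engel_distribution A D \<longleftrightarrow> smooth_manifold A \<and> DIM('e) = 4 \<and> smooth_distribution A 2 D \<and>
     (\<forall>p\<in>mcarrier A. dim (bracket_sum A D D p) = 3) \<and>
     (\<forall>p\<in>mcarrier A. dim (bracket_sum A D (bracket_sum A D D) p) = 4)"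

section \<open>Riemannian metrics and the Levi-Civita covariant derivative\<close>

type_synonym ('p, 'e) metric = "'p \<Rightarrow> ('p, 'e) tangent \<Rightarrow> ('p, 'e) tangent \<Rightarrow> real"

definition metric_coord ::
    "('p, 'e::euclidean_space) chart set \<Rightarrow> ('p, 'e) metric \<Rightarrow> ('p, 'e) chart \<Rightarrow> 'e \<Rightarrow> 'e \<Rightarrow> 'e \<Rightarrow> real"
  where
  "metric_coord A g c u v w =
     (let x = chart_inv c u in g x (coord_vec A c x v) (coord_vec A c x w))"

definition riemannian_metric ::
    "('p, 'e::euclidean_space) chart set \<Rightarrow> ('p, 'e) metric \<Rightarrow> bool" where
  "riemannian_metric A g \<longleftrightarrow>
     (\<forall>x\<in>mcarrier A. \<forall>u\<in>tangent_space A x. \<forall>v\<in>tangent_space A x.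
        g x u v = g x v u \<and>
        (\<forall>w\<in>tangent_space A x. g x (u + v) w = g x u w + g x v w) \<and>
        (\<forall>a. g x (a *\<^sub>R u) v = a * g x u v) \<and>
        (u \<noteq> 0 \<longrightarrow> g x u u > 0)) \<and>
     (\<forall>c\<in>A. \<forall>v w. smooth_on (snd c ` fst c) (\<lambda>u. metric_coord A g c u v w))"

text \<open>$\Gamma(v,w)$ has the components $\Gamma^k_{ij} v^i w^j$. The defining equation is
  $2 g_{kl}\Gamma^k_{ij} = \partial_i g_{jl} + \partial_j g_{il} - \partial_l g_{ij}$,
  contracted with $v^i w^j e^l$.\<close>

definition christoffel ::
    "('p, 'e::euclidean_space) chart set \<Rightarrow> ('p, 'e) metric \<Rightarrow> ('p, 'e) chart \<Rightarrow> 'e \<Rightarrow> 'e \<Rightarrow> 'e \<Rightarrow> 'e"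
  where
  "christoffel A g c u v w = (THE z. \<forall>e. 2 * metric_coord A g c u z e =
       frechet_derivative (\<lambda>u. metric_coord A g c u w e) (at u) v
     + frechet_derivative (\<lambda>u. metric_coord A g c u v e) (at u) w
     - frechet_derivative (\<lambda>u. metric_coord A g c u v w) (at u) e)"

text \<open>$(D_t V)^k = \dot V^k + \Gamma^k_{ij} \dot\gamma^i V^j$ for a vector field \<open>V\<close> along \<open>\<gamma>\<close>.\<close>

definition cov_deriv ::
    "('p, 'e::euclidean_space) chart set \<Rightarrow> ('p, 'e) metric \<Rightarrow> real set \<Rightarrow> (real \<Rightarrow> 'p)
       \<Rightarrow> (real \<Rightarrow> ('p, 'e) tangent) \<Rightarrow> real \<Rightarrow> ('p, 'e) tangent" where
  "cov_deriv A g I \<gamma> V t = (\<lambda>c. if c \<in> A \<and> \<gamma> t \<in> fst c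
     then vector_derivative (\<lambda>s. V s c) (at t within I)
        + christoffel A g c (snd c (\<gamma> t)) (velocity A I \<gamma> t c) (V t c)
     else 0)"

definition gnorm :: "('p, 'e) metric \<Rightarrow> 'p \<Rightarrow> ('p, 'e) tangent \<Rightarrow> real" where
  "gnorm g x v = sqrt (g x v v)"

text \<open>The orthogonal projection of \<open>v\<close> onto the orthogonal complement of \<open>u\<close>.\<close>

definition proj_perp ::
    "('p, 'e::euclidean_space) metric \<Rightarrow> 'p \<Rightarrow> ('p, 'e) tangent \<Rightarrow> ('p, 'e) tangent \<Rightarrow> ('p, 'e) tangent"
  where
  "proj_perp g x u v = v - (g x v u / g x u u) *\<^sub>R u"

section \<open>Curvature of curves, the lift and the distribution\<close>

definition normal_acceleration ::
    "('p, 'e::euclidean_space) chart set \<Rightarrow> ('p, 'e) metric \<Rightarrow> real set \<Rightarrow> (real \<Rightarrow> 'p) \<Rightarrow> real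
       \<Rightarrow> ('p, 'e) tangent" where
  "normal_acceleration A g I \<gamma> t =
     proj_perp g (\<gamma> t) (velocity A I \<gamma> t) (cov_deriv A g I \<gamma> (velocity A I \<gamma>) t)"

definition geodesic_curvature ::
    "('p, 'e::euclidean_space) chart set \<Rightarrow> ('p, 'e) metric \<Rightarrow> real set \<Rightarrow> (real \<Rightarrow> 'p) \<Rightarrow> real \<Rightarrow> real"
  where
  "geodesic_curvature A g I \<gamma> t =
     gnorm g (\<gamma> t) (normal_acceleration A g I \<gamma> t) / (gnorm g (\<gamma> t) (velocity A I \<gamma> t))\<^sup>2"

definition curvature_radius ::
    "('p, 'e::euclidean_space) chart set \<Rightarrow> ('p, 'e) metric \<Rightarrow> real set \<Rightarrow> (real \<Rightarrow> 'p) \<Rightarrow> real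
       \<Rightarrow> ('p, 'e) tangent" where
  "curvature_radius A g I \<gamma> t = (1 / geodesic_curvature A g I \<gamma> t) *\<^sub>R
     ((1 / gnorm g (\<gamma> t) (normal_acceleration A g I \<gamma> t)) *\<^sub>R normal_acceleration A g I \<gamma> t)"

definition curved_curve ::
    "('p, 'e::euclidean_space) chart set \<Rightarrow> ('p, 'e) metric \<Rightarrow> real set \<Rightarrow> (real \<Rightarrow> 'p) \<Rightarrow> bool" where
  "curved_curve A g I \<gamma> \<longleftrightarrow>
     regular_curve A I \<gamma> \<and> (\<forall>t\<in>I. geodesic_curvature A g I \<gamma> t \<noteq> 0)"

definition lift_curve ::
    "('p, 'e::euclidean_space) chart set \<Rightarrow> ('p, 'e) metric \<Rightarrow> real set \<Rightarrow> (real \<Rightarrow> 'p) \<Rightarrow> real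
       \<Rightarrow> 'p \<times> ('p, 'e) tangent" where
  "lift_curve A g I \<gamma> t = (\<gamma> t, curvature_radius A g I \<gamma> t)"

text \<open>The tangent bundle without its zero section, with the charts $(x, R) \mapsto (\phi(x), d\phi(R))$.\<close>

definition slit_chart ::
    "('p, 'e::euclidean_space) chart set \<Rightarrow> ('p, 'e) chart \<Rightarrow> ('p \<times> ('p, 'e) tangent, 'e \<times> 'e) chart"
  where
  "slit_chart A c =
     ({(x, R). x \<in> fst c \<and> R \<in> tangent_space A x \<and> R \<noteq> 0}, \<lambda>(x, R). (snd c x, R c))"

definition slit_bundle ::
    "('p, 'e::euclidean_space) chart set \<Rightarrow> ('p \<times> ('p, 'e) tangent, 'e \<times> 'e) chart set" where
  "slit_bundle A = slit_chart A ` A"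

definition radius_distribution ::
    "('p, 'e::euclidean_space) chart set \<Rightarrow> ('p, 'e) metric \<Rightarrow> 'p \<times> ('p, 'e) tangent
       \<Rightarrow> ('p \<times> ('p, 'e) tangent, 'e \<times> 'e) tangent set" where
  "radius_distribution A g p = span
     {velocity (slit_bundle A) {a<..<b} (lift_curve A g {a<..<b} \<gamma>) 0 | a b \<gamma>.
        a < 0 \<and> 0 < b \<and> curved_curve A g {a<..<b} \<gamma> \<and> lift_curve A g {a<..<b} \<gamma> 0 = p}"

section \<open>The two vector fields\<close>

definition positively_oriented ::
    "('p, real^2) chart set \<Rightarrow> 'p \<Rightarrow> ('p, real^2) tangent \<Rightarrow> ('p, real^2) tangent \<Rightarrow> bool" where
  "positively_oriented A x v w \<longleftrightarrow>
     (\<forall>c\<in>A. x \<in> fst c \<longrightarrow> det (vector [v c, w c] :: real^2^2) > 0)"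

definition rperp ::
    "('p, real^2) chart set \<Rightarrow> ('p, real^2) metric \<Rightarrow> 'p \<Rightarrow> ('p, real^2) tangent
       \<Rightarrow> ('p, real^2) tangent" where
  "rperp A g x R = (THE S. S \<in> tangent_space A x \<and> g x S R = 0 \<and>
     gnorm g x S = gnorm g x R \<and> positively_oriented A x R S)"

definition ode1 ::
    "('p, real^2) chart set \<Rightarrow> ('p, real^2) metric \<Rightarrow> real set \<Rightarrow> (real \<Rightarrow> 'p)
       \<Rightarrow> (real \<Rightarrow> ('p, real^2) tangent) \<Rightarrow> bool" where
  "ode1 A g I x R \<longleftrightarrow> (\<forall>t\<in>I.
     velocity A I x t = rperp A g (x t) (R t) \<and>
     cov_deriv A g I x R t = - rperp A g (x t) (R t))"

text \<open>Here \<open>x\<close> is constant, so that \<open>R\<close> is a curve in the fixed vector space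
  \<open>tangent_space A (x t)\<close>, whose derivative is computed in each coordinate.\<close>

definition ode2 ::
    "('p, real^2) chart set \<Rightarrow> real set \<Rightarrow> (real \<Rightarrow> 'p)
       \<Rightarrow> (real \<Rightarrow> ('p, real^2) tangent) \<Rightarrow> bool" where
  "ode2 A I x R \<longleftrightarrow> (\<forall>t\<in>I.
     velocity A I x t = 0 \<and>
     (\<lambda>c. vector_derivative (\<lambda>s. R s c) (at t within I)) = R t)"

text \<open>\<open>X\<close> is, up to values outside the manifold, the only smooth vector field whose integral curves
  are exactly the smooth curves satisfying \<open>P\<close>.\<close>

definition has_integral_curves ::
    "('p, 'e::euclidean_space) chart set \<Rightarrow> (real set \<Rightarrow> (real \<Rightarrow> 'p) \<Rightarrow> bool)
       \<Rightarrow> ('p \<Rightarrow> ('p, 'e) tangent) \<Rightarrow> bool" where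
  "has_integral_curves A P X \<longleftrightarrow> smooth_vector_field A (mcarrier A) X \<and>
     (\<forall>I \<gamma>. curve_interval I \<and> smooth_curve A I \<gamma> \<longrightarrow> (integral_curve A X I \<gamma> \<longleftrightarrow> P I \<gamma>))"

definition characterized_by_integral_curves ::
    "('p, 'e::euclidean_space) chart set \<Rightarrow> (real set \<Rightarrow> (real \<Rightarrow> 'p) \<Rightarrow> bool)
       \<Rightarrow> ('p \<Rightarrow> ('p, 'e) tangent) \<Rightarrow> bool" where
  "characterized_by_integral_curves A P X \<longleftrightarrow> has_integral_curves A P X \<and>
     (\<forall>Y. has_integral_curves A P Y \<longrightarrow> (\<forall>p\<in>mcarrier A. Y p = X p))"

end

theory Submission
  imports Defs
begin

text \<open>The proof describes tangent vectors of the slit bundle by the Levi-Civita connection. A tangent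
  vector at \<open>(x, R)\<close> has a horizontal part \<open>v\<close> and a vertical part \<open>w\<close> in the tangent space of the surface
  at \<open>x\<close>, and \<open>lift_vec x R v w\<close> is the vector with these parts. The velocity of a curve \<open>(\<gamma>, R)\<close> has the parts
  \<open>\<gamma>'\<close> and \<open>D\<^sub>tR\<close> (\<open>slit_velocity\<close>). That this is independent of the chart is the transformation law of the
  Christoffel symbols (\<open>christoffel_transition\<close>). Let \<open>P\<close> be \<open>R\<close> rotated by a quarter turn. The two fields
  of the theorem have the parts \<open>(P, -P)\<close> and \<open>(0, R)\<close>.

  \<^bold>\<open>Lifts.\<close> The radius of curvature \<open>R\<close> of a curve satisfies \<open>\<langle>\<gamma>', R\<rangle> = 0\<close> and \<open>\<langle>D\<^sub>t\<gamma>', R\<rangle> = |\<gamma>'|\<^sup>2\<close>. The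
  derivative of the first equation then says \<open>\<langle>\<gamma>', D\<^sub>tR\<rangle> = - |\<gamma>'|\<^sup>2\<close>, so that \<open>\<gamma>' = a P\<close> and \<open>D\<^sub>tR = b R - a P\<close>:
  the velocity of the lift is \<open>a f1 + b f2\<close> (\<open>lift_velocity_in_span\<close>). For a regular curve \<open>\<gamma>\<close> the argument can
  be reversed (\<open>tangent_curve_is_lift\<close>). The velocities of lifts fill the plane of \<open>f1\<close> and \<open>f2\<close> because the
  third derivative of \<open>\<gamma>\<close> at a point changes \<open>b\<close> and nothing else (\<open>osculating_curves\<close>).

  \<^bold>\<open>Brackets.\<close> Let \<open>D\<close> be the span of \<open>f1\<close> and \<open>f2\<close>. The field \<open>f2\<close> generates the dilations of the fibres, and in
  coordinates \<open>f1\<close> consists of parts of degree one and two in the fibre; therefore \<open>[f2, f1]\<close> is the field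
  \<open>f3\<close> with parts \<open>(P, 0)\<close> (\<open>bracket_vf2_vf1\<close>). The span of \<open>f1\<close>, \<open>f2\<close>, \<open>f3\<close> consists of the vectors whose
  horizontal part is orthogonal to \<open>R\<close>, and brackets of sections of \<open>D\<close> stay in it
  (\<open>bracket_of_sections\<close>). The bracket \<open>[f1, f3]\<close> leaves it, as its horizontal part is \<open>R\<close>: turning \<open>R\<close> twice
  gives \<open>-R\<close> (\<open>bracket_vf1_vf3_horizontal\<close>). So the ranks are 2, 3 and 4, whatever the curvature of the
  surface.

  \<^bold>\<open>Integral curves.\<close> By \<open>slit_velocity\<close> the two systems of equations describe the integral curves of \<open>f1\<close>
  and \<open>f2\<close>. They determine these fields because an integral curve starts at every point, by the
  theorem of Picard and Lindeloef (\<open>picard_local\<close>).\<close>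

section \<open>Calculus of smooth maps\<close>

text \<open>The points of such a set can be approached along every coordinate axis, which makes derivatives
  within the set unique. Open sets have this property, and so have relatively open parts of
  intervals, where derivatives at an endpoint are one-sided.\<close>

definition accessible :: "'a::euclidean_space set \<Rightarrow> bool" where
  "accessible S \<longleftrightarrow>
     (\<forall>x\<in>S. \<forall>i\<in>Basis. \<forall>e>0. \<exists>d. 0 < \<bar>d\<bar> \<and> \<bar>d\<bar> < e \<and> x + d *\<^sub>R i \<in> S)"

lemma accessible_open:
  assumes "open S"
  shows "accessible S"
  unfolding accessible_def
proof (intro ballI allI impI)
  fix x i :: 'a and e :: real
  assume x: "x \<in> S" and i: "i \<in> Basis" and e: "e > 0"
  obtain r where r: "r > 0" "ball x r \<subseteq> S"
    using assms x openE by blast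
  define d where "d = min r e / 2"
  have "d > 0" "d < e" "d < r" using r e by (auto simp: d_def)
  moreover have "x + d *\<^sub>R i \<in> ball x r"
    using \<open>d > 0\<close> \<open>d < r\<close> i by (simp add: dist_norm)
  ultimately show "\<exists>d. 0 < \<bar>d\<bar> \<and> \<bar>d\<bar> < e \<and> x + d *\<^sub>R i \<in> S"
    using r by (intro exI[of _ d]) auto
qed

lemma interval_not_singleton:
  fixes I :: "real set"
  assumes "curve_interval I" "t \<in> I" "e > 0"
  shows "\<exists>s\<in>I. s \<noteq> t \<and> \<bar>s - t\<bar> < e"
proof -
  from assms obtain y where "y \<in> interior I" by (auto simp: curve_interval_def)
  then obtain r where r: "r > 0" "ball y r \<subseteq> I"
    by (auto simp: mem_interior)
  then have "y \<in> I" "y + r/2 \<in> I" by (auto simp: dist_norm subset_eq)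
  then obtain z where z: "z \<in> I" "z \<noteq> t"
    using r(1) by (metis add_cancel_left_right half_gt_zero less_irrefl)
  define l where "l = min 1 (e / (2 * \<bar>z - t\<bar>))"
  have l: "0 < l" "l \<le> 1" "l * \<bar>z - t\<bar> < e"
    using assms(3) z by (auto simp: l_def min_def field_simps)
  define s where "s = t + l * (z - t)"
  have "s \<in> closed_segment t z"
    unfolding closed_segment_def s_def using l by (auto intro!: exI[of _ l] simp: algebra_simps)
  moreover have "convex I" using assms(1) by (simp add: curve_interval_def is_interval_convex_1)
  ultimately have "s \<in> I"
    using assms(2) z(1) closed_segment_subset by blast
  moreover have "s \<noteq> t" "\<bar>s - t\<bar> < e" using l z by (auto simp: s_def abs_mult)
  ultimately show ?thesis by blast
qed

lemma accessible_interval_part: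
  fixes I :: "real set"
  assumes "curve_interval I" "openin (top_of_set I) S"
  shows "accessible S"
  unfolding accessible_def
proof (intro ballI allI impI)
  fix x i and e :: real
  assume x: "x \<in> S" and i: "i \<in> (Basis :: real set)" and e: "e > 0"
  obtain r where r: "r > 0" "\<And>y. y \<in> I \<Longrightarrow> dist y x < r \<Longrightarrow> y \<in> S"
    using assms(2) x by (auto simp: openin_euclidean_subtopology_iff)
  have "x \<in> I" using assms(2) x openin_imp_subset by blast
  then obtain s where "s \<in> I" "s \<noteq> x" "\<bar>s - x\<bar> < min r e"
    using interval_not_singleton[OF assms(1), of x "min r e"] r e by auto
  then show "\<exists>d. 0 < \<bar>d\<bar> \<and> \<bar>d\<bar> < e \<and> x + d *\<^sub>R i \<in> S"
    using r i by (intro exI[of _ "s - x"]) (auto simp: dist_real_def)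
qed

lemma accessible_interval: "curve_interval I \<Longrightarrow> accessible I"
  by (rule accessible_interval_part) auto

lemma accessible_at_nontrivial:
  fixes S :: "real set"
  assumes "accessible S" "t \<in> S"
  shows "at t within S \<noteq> bot"
proof -
  have "t islimpt S"
    unfolding islimpt_approachable
  proof (intro allI impI)
    fix e :: real assume "0 < e"
    then obtain d where "0 < \<bar>d\<bar>" "\<bar>d\<bar> < e" "t + d *\<^sub>R 1 \<in> S"
      using assms(1)[unfolded accessible_def, rule_format, OF assms(2), of 1 e] by auto
    then show "\<exists>x'\<in>S. x' \<noteq> t \<and> dist x' t < e"
      by (intro bexI[of _ "t + d"]) (auto simp: dist_real_def)
  qed
  then show ?thesis by (simp add: trivial_limit_within)
qed

lemma frechet_derivative_within_eqI:
  assumes "accessible S" "x \<in> S" "(f has_derivative f') (at x within S)"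
  shows "frechet_derivative f (at x within S) = f'"
proof -
  have "(f has_derivative frechet_derivative f (at x within S)) (at x within S)"
    using assms(3) differentiableI frechet_derivative_works by blast
  then show ?thesis
    using frechet_derivative_unique_within assms unfolding accessible_def by blast
qed

lemma frechet_derivative_cong_within:
  assumes "x \<in> S" "\<And>y. y \<in> S \<Longrightarrow> f y = g y"
  shows "frechet_derivative f (at x within S) = frechet_derivative g (at x within S)"
proof -
  have "(f has_derivative D) (at x within S) \<longleftrightarrow> (g has_derivative D) (at x within S)" for D
    using has_derivative_transform[of x S f g D] has_derivative_transform[of x S g f D] assms by auto
  then show ?thesis by (simp add: frechet_derivative_def)
qed

lemma C_on_cong:
  assumes "\<And>x. x \<in> S \<Longrightarrow> f x = g x"
  shows "C_on k S f \<longleftrightarrow> C_on k S g"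
  using assms
proof (induction k arbitrary: f g)
  case 0
  then show ?case using continuous_on_cong by simp
next
  case (Suc k)
  have "f differentiable_on S \<longleftrightarrow> g differentiable_on S"
    using Suc.prems has_derivative_transform[of _ S f g] has_derivative_transform[of _ S g f]
    unfolding differentiable_on_def differentiable_def by metis
  moreover have "C_on k S (\<lambda>x. frechet_derivative f (at x within S) v) \<longleftrightarrow>
      C_on k S (\<lambda>x. frechet_derivative g (at x within S) v)" for v
  proof (rule Suc.IH)
    fix x assume "x \<in> S"
    then show "frechet_derivative f (at x within S) v = frechet_derivative g (at x within S) v"
      using frechet_derivative_cong_within Suc.prems by metis
  qed
  ultimately show ?case by simp
qed

lemma C_on_SucI:
  assumes "accessible S" "\<And>x. x \<in> S \<Longrightarrow> (f has_derivative f' x) (at x within S)"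
    and "\<And>v. C_on k S (\<lambda>x. f' x v)"
  shows "C_on (Suc k) S f"
proof -
  have "f differentiable_on S"
    using assms(2) by (auto simp: differentiable_on_def differentiable_def)
  moreover have "C_on k S (\<lambda>x. frechet_derivative f (at x within S) v)" for v
    by (subst C_on_cong[where g = "\<lambda>x. f' x v"])
       (use assms frechet_derivative_within_eqI in \<open>fastforce+\<close>)
  ultimately show ?thesis by simp
qed

lemma C_on_Suc_has_derivative:
  assumes "C_on (Suc k) S f" "x \<in> S"
  shows "(f has_derivative frechet_derivative f (at x within S)) (at x within S)"
  using assms by (auto simp: differentiable_on_def frechet_derivative_works)

lemma C_on_SucD: "C_on (Suc k) S f \<Longrightarrow> C_on k S (\<lambda>x. frechet_derivative f (at x within S) v)"
  by simp

lemma C_on_Suc_imp: "C_on (Suc k) S f \<Longrightarrow> C_on k S f"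
proof (induction k arbitrary: f)
  case 0
  then show ?case by (simp add: differentiable_imp_continuous_on)
next
  case (Suc k)
  have "C_on k S (\<lambda>x. frechet_derivative f (at x within S) v)" for v
    using Suc.IH C_on_SucD[OF Suc.prems] .
  moreover have "f differentiable_on S" using Suc.prems by simp
  ultimately show ?case by (subst C_on.simps) blast
qed

lemma C_on_const: "accessible S \<Longrightarrow> C_on k S (\<lambda>x. c)"
proof (induction k arbitrary: c)
  case (Suc k)
  show ?case
    by (rule C_on_SucI[where f' = "\<lambda>_ _. 0"]) (use Suc in auto)
qed simp

lemma C_on_linear:
  assumes "bounded_linear L" "accessible S" "C_on k S f"
  shows "C_on k S (\<lambda>x. L (f x))"
  using assms(3)
proof (induction k arbitrary: f)
  case 0
  then show ?case using assms(1) by (simp add: bounded_linear.continuous_on)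
next
  case (Suc k)
  show ?case
  proof (rule C_on_SucI[OF assms(2)])
    show "((\<lambda>x. L (f x)) has_derivative (\<lambda>h. L (frechet_derivative f (at x within S) h)))
        (at x within S)" if "x \<in> S" for x
      using bounded_linear.has_derivative[OF assms(1) C_on_Suc_has_derivative[OF Suc.prems that]] .
    show "C_on k S (\<lambda>x. L (frechet_derivative f (at x within S) v))" for v
      using Suc by simp
  qed
qed

lemma C_on_add:
  assumes "accessible S" "C_on k S f" "C_on k S g"
  shows "C_on k S (\<lambda>x. f x + g x)"
  using assms(2,3)
proof (induction k arbitrary: f g)
  case 0
  then show ?case by (simp add: continuous_on_add)
next
  case (Suc k)
  show ?case
  proof (rule C_on_SucI[OF assms(1)])
    show "((\<lambda>x. f x + g x) has_derivative (\<lambda>h. frechet_derivative f (at x within S) h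
         + frechet_derivative g (at x within S) h)) (at x within S)" if "x \<in> S" for x
      using C_on_Suc_has_derivative Suc.prems that by (blast intro: has_derivative_add)
    show "C_on k S (\<lambda>x. frechet_derivative f (at x within S) v + frechet_derivative g (at x within S) v)"
      for v using Suc by simp
  qed
qed

lemma C_on_bilinear:
  assumes "bounded_bilinear P" "accessible S" "C_on k S f" "C_on k S g"
  shows "C_on k S (\<lambda>x. P (f x) (g x))"
  using assms(3,4)
proof (induction k arbitrary: f g)
  case 0
  then show ?case using assms(1) by (simp add: bounded_bilinear.continuous_on)
next
  case (Suc k)
  show ?case
  proof (rule C_on_SucI[OF assms(2)])
    show "((\<lambda>x. P (f x) (g x)) has_derivative (\<lambda>h. P (f x) (frechet_derivative g (at x within S) h)
         + P (frechet_derivative f (at x within S) h) (g x))) (at x within S)" if "x \<in> S" for x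
      using bounded_bilinear.FDERIV[OF assms(1) C_on_Suc_has_derivative[OF Suc.prems(1) that]
          C_on_Suc_has_derivative[OF Suc.prems(2) that]] .
    show "C_on k S (\<lambda>x. P (f x) (frechet_derivative g (at x within S) v)
         + P (frechet_derivative f (at x within S) v) (g x))" for v
      by (intro C_on_add[OF assms(2)] Suc.IH C_on_Suc_imp[OF Suc.prems(1)]
          C_on_Suc_imp[OF Suc.prems(2)] C_on_SucD[OF Suc.prems(1)] C_on_SucD[OF Suc.prems(2)])
  qed
qed

lemma C_on_sum:
  assumes "accessible S" "finite B" "\<And>b. b \<in> B \<Longrightarrow> C_on k S (f b)"
  shows "C_on k S (\<lambda>x. \<Sum>b\<in>B. f b x)"
  using assms(2,3)
  by (induction B rule: finite_induct) (auto intro: C_on_const C_on_add assms(1))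

lemma linear_basis_expansion:
  fixes L :: "'a::euclidean_space \<Rightarrow> 'b::real_vector"
  assumes "linear L"
  shows "L v = (\<Sum>b\<in>Basis. (v \<bullet> b) *\<^sub>R L b)"
  using linear_sum[OF assms, of "\<lambda>b. (v \<bullet> b) *\<^sub>R b" Basis] linear_scale[OF assms]
  by (simp add: euclidean_representation)

text \<open>Expanding \<open>g'\<close> in a basis turns the derivative of the composition into a sum of products of
  coordinates of \<open>f'\<close> with compositions of a less often differentiated function with \<open>f\<close>, so that
  the induction goes through.\<close>

lemma C_on_compose:
  fixes f :: "'a::euclidean_space \<Rightarrow> 'b::euclidean_space"
  assumes "accessible S" "C_on k S f" "C_on k T g" "f ` S \<subseteq> T"
  shows "C_on k S (\<lambda>x. g (f x))"
  using assms(2,3)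
proof (induction k arbitrary: g)
  case 0
  then show ?case using assms(4) by (auto intro: continuous_on_compose2)
next
  case (Suc k)
  let ?f' = "\<lambda>x. frechet_derivative f (at x within S)"
  let ?g' = "\<lambda>x. frechet_derivative g (at x within T)"
  have g': "(g has_derivative ?g' (f x)) (at (f x) within T)" if "x \<in> S" for x
    using C_on_Suc_has_derivative[OF Suc.prems(2)] assms(4) that by auto
  have lin: "linear (?g' (f x))" if "x \<in> S" for x
    using g'[OF that] has_derivative_linear by blast
  show ?case
  proof (rule C_on_SucI[OF assms(1)])
    show "((\<lambda>x. g (f x)) has_derivative (\<lambda>h. \<Sum>b\<in>Basis. (?f' x h \<bullet> b) *\<^sub>R ?g' (f x) b))
       (at x within S)" if "x \<in> S" for x
    proof -
      have "((\<lambda>x. g (f x)) has_derivative (\<lambda>h. ?g' (f x) (?f' x h))) (at x within S)"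
        by (rule has_derivative_in_compose[OF C_on_Suc_has_derivative[OF Suc.prems(1) that]
              has_derivative_subset[OF g'[OF that] assms(4)]])
      then show ?thesis by (subst (asm) linear_basis_expansion[OF lin[OF that]])
    qed
    have "C_on k S (\<lambda>x. ?g' (f x) b)" for b
      by (rule Suc.IH[OF C_on_Suc_imp[OF Suc.prems(1)] C_on_SucD[OF Suc.prems(2)]])
    moreover have "C_on k S (\<lambda>x. ?f' x v \<bullet> b)" for v b
      by (rule C_on_linear[OF bounded_linear_inner_left assms(1) C_on_SucD[OF Suc.prems(1)]])
    ultimately show "C_on k S (\<lambda>x. \<Sum>b\<in>Basis. (?f' x v \<bullet> b) *\<^sub>R ?g' (f x) b)" for v
      by (intro C_on_sum[OF assms(1)] C_on_bilinear[OF bounded_bilinear_scaleR assms(1)] finite_Basis)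
  qed
qed

lemma C_on_ident: "accessible S \<Longrightarrow> C_on k S (\<lambda>x. x)"
proof (cases k)
  case (Suc j)
  assume "accessible S"
  then show ?thesis unfolding Suc
    by (intro C_on_SucI[where f' = "\<lambda>_ h. h"] C_on_const) auto
qed simp


lemma smooth_on_cong:
  "(\<And>x. x \<in> S \<Longrightarrow> f x = g x) \<Longrightarrow> smooth_on S f \<longleftrightarrow> smooth_on S g"
  unfolding smooth_on_def using C_on_cong by blast

lemma smooth_on_eq:
  "smooth_on S f \<Longrightarrow> (\<And>x. x \<in> S \<Longrightarrow> g x = f x) \<Longrightarrow> smooth_on S g"
  using smooth_on_cong[of S g f] by blast

lemma smooth_on_const: "accessible S \<Longrightarrow> smooth_on S (\<lambda>x. c)"
  by (simp add: smooth_on_def C_on_const)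

lemma smooth_on_ident: "accessible S \<Longrightarrow> smooth_on S (\<lambda>x. x)"
  by (simp add: smooth_on_def C_on_ident)

lemma smooth_on_linear:
  "bounded_linear L \<Longrightarrow> accessible S \<Longrightarrow> smooth_on S f \<Longrightarrow> smooth_on S (\<lambda>x. L (f x))"
  by (simp add: smooth_on_def C_on_linear)

lemma smooth_on_add:
  "accessible S \<Longrightarrow> smooth_on S f \<Longrightarrow> smooth_on S g \<Longrightarrow> smooth_on S (\<lambda>x. f x + g x)"
  by (simp add: smooth_on_def C_on_add)

lemma smooth_on_minus:
  "accessible S \<Longrightarrow> smooth_on S f \<Longrightarrow> smooth_on S (\<lambda>x. - f x)"
  by (rule smooth_on_linear[OF bounded_linear_minus[OF bounded_linear_ident]])

lemma smooth_on_diff: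
  "accessible S \<Longrightarrow> smooth_on S f \<Longrightarrow> smooth_on S g \<Longrightarrow> smooth_on S (\<lambda>x. f x - g x)"
  using smooth_on_add[of S f "\<lambda>x. - g x"] smooth_on_minus by fastforce

lemma smooth_on_bilinear:
  "bounded_bilinear P \<Longrightarrow> accessible S \<Longrightarrow> smooth_on S f \<Longrightarrow> smooth_on S g
    \<Longrightarrow> smooth_on S (\<lambda>x. P (f x) (g x))"
  by (simp add: smooth_on_def C_on_bilinear)

lemmas smooth_on_scaleR = smooth_on_bilinear[OF bounded_bilinear_scaleR]
lemmas smooth_on_mult = smooth_on_bilinear[OF bounded_bilinear_mult]
lemmas smooth_on_inner = smooth_on_bilinear[OF bounded_bilinear_inner]

lemma smooth_on_sum:
  "accessible S \<Longrightarrow> finite B \<Longrightarrow> (\<And>b. b \<in> B \<Longrightarrow> smooth_on S (f b))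
    \<Longrightarrow> smooth_on S (\<lambda>x. \<Sum>b\<in>B. f b x)"
  by (simp add: smooth_on_def C_on_sum)

lemma smooth_on_Pair:
  assumes "accessible S" "smooth_on S f" "smooth_on S g"
  shows "smooth_on S (\<lambda>x. (f x, g x))"
proof -
  have "smooth_on S (\<lambda>x. (f x, 0))"
    using smooth_on_linear[OF bounded_linear_Pair[OF bounded_linear_ident bounded_linear_zero] assms(1,2)] .
  moreover have "smooth_on S (\<lambda>x. (0, g x))"
    using smooth_on_linear[OF bounded_linear_Pair[OF bounded_linear_zero bounded_linear_ident] assms(1,3)] .
  ultimately show ?thesis
    using smooth_on_add[OF assms(1), of "\<lambda>x. (f x, 0)" "\<lambda>x. (0, g x)"] by simp
qed

lemma smooth_on_compose:
  fixes f :: "'a::euclidean_space \<Rightarrow> 'b::euclidean_space"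
  assumes "smooth_on T g" "smooth_on S f" "accessible S" "f ` S \<subseteq> T"
  shows "smooth_on S (\<lambda>x. g (f x))"
  unfolding smooth_on_def
proof
  fix k
  have "C_on k S f" using assms(2) unfolding smooth_on_def by (rule spec)
  moreover have "C_on k T g" using assms(1) unfolding smooth_on_def by (rule spec)
  ultimately show "C_on k S (\<lambda>x. g (f x))" by (rule C_on_compose[OF assms(3) _ _ assms(4)])
qed

lemma smooth_on_subset:
  assumes "smooth_on T f" "S \<subseteq> T" "accessible S"
  shows "smooth_on S f"
  using smooth_on_compose[OF assms(1) smooth_on_ident[OF assms(3)] assms(3)] assms(2) by simp

lemma smooth_on_has_derivative:
  assumes "smooth_on S f" "x \<in> S"
  shows "(f has_derivative frechet_derivative f (at x within S)) (at x within S)"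
proof (rule C_on_Suc_has_derivative[OF _ assms(2)])
  show "C_on (Suc 0) S f" using assms(1) unfolding smooth_on_def by (rule spec)
qed

lemma smooth_on_continuous_on:
  assumes "smooth_on S f"
  shows "continuous_on S f"
proof -
  have "C_on 0 S f" using assms unfolding smooth_on_def by (rule spec)
  then show ?thesis by simp
qed

lemma smooth_on_frechet_derivative_within:
  assumes "smooth_on S f"
  shows "smooth_on S (\<lambda>x. frechet_derivative f (at x within S) v)"
  unfolding smooth_on_def
proof
  fix k
  have "C_on (Suc k) S f" using assms unfolding smooth_on_def by (rule spec)
  then show "C_on k S (\<lambda>x. frechet_derivative f (at x within S) v)" by (rule C_on_SucD)
qed

lemma smooth_on_frechet_derivative:
  assumes "smooth_on S f" "open S"
  shows "smooth_on S (\<lambda>x. frechet_derivative f (at x) v)"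
proof (rule smooth_on_eq[OF smooth_on_frechet_derivative_within[OF assms(1), of v]])
  show "frechet_derivative f (at x) v = frechet_derivative f (at x within S) v" if "x \<in> S" for x
    by (simp only: at_within_open[OF that assms(2)])
qed

lemma smooth_on_has_derivative_at:
  assumes "smooth_on S f" "open S" "x \<in> S"
  shows "(f has_derivative frechet_derivative f (at x)) (at x)"
  using smooth_on_has_derivative[OF assms(1,3)] by (simp only: at_within_open[OF assms(3,2)])

lemma smooth_on_vector_derivative:
  fixes f :: "real \<Rightarrow> 'b::real_normed_vector"
  assumes "smooth_on S f" "accessible S"
  shows "smooth_on S (\<lambda>t. vector_derivative f (at t within S))"
proof -
  have *: "vector_derivative f (at t within S) = frechet_derivative f (at t within S) 1" if tS: "t \<in> S" for t
  proof -
    obtain D where D: "(f has_derivative D) (at t within S)"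
      using smooth_on_has_derivative[OF assms(1) tS] by blast
    have lin: "linear D" using D has_derivative_linear by blast
    have vd: "(f has_vector_derivative D 1) (at t within S)"
    proof -
      have "D = (\<lambda>h. h *\<^sub>R D 1)"
      proof
        fix h show "D h = h *\<^sub>R D 1" using linear_scale[OF lin, of h 1] by simp
      qed
      then show ?thesis
        unfolding has_vector_derivative_def
        by (rule arg_cong[of D _ "\<lambda>E. (f has_derivative E) (at t within S)", THEN iffD1, OF _ D])
    qed
    have "vector_derivative f (at t within S) = D 1"
      by (rule vector_derivative_within[OF accessible_at_nontrivial[OF assms(2) tS] vd])
    then show ?thesis using frechet_derivative_within_eqI[OF assms(2) tS D] by simp
  qed
  show ?thesis
    by (rule smooth_on_eq[OF smooth_on_frechet_derivative_within[OF assms(1), of 1]]) (rule *)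
qed

text \<open>A function whose derivative is as regular as the function itself gains one derivative after the
  other. This applies to solutions of differential equations, such as \<open>inverse\<close>, \<open>sqrt\<close> and integral
  curves.\<close>

lemma smooth_on_bootstrap:
  assumes "accessible S" "\<And>x. x \<in> S \<Longrightarrow> (f has_derivative f' x) (at x within S)"
    and "\<And>k. C_on k S f \<Longrightarrow> (\<And>v. C_on k S (\<lambda>x. f' x v))"
  shows "smooth_on S f"
  unfolding smooth_on_def
proof
  fix k show "C_on k S f"
  proof (induction k)
    case 0
    have "continuous_on S f"
      unfolding continuous_on_eq_continuous_within
      using has_derivative_continuous[OF assms(2)] by auto
    then show ?case by simp
  next
    case (Suc k)
    show ?case by (rule C_on_SucI[OF assms(1,2) assms(3)[OF Suc]])
  qed
qed

lemma smooth_on_inverse_real: "smooth_on (-{0}) (inverse :: real \<Rightarrow> real)"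
proof (rule smooth_on_bootstrap)
  show acc: "accessible (-{0::real})" by (rule accessible_open) auto
  show "(inverse has_derivative (\<lambda>h. - (inverse x * h * inverse x))) (at x within -{0})"
    if "x \<in> -{0}" for x :: real
    by (rule has_derivative_at_withinI, rule has_derivative_inverse') (use that in simp)
  show "C_on k (-{0}) (\<lambda>x. - (inverse x * v * inverse x))" if "C_on k (-{0}) (inverse :: real \<Rightarrow> real)"
    for k and v :: real
  proof -
    have "C_on k (-{0}) (\<lambda>x. inverse x * v)"
      by (rule C_on_bilinear[OF bounded_bilinear_mult acc that]) (rule C_on_const[OF acc])
    then have "C_on k (-{0}) (\<lambda>x. inverse x * v * inverse x)"
      by (rule C_on_bilinear[OF bounded_bilinear_mult acc]) (rule that)
    then show ?thesis
      by (rule C_on_linear[OF bounded_linear_minus[OF bounded_linear_ident] acc])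
  qed
qed

lemma smooth_on_divide:
  fixes f g :: "'a::euclidean_space \<Rightarrow> real"
  assumes "accessible S" "smooth_on S f" "smooth_on S g" "\<And>x. x \<in> S \<Longrightarrow> g x \<noteq> 0"
  shows "smooth_on S (\<lambda>x. f x / g x)"
proof -
  have "g ` S \<subseteq> -{0}" using assms(4) by auto
  then have "smooth_on S (\<lambda>x. inverse (g x))"
    by (rule smooth_on_compose[OF smooth_on_inverse_real assms(3,1)])
  then have "smooth_on S (\<lambda>x. f x * inverse (g x))"
    by (rule smooth_on_mult[OF assms(1,2)])
  then show ?thesis unfolding divide_inverse .
qed

lemma smooth_on_sqrt_real: "smooth_on {0<..} (sqrt :: real \<Rightarrow> real)"
proof (rule smooth_on_bootstrap)
  show acc: "accessible {0::real<..}" by (rule accessible_open) auto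
  show "(sqrt has_derivative (\<lambda>h. h * (inverse (sqrt x) / 2))) (at x within {0<..})"
    if "x \<in> {0<..}" for x :: real
  proof -
    have "(sqrt has_derivative (\<lambda>h. inverse (sqrt x) / 2 * h)) (at x)"
      using DERIV_real_sqrt[of x] that unfolding has_field_derivative_def by (simp del: times_divide_eq_left)
    then show ?thesis
      by (simp only: mult.commute[of "inverse (sqrt x) / 2"] has_derivative_at_withinI)
  qed
  show "C_on k {0<..} (\<lambda>x. v * (inverse (sqrt x) / 2))" if k: "C_on k {0<..} sqrt"
    for k and v :: real
  proof -
    have "C_on k {0<..} (\<lambda>x. inverse (sqrt x))"
      by (rule C_on_compose[OF acc k smooth_on_inverse_real[unfolded smooth_on_def, THEN spec]]) auto
    then have "C_on k {0<..} (\<lambda>x. (v / 2) * inverse (sqrt x))"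
      by (intro C_on_bilinear[OF bounded_bilinear_mult acc] C_on_const[OF acc])
    moreover have "(\<lambda>x. (v / 2) * inverse (sqrt x)) = (\<lambda>x. v * (inverse (sqrt x) / 2))"
      by (rule ext) simp
    ultimately show ?thesis by (rule subst[rotated])
  qed
qed

text \<open>A family of linear maps is a finite combination of its values on a basis.\<close>

lemma smooth_on_linear_family:
  fixes V :: "'x::euclidean_space \<Rightarrow> 'a::euclidean_space"
  assumes "accessible S" "\<And>b. b \<in> Basis \<Longrightarrow> smooth_on S (\<lambda>s. Q s b)"
    and "\<And>s. s \<in> S \<Longrightarrow> linear (Q s)" and "smooth_on S V"
  shows "smooth_on S (\<lambda>s. Q s (V s))"
proof -
  have "smooth_on S (\<lambda>s. \<Sum>b\<in>Basis. (V s \<bullet> b) *\<^sub>R Q s b)"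
    by (intro smooth_on_sum[OF assms(1) finite_Basis] smooth_on_scaleR[OF assms(1)]
        smooth_on_inner[OF assms(1,4)] smooth_on_const[OF assms(1)] assms(2))
  then show ?thesis
    by (rule smooth_on_eq) (rule linear_basis_expansion[OF assms(3)])
qed

text \<open>Write \<open>Q s (V s) = Q s (V s0) + Q s (V s - V s0)\<close>. The first summand differentiates the family at
  a fixed vector; in the second, expanded in a basis, the coefficients vanish at \<open>s0\<close>, so that only
  their derivatives survive.\<close>

lemma has_derivative_linear_family:
  fixes V :: "'x::real_normed_vector \<Rightarrow> 'a::euclidean_space"
    and Q :: "'x \<Rightarrow> 'a \<Rightarrow> 'b::real_normed_vector"
  assumes Q: "\<And>v. ((\<lambda>s. Q s v) has_derivative Q' v) (at s0 within S)"
    and lin: "\<And>s. s \<in> S \<Longrightarrow> linear (Q s)" and s0: "s0 \<in> S"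
    and V: "(V has_derivative V') (at s0 within S)"
  shows "((\<lambda>s. Q s (V s)) has_derivative (\<lambda>h. Q' (V s0) h + Q s0 (V' h))) (at s0 within S)"
proof -
  have "((\<lambda>s. Q s (V s0) + (\<Sum>b\<in>Basis. ((V s - V s0) \<bullet> b) *\<^sub>R Q s b)) has_derivative
     (\<lambda>h. Q' (V s0) h + (\<Sum>b\<in>Basis. ((V s0 - V s0) \<bullet> b) *\<^sub>R Q' b h + ((V' h - 0) \<bullet> b) *\<^sub>R Q s0 b)))
     (at s0 within S)"
    by (intro has_derivative_add Q has_derivative_sum has_derivative_scaleR
        has_derivative_inner_left has_derivative_diff V has_derivative_const)
  then have *: "((\<lambda>s. Q s (V s0) + Q s (V s - V s0)) has_derivative
      (\<lambda>h. Q' (V s0) h + Q s0 (V' h))) (at s0 within S)"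
  proof -
    have rhs: "(\<lambda>h. Q' (V s0) h + (\<Sum>b\<in>Basis. ((V s0 - V s0) \<bullet> b) *\<^sub>R Q' b h
        + ((V' h - 0) \<bullet> b) *\<^sub>R Q s0 b)) = (\<lambda>h. Q' (V s0) h + Q s0 (V' h))"
      by (rule ext) (simp add: linear_basis_expansion[OF lin[OF s0], symmetric])
    have *: "Q s (V s0) + Q s (V s - V s0) = Q s (V s0) + (\<Sum>b\<in>Basis. ((V s - V s0) \<bullet> b) *\<^sub>R Q s b)"
      if "s \<in> S" for s
      by (simp add: linear_basis_expansion[OF lin[OF that], of "V s - V s0", symmetric])
    assume D: "((\<lambda>s. Q s (V s0) + (\<Sum>b\<in>Basis. ((V s - V s0) \<bullet> b) *\<^sub>R Q s b)) has_derivative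
     (\<lambda>h. Q' (V s0) h + (\<Sum>b\<in>Basis. ((V s0 - V s0) \<bullet> b) *\<^sub>R Q' b h + ((V' h - 0) \<bullet> b) *\<^sub>R Q s0 b)))
     (at s0 within S)"
    show ?thesis
      by (rule has_derivative_transform[OF s0 _ D[unfolded rhs]]) (rule *)
  qed
  show ?thesis
  proof (rule has_derivative_transform[OF s0 _ *])
    show "Q s (V s) = Q s (V s0) + Q s (V s - V s0)" if "s \<in> S" for s
      by (simp add: linear_add[OF lin[OF that], symmetric])
  qed
qed

subsection \<open>Symmetry of second derivatives\<close>

text \<open>The mean value theorem, first in the direction \<open>v\<close> and then in the direction \<open>w\<close>.\<close>

lemma second_difference_mean_value:
  fixes f :: "'a::real_normed_vector \<Rightarrow> real"
  assumes F: "\<And>u. u \<in> ball x r \<Longrightarrow> (f has_derivative F u) (at u)"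
    and G: "\<And>u. u \<in> ball x r \<Longrightarrow> ((\<lambda>u. F u v) has_derivative G u) (at u)"
    and t: "0 < t" "t * (norm v + norm w) < r"
  shows "\<exists>\<xi>. dist x \<xi> \<le> t * (norm v + norm w) \<and>
     f (x + t *\<^sub>R v + t *\<^sub>R w) - f (x + t *\<^sub>R v) - f (x + t *\<^sub>R w) + f x = t * t * G \<xi> w"
proof -
  have dst: "dist x (x + a *\<^sub>R v + b *\<^sub>R w) \<le> t * (norm v + norm w)"
    if "0 \<le> a" "a \<le> t" "0 \<le> b" "b \<le> t" for a b
  proof -
    have "norm (a *\<^sub>R v + b *\<^sub>R w) \<le> a * norm v + b * norm w"
      using norm_triangle_ineq[of "a *\<^sub>R v" "b *\<^sub>R w"] that by simp
    also have "\<dots> \<le> t * norm v + t * norm w"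
      using that by (intro add_mono mult_right_mono) auto
    finally show ?thesis by (simp add: dist_norm algebra_simps norm_minus_commute)
  qed
  then have ball: "x + a *\<^sub>R v + b *\<^sub>R w \<in> ball x r" if "0 \<le> a" "a \<le> t" "0 \<le> b" "b \<le> t" for a b
    using that t(2) by fastforce
  define \<phi> where "\<phi> = (\<lambda>a. f (x + a *\<^sub>R v + t *\<^sub>R w) - f (x + a *\<^sub>R v))"
  have d1: "((\<lambda>a. f (x + a *\<^sub>R v + b *\<^sub>R w)) has_real_derivative F (x + a *\<^sub>R v + b *\<^sub>R w) v) (at a)"
    if "0 \<le> a" "a \<le> t" "0 \<le> b" "b \<le> t" for a b
  proof -
    have "((\<lambda>a. f (x + a *\<^sub>R v + b *\<^sub>R w)) has_derivative
        (\<lambda>h. F (x + a *\<^sub>R v + b *\<^sub>R w) (h *\<^sub>R v))) (at a)"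
      by (rule has_derivative_compose[where f = "\<lambda>a. x + a *\<^sub>R v + b *\<^sub>R w" and g = f, OF _ F[OF ball[OF that]]])
         (auto intro!: derivative_eq_intros)
    moreover have "F (x + a *\<^sub>R v + b *\<^sub>R w) (h *\<^sub>R v) = h * F (x + a *\<^sub>R v + b *\<^sub>R w) v" for h
      using linear_scale[OF has_derivative_linear[OF F[OF ball[OF that]]]] by simp
    ultimately show ?thesis by (simp add: has_field_derivative_def mult.commute[of _ "F _ _"])
  qed
  have "(\<phi> has_real_derivative F (x + a *\<^sub>R v + t *\<^sub>R w) v - F (x + a *\<^sub>R v) v) (at a)"
    if "0 \<le> a" "a \<le> t" for a
    unfolding \<phi>_def using d1[OF that, of t] d1[OF that, of 0] t by (intro DERIV_diff) auto
  then obtain a where a: "0 < a" "a < t"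
    "\<phi> t - \<phi> 0 = (t - 0) * (F (x + a *\<^sub>R v + t *\<^sub>R w) v - F (x + a *\<^sub>R v) v)"
    using MVT2[OF t(1), of \<phi> "\<lambda>a. F (x + a *\<^sub>R v + t *\<^sub>R w) v - F (x + a *\<^sub>R v) v"] by auto
  have "((\<lambda>b. F (x + a *\<^sub>R v + b *\<^sub>R w) v) has_real_derivative G (x + a *\<^sub>R v + b *\<^sub>R w) w) (at b)"
    if "0 \<le> b" "b \<le> t" for b
  proof -
    have ba: "x + a *\<^sub>R v + b *\<^sub>R w \<in> ball x r" using ball a that by auto
    have "((\<lambda>b. F (x + a *\<^sub>R v + b *\<^sub>R w) v) has_derivative
        (\<lambda>h. G (x + a *\<^sub>R v + b *\<^sub>R w) (h *\<^sub>R w))) (at b)"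
      by (rule has_derivative_compose[where f = "\<lambda>b. x + a *\<^sub>R v + b *\<^sub>R w" and g = "\<lambda>u. F u v", OF _ G[OF ba]])
         (auto intro!: derivative_eq_intros)
    moreover have "G (x + a *\<^sub>R v + b *\<^sub>R w) (h *\<^sub>R w) = h * G (x + a *\<^sub>R v + b *\<^sub>R w) w" for h
      using linear_scale[OF has_derivative_linear[OF G[OF ba]]] by simp
    ultimately show ?thesis by (simp add: has_field_derivative_def mult.commute[of _ "G _ _"])
  qed
  then obtain b where b: "0 < b" "b < t"
    "F (x + a *\<^sub>R v + t *\<^sub>R w) v - F (x + a *\<^sub>R v + 0 *\<^sub>R w) v = (t - 0) * G (x + a *\<^sub>R v + b *\<^sub>R w) w"
    using MVT2[OF t(1), of "\<lambda>b. F (x + a *\<^sub>R v + b *\<^sub>R w) v" "\<lambda>b. G (x + a *\<^sub>R v + b *\<^sub>R w) w"] by auto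
  have "\<phi> t - \<phi> 0 = t * t * G (x + a *\<^sub>R v + b *\<^sub>R w) w" using a(3) b(3) by simp
  then show ?thesis
    using dst[of a b] a b by (intro exI[of _ "x + a *\<^sub>R v + b *\<^sub>R w"]) (auto simp: \<phi>_def)
qed

text \<open>The second difference is symmetric in \<open>v\<close> and \<open>w\<close>. By the preceding lemma it is \<open>t\<^sup>2\<close> times either of
  the two mixed derivatives, taken at points that tend to \<open>x\<close> with \<open>t\<close>.\<close>

lemma symmetric_second_derivative_real:
  fixes f :: "'a::euclidean_space \<Rightarrow> real"
  assumes sm: "smooth_on S f" and S: "open S" "x \<in> S"
  shows "frechet_derivative (\<lambda>u. frechet_derivative f (at u) v) (at x) w
       = frechet_derivative (\<lambda>u. frechet_derivative f (at u) w) (at x) v"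
proof -
  let ?F = "\<lambda>u. frechet_derivative f (at u)"
  let ?G = "\<lambda>v u. frechet_derivative (\<lambda>u. ?F u v) (at u)"
  obtain r where r: "r > 0" "ball x r \<subseteq> S" using S openE by blast
  have F: "(f has_derivative ?F u) (at u)" if "u \<in> ball x r" for u
    using smooth_on_has_derivative_at[OF sm S(1)] r that by blast
  have G: "((\<lambda>u. ?F u v) has_derivative ?G v u) (at u)" if "u \<in> ball x r" for u v
    using smooth_on_has_derivative_at[OF smooth_on_frechet_derivative[OF sm S(1)] S(1)] r that by blast
  have cont: "continuous (at x) (\<lambda>u. ?G v u w)" for v w
    using smooth_on_continuous_on[OF smooth_on_frechet_derivative[OF smooth_on_frechet_derivative[OF sm S(1)] S(1)]]
      S continuous_on_eq_continuous_at by blast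
  have "\<bar>?G v x w - ?G w x v\<bar> < e" if e: "e > 0" for e
  proof -
    obtain d1 where d1: "d1 > 0" "\<And>u. dist u x < d1 \<Longrightarrow> dist (?G v u w) (?G v x w) < e / 2"
      using cont[of v w] e unfolding continuous_at_eps_delta by (metis half_gt_zero)
    obtain d2 where d2: "d2 > 0" "\<And>u. dist u x < d2 \<Longrightarrow> dist (?G w u v) (?G w x v) < e / 2"
      using cont[of w v] e unfolding continuous_at_eps_delta by (metis half_gt_zero)
    define m where "m = min r (min d1 d2)"
    have m: "m > 0" using r d1 d2 by (simp add: m_def)
    define t where "t = m / (2 * (norm v + norm w + 1))"
    have n: "norm v + norm w + 1 > 0" by (smt (verit) norm_ge_zero)
    have t: "t > 0" using m n by (simp add: t_def)
    have tm: "t * (norm v + norm w) < m"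
    proof -
      have "t * (norm v + norm w) \<le> t * (norm v + norm w + 1)" using t by simp
      also have "\<dots> = m / 2" unfolding t_def using n by (simp only: times_divide_eq_left) (simp add: divide_simps)
      finally show ?thesis using m by simp
    qed
    have tr: "t * (norm v + norm w) < r" "t * (norm w + norm v) < r"
      using tm by (auto simp: m_def algebra_simps)
    obtain \<xi> where \<xi>: "dist x \<xi> \<le> t * (norm v + norm w)"
      "f (x + t *\<^sub>R v + t *\<^sub>R w) - f (x + t *\<^sub>R v) - f (x + t *\<^sub>R w) + f x = t * t * ?G v \<xi> w"
      using second_difference_mean_value[OF F G t tr(1)] by metis
    obtain \<eta> where \<eta>: "dist x \<eta> \<le> t * (norm w + norm v)"
      "f (x + t *\<^sub>R w + t *\<^sub>R v) - f (x + t *\<^sub>R w) - f (x + t *\<^sub>R v) + f x = t * t * ?G w \<eta> v"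
      using second_difference_mean_value[OF F G t tr(2)] by metis
    have "t * t * ?G v \<xi> w = t * t * ?G w \<eta> v"
      using \<xi>(2) \<eta>(2) by (simp add: algebra_simps)
    then have "?G v \<xi> w = ?G w \<eta> v" using t by simp
    moreover have "dist \<xi> x < d1" "dist \<eta> x < d2"
      using \<xi>(1) \<eta>(1) tm by (auto simp: m_def dist_commute algebra_simps)
    ultimately have "\<bar>?G v \<xi> w - ?G v x w\<bar> < e / 2" "\<bar>?G v \<xi> w - ?G w x v\<bar> < e / 2"
      using d1(2)[of \<xi>] d2(2)[of \<eta>] by (auto simp only: dist_real_def)
    then show ?thesis by linarith
  qed
  then have "\<not> \<bar>?G v x w - ?G w x v\<bar> > 0" by blast
  then show ?thesis by simp
qed

lemma symmetric_second_derivative: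
  fixes f :: "'a::euclidean_space \<Rightarrow> 'b::euclidean_space"
  assumes sm: "smooth_on S f" and S: "open S" "x \<in> S"
  shows "frechet_derivative (\<lambda>u. frechet_derivative f (at u) v) (at x) w
       = frechet_derivative (\<lambda>u. frechet_derivative f (at u) w) (at x) v"
proof (rule euclidean_eqI)
  fix b :: 'b assume "b \<in> Basis"
  have smb: "smooth_on S (\<lambda>u. f u \<bullet> b)"
    using smooth_on_linear[OF bounded_linear_inner_left accessible_open[OF S(1)] sm] .
  have D1: "frechet_derivative (\<lambda>u. f u \<bullet> b) (at u) h = frechet_derivative f (at u) h \<bullet> b"
    if "u \<in> S" for u h
    using frechet_derivative_at[OF has_derivative_inner_left[OF smooth_on_has_derivative_at[OF sm S(1) that]], of b]
    by (metis)
  have D2: "frechet_derivative (\<lambda>u. frechet_derivative (\<lambda>u. f u \<bullet> b) (at u) v) (at x) w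
     = frechet_derivative (\<lambda>u. frechet_derivative f (at u) v) (at x) w \<bullet> b" for v w
  proof -
    have "((\<lambda>u. frechet_derivative f (at u) v \<bullet> b) has_derivative
       (\<lambda>h. frechet_derivative (\<lambda>u. frechet_derivative f (at u) v) (at x) h \<bullet> b)) (at x)"
      by (intro has_derivative_inner_left smooth_on_has_derivative_at[OF _ S]
           smooth_on_frechet_derivative sm S)
    then have "((\<lambda>u. frechet_derivative (\<lambda>u. f u \<bullet> b) (at u) v) has_derivative
       (\<lambda>h. frechet_derivative (\<lambda>u. frechet_derivative f (at u) v) (at x) h \<bullet> b)) (at x)"
      by (rule has_derivative_transform_within_open[OF _ S]) (simp add: D1)
    then show ?thesis using frechet_derivative_at by metis
  qed
  show "frechet_derivative (\<lambda>u. frechet_derivative f (at u) v) (at x) w \<bullet> b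
      = frechet_derivative (\<lambda>u. frechet_derivative f (at u) w) (at x) v \<bullet> b"
    using symmetric_second_derivative_real[OF smb S, of v w] unfolding D2 .
qed

section \<open>Manifolds described by atlases\<close>

text \<open>Charts are pairs of sets and maps, but are always handled as single objects.\<close>

declare split_paired_All [simp del] split_paired_Ex [simp del]

lemma at_within_openin:
  assumes "openin (top_of_set I) S" "t \<in> S"
  shows "at t within S = at t within I"
proof -
  obtain T where T: "open T" "S = I \<inter> T" using assms(1) by (auto simp: openin_open)
  then show ?thesis using assms(2) by (intro at_within_nhd[of t T]) auto
qed

lemma vector_derivative_interval:
  assumes "curve_interval I" "t \<in> I" "(f has_vector_derivative v) (at t within I)"
  shows "vector_derivative f (at t within I) = v"
  by (rule vector_derivative_within[OF accessible_at_nontrivial[OF accessible_interval]]) fact+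

lemma smooth_on_has_vector_derivative:
  fixes f :: "real \<Rightarrow> 'b::real_normed_vector"
  assumes "smooth_on S f" "t \<in> S" "accessible S"
  shows "(f has_vector_derivative vector_derivative f (at t within S)) (at t within S)"
proof -
  have "f differentiable (at t within S)"
    using smooth_on_has_derivative[OF assms(1,2)] by (rule differentiableI)
  then show ?thesis by (simp add: vector_derivative_works)
qed

locale atlas =
  fixes A :: "('p, 'e::euclidean_space) chart set"
  assumes atlas: "smooth_atlas A"
begin

abbreviation overlap :: "('p, 'e) chart \<Rightarrow> ('p, 'e) chart \<Rightarrow> 'e set" where
  "overlap c d \<equiv> snd c ` (fst c \<inter> fst d)"

abbreviation dtrans :: "('p, 'e) chart \<Rightarrow> ('p, 'e) chart \<Rightarrow> 'p \<Rightarrow> 'e \<Rightarrow> 'e" where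
  "dtrans c d x \<equiv> frechet_derivative (transition c d) (at (snd c x))"

lemma inj_chart: "c \<in> A \<Longrightarrow> inj_on (snd c) (fst c)"
  and open_chart_image: "c \<in> A \<Longrightarrow> open (snd c ` fst c)"
  and open_overlap: "c \<in> A \<Longrightarrow> d \<in> A \<Longrightarrow> open (overlap c d)"
  and smooth_transition: "c \<in> A \<Longrightarrow> d \<in> A \<Longrightarrow> smooth_on (overlap c d) (transition c d)"
  using atlas by (auto simp: smooth_atlas_def)

lemma chart_inv_chart [simp]: "c \<in> A \<Longrightarrow> x \<in> fst c \<Longrightarrow> chart_inv c (snd c x) = x"
  using inj_chart by (simp add: inv_into_f_f)

lemma chart_chart_inv [simp]: "u \<in> snd c ` fst c \<Longrightarrow> snd c (chart_inv c u) = u"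
  by (rule f_inv_into_f)

lemma mem_overlap: "c \<in> A \<Longrightarrow> u \<in> overlap c d \<longleftrightarrow> u \<in> snd c ` fst c \<and> chart_inv c u \<in> fst d"
  by (auto intro!: image_eqI)

lemma chart_image_Int:
  "c \<in> A \<Longrightarrow> S \<subseteq> fst c \<Longrightarrow> T \<subseteq> fst c \<Longrightarrow> snd c ` (S \<inter> T) = snd c ` S \<inter> snd c ` T"
  using inj_chart inj_on_image_Int by blast

lemma transition_has_derivative:
  assumes "c \<in> A" "d \<in> A" "x \<in> fst c" "x \<in> fst d"
  shows "(transition c d has_derivative dtrans c d x) (at (snd c x))"
  by (rule smooth_on_has_derivative_at[OF smooth_transition open_overlap]) (use assms in auto)

lemma linear_dtrans:
  assumes "c \<in> A" "d \<in> A" "x \<in> fst c" "x \<in> fst d"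
  shows "linear (dtrans c d x)"
  using transition_has_derivative[OF assms] by (rule has_derivative_linear)

lemma dtrans_self:
  assumes "c \<in> A" "x \<in> fst c"
  shows "dtrans c c x = (\<lambda>v. v)"
proof -
  have "((\<lambda>v. v) has_derivative (\<lambda>v. v)) (at (snd c x))" by simp
  then have "(transition c c has_derivative (\<lambda>v. v)) (at (snd c x))"
    by (rule has_derivative_transform_within_open[OF _ open_chart_image[OF assms(1)]])
       (use assms in auto)
  from frechet_derivative_at[OF this] show ?thesis by simp
qed

lemma dtrans_cocycle:
  assumes A: "c \<in> A" "d \<in> A" "e \<in> A" and x: "x \<in> fst c" "x \<in> fst d" "x \<in> fst e"
  shows "dtrans d e x (dtrans c d x v) = dtrans c e x v"
proof -
  have tr: "transition c d (snd c x) = snd d x" using A x by simp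
  have "((\<lambda>u. transition d e (transition c d u)) has_derivative
      (\<lambda>v. dtrans d e x (dtrans c d x v))) (at (snd c x))"
    using has_derivative_compose[OF transition_has_derivative[OF A(1,2) x(1,2)],
        of "transition d e" "dtrans d e x"] transition_has_derivative[OF A(2,3) x(2,3)]
    unfolding tr by blast
  then have "(transition c e has_derivative (\<lambda>v. dtrans d e x (dtrans c d x v))) (at (snd c x))"
  proof (rule has_derivative_transform_within_open)
    show "open (overlap c d \<inter> overlap c e)" by (intro open_Int open_overlap A)
    show "snd c x \<in> overlap c d \<inter> overlap c e" using x by auto
    show "transition d e (transition c d u) = transition c e u"
      if "u \<in> overlap c d \<inter> overlap c e" for u
      using that A by (auto simp: mem_overlap)
  qed
  from frechet_derivative_at[OF this] show ?thesis by metis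
qed

subsection \<open>Tangent spaces\<close>

lemma tangent_spaceD:
  assumes "v \<in> tangent_space A x" "c \<in> A" "d \<in> A" "x \<in> fst c" "x \<in> fst d"
  shows "v d = dtrans c d x (v c)"
proof -
  have "\<forall>c\<in>A. \<forall>d\<in>A. x \<in> fst c \<inter> fst d \<longrightarrow> v d = dtrans c d x (v c)"
    using assms(1) unfolding tangent_space_def mem_Collect_eq by (rule conjunct2)
  from bspec[OF bspec[OF this assms(2)] assms(3)] show ?thesis using assms(4,5) by simp
qed

lemma tangent_space_outside:
  assumes "v \<in> tangent_space A x" "\<not> (c \<in> A \<and> x \<in> fst c)"
  shows "v c = 0"
proof -
  have "\<forall>c. \<not> (c \<in> A \<and> x \<in> fst c) \<longrightarrow> v c = 0"
    using assms(1) unfolding tangent_space_def mem_Collect_eq by (rule conjunct1)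
  then show ?thesis using assms(2) by simp
qed

lemma coord_vec_tangent:
  assumes "c \<in> A" "x \<in> fst c"
  shows "coord_vec A c x e \<in> tangent_space A x"
  unfolding tangent_space_def mem_Collect_eq
proof (intro conjI allI ballI impI)
  show "coord_vec A c x e d = 0" if "\<not> (d \<in> A \<and> x \<in> fst d)" for d
    using that by (auto simp add: coord_vec_def)
  show "coord_vec A c x e d' = dtrans d d' x (coord_vec A c x e d)"
    if "d \<in> A" "d' \<in> A" "x \<in> fst d \<inter> fst d'" for d d'
    using that assms dtrans_cocycle[of c d d' x e] by (simp add: coord_vec_def)
qed

lemma coord_vec_at [simp]:
  assumes "c \<in> A" "x \<in> fst c"
  shows "coord_vec A c x e c = e"
  using dtrans_self[OF assms] assms by (simp add: coord_vec_def)

lemma coord_vec_tangent_eq: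
  assumes "c \<in> A" "x \<in> fst c" "v \<in> tangent_space A x"
  shows "coord_vec A c x (v c) = v"
proof
  fix d
  show "coord_vec A c x (v c) d = v d"
  proof (cases "d \<in> A \<and> x \<in> fst d")
    case True
    then show ?thesis using tangent_spaceD[OF assms(3,1), of d] assms(2) by (simp add: coord_vec_def)
  next
    case False
    then have "v d = 0" by (rule tangent_space_outside[OF assms(3)])
    then show ?thesis using False by (auto simp add: coord_vec_def)
  qed
qed

lemma tangent_eqI:
  assumes "c \<in> A" "x \<in> fst c" "v \<in> tangent_space A x" "w \<in> tangent_space A x" "v c = w c"
  shows "v = w"
  using coord_vec_tangent_eq[OF assms(1,2,3), unfolded assms(5)]
    coord_vec_tangent_eq[OF assms(1,2,4)] by (rule trans[OF sym])

lemma subspace_tangent_space: "subspace (tangent_space A x)"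
proof -
  have lin: "linear (dtrans c d x)" if "c \<in> A" "d \<in> A" "x \<in> fst c \<inter> fst d" for c d
    using that linear_dtrans by simp
  have "0 \<in> tangent_space A x"
    by (simp add: tangent_space_def linear_0[OF lin])
  moreover have "v + w \<in> tangent_space A x" if v: "v \<in> tangent_space A x" and w: "w \<in> tangent_space A x" for v w
    unfolding tangent_space_def mem_Collect_eq
  proof (intro conjI allI ballI impI)
    show "(v + w) c = 0" if "\<not> (c \<in> A \<and> x \<in> fst c)" for c
      using tangent_space_outside[OF v that] tangent_space_outside[OF w that] by simp
    show "(v + w) d = dtrans c d x ((v + w) c)" if "c \<in> A" "d \<in> A" "x \<in> fst c \<inter> fst d" for c d
      using tangent_spaceD[OF v that(1,2)] tangent_spaceD[OF w that(1,2)] linear_add[OF lin[OF that]] that(3)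
      by simp
  qed
  moreover have "r *\<^sub>R v \<in> tangent_space A x" if v: "v \<in> tangent_space A x" for v r
    unfolding tangent_space_def mem_Collect_eq
  proof (intro conjI allI ballI impI)
    show "(r *\<^sub>R v) c = 0" if "\<not> (c \<in> A \<and> x \<in> fst c)" for c
      using tangent_space_outside[OF v that] by (simp add: scaleR_fun_def)
    show "(r *\<^sub>R v) d = dtrans c d x ((r *\<^sub>R v) c)" if "c \<in> A" "d \<in> A" "x \<in> fst c \<inter> fst d" for c d
      using tangent_spaceD[OF v that(1,2)] linear_scale[OF lin[OF that]] that(3)
      by (simp add: scaleR_fun_def)
  qed
  ultimately show ?thesis unfolding subspace_def by simp
qed

lemma tangent_space_nonzero:
  assumes "c \<in> A" "x \<in> fst c" "v \<in> tangent_space A x"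
  shows "v = 0 \<longleftrightarrow> v c = 0"
proof
  assume "v c = 0"
  then show "v = 0"
    using tangent_eqI[OF assms subspace_0[OF subspace_tangent_space]] by simp
qed simp



lemma mcarrier_chart: "x \<in> mcarrier A \<Longrightarrow> \<exists>c\<in>A. x \<in> fst c"
  unfolding mcarrier_def by (simp only: UN_iff)

subsection \<open>The manifold topology\<close>

text \<open>Because charts are injective, the image of an intersection is the intersection of the images; so
  the condition that defines the topology is stable under intersections.\<close>

lemma openin_manifold_topology:
  "openin (manifold_topology A) W \<longleftrightarrow> W \<subseteq> mcarrier A \<and> (\<forall>c\<in>A. open (snd c ` (W \<inter> fst c)))"
proof -
  have "istopology (\<lambda>W. W \<subseteq> mcarrier A \<and> (\<forall>c\<in>A. open (snd c ` (W \<inter> fst c))))"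
    unfolding istopology_def
  proof (intro conjI allI impI ballI)
    fix S T c
    assume S: "S \<subseteq> mcarrier A \<and> (\<forall>c\<in>A. open (snd c ` (S \<inter> fst c)))"
      and T: "T \<subseteq> mcarrier A \<and> (\<forall>c\<in>A. open (snd c ` (T \<inter> fst c)))"
    show "S \<inter> T \<subseteq> mcarrier A" using S by blast
    assume c: "c \<in> A"
    have "snd c ` (S \<inter> T \<inter> fst c) = snd c ` (S \<inter> fst c) \<inter> snd c ` (T \<inter> fst c)"
      using chart_image_Int[OF c, of "S \<inter> fst c" "T \<inter> fst c"] by (simp add: Int_ac)
    then show "open (snd c ` (S \<inter> T \<inter> fst c))" using S T c by auto
  next
    fix \<K> assume K: "\<forall>K\<in>\<K>. K \<subseteq> mcarrier A \<and> (\<forall>c\<in>A. open (snd c ` (K \<inter> fst c)))"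
    then show "\<Union> \<K> \<subseteq> mcarrier A" by blast
    fix c assume c: "c \<in> A"
    have "snd c ` (\<Union> \<K> \<inter> fst c) = (\<Union>K\<in>\<K>. snd c ` (K \<inter> fst c))" by blast
    then show "open (snd c ` (\<Union> \<K> \<inter> fst c))" using K c by auto
  qed
  then show ?thesis unfolding manifold_topology_def by (simp add: topology_inverse')
qed

text \<open>In another chart this set becomes the preimage of \<open>S\<close> under a continuous transition map.\<close>

lemma openin_chart_part:
  assumes c: "c \<in> A" and S: "open S" "S \<subseteq> snd c ` fst c"
  shows "openin (manifold_topology A) (chart_inv c ` S)"
  unfolding openin_manifold_topology
proof (intro conjI ballI)
  show "chart_inv c ` S \<subseteq> mcarrier A"
  proof
    fix y assume "y \<in> chart_inv c ` S"
    then have "y \<in> fst c" using S(2) inv_into_into by (metis imageE subsetD)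
    then show "y \<in> mcarrier A" using c unfolding mcarrier_def by (rule UN_I[rotated])
  qed
  fix d assume d: "d \<in> A"
  have "snd d ` (chart_inv c ` S \<inter> fst d) = overlap d c \<inter> transition d c -` S"
  proof (intro equalityI subsetI)
    fix u assume "u \<in> snd d ` (chart_inv c ` S \<inter> fst d)"
    then obtain s where s: "s \<in> S" "chart_inv c s \<in> fst d" "u = snd d (chart_inv c s)" by auto
    then obtain x where x: "x \<in> fst c" "s = snd c x" using S(2) by auto
    then show "u \<in> overlap d c \<inter> transition d c -` S" using s c d by auto
  next
    fix u assume "u \<in> overlap d c \<inter> transition d c -` S"
    then obtain x where "x \<in> fst d" "x \<in> fst c" "u = snd d x" "snd c x \<in> S" using d by auto
    then show "u \<in> snd d ` (chart_inv c ` S \<inter> fst d)" using c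
      by (intro image_eqI[of _ _ x] IntI image_eqI[of x _ "snd c x"]) auto
  qed
  then show "open (snd d ` (chart_inv c ` S \<inter> fst d))"
    using continuous_open_preimage[OF smooth_on_continuous_on[OF smooth_transition[OF d c]]
        open_overlap[OF d c] S(1)] by simp
qed

lemma chart_inv_image: "c \<in> A \<Longrightarrow> S \<subseteq> fst c \<Longrightarrow> chart_inv c ` snd c ` S = S"
  by (rule inv_into_image_cancel[OF inj_chart])

lemma openin_chart: "c \<in> A \<Longrightarrow> openin (manifold_topology A) (fst c)"
  using openin_chart_part[OF _ open_chart_image order_refl, of c] chart_inv_image[of c "fst c"] by simp

lemma topspace_manifold: "topspace (manifold_topology A) = mcarrier A"
proof
  show "topspace (manifold_topology A) \<subseteq> mcarrier A"
    using openin_topspace openin_manifold_topology by blast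
  show "mcarrier A \<subseteq> topspace (manifold_topology A)"
    unfolding mcarrier_def using openin_chart openin_subset by blast
qed

lemma openin_mcarrier: "openin (manifold_topology A) (mcarrier A)"
  using openin_topspace[of "manifold_topology A"] by (simp add: topspace_manifold)

lemma openin_chart_image:
  "openin (manifold_topology A) W \<Longrightarrow> c \<in> A \<Longrightarrow> open (snd c ` (W \<inter> fst c))"
  by (simp add: openin_manifold_topology)

subsection \<open>Curves\<close>

lemma smooth_curve_in_carrier: "smooth_curve A I \<gamma> \<Longrightarrow> t \<in> I \<Longrightarrow> \<gamma> t \<in> mcarrier A"
  unfolding smooth_curve_def using topspace_manifold by (auto simp: continuous_map_def)

lemma smooth_curve_preimage_openin:
  assumes "smooth_curve A I \<gamma>" "c \<in> A"
  shows "openin (top_of_set I) {t \<in> I. \<gamma> t \<in> fst c}"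
  using assms openin_chart[OF assms(2)] unfolding smooth_curve_def continuous_map_def by auto

lemma smooth_curve_coord_smooth:
  "smooth_curve A I \<gamma> \<Longrightarrow> c \<in> A \<Longrightarrow> smooth_on {t\<in>I. \<gamma> t \<in> fst c} (\<lambda>t. snd c (\<gamma> t))"
  unfolding smooth_curve_def by blast

lemma smooth_curve_has_vector_derivative:
  assumes "curve_interval I" "smooth_curve A I \<gamma>" "c \<in> A" "t \<in> I" "\<gamma> t \<in> fst c"
  shows "((\<lambda>s. snd c (\<gamma> s)) has_vector_derivative velocity A I \<gamma> t c) (at t within I)"
proof -
  let ?S = "{t \<in> I. \<gamma> t \<in> fst c}"
  have o: "openin (top_of_set I) ?S" using smooth_curve_preimage_openin[OF assms(2,3)] .
  have "((\<lambda>s. snd c (\<gamma> s)) has_vector_derivative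
      vector_derivative (\<lambda>s. snd c (\<gamma> s)) (at t within ?S)) (at t within ?S)"
    by (rule smooth_on_has_vector_derivative[OF smooth_curve_coord_smooth[OF assms(2,3)] _
        accessible_interval_part[OF assms(1) o]]) (use assms in auto)
  then show ?thesis
    using at_within_openin[OF o, of t] assms by (simp add: velocity_def)
qed

text \<open>By the chain rule one chart around the point is enough to know a velocity.\<close>

lemma velocity_from_chart:
  assumes I: "curve_interval I" "openin (top_of_set I) S" "t \<in> S"
    and c: "c \<in> A" "\<And>s. s \<in> S \<Longrightarrow> \<gamma> s \<in> fst c"
    and v: "((\<lambda>s. snd c (\<gamma> s)) has_vector_derivative v) (at t within I)"
  shows "velocity A I \<gamma> t = coord_vec A c (\<gamma> t) v"
proof
  fix d
  have tI: "t \<in> I" using I openin_imp_subset by blast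
  show "velocity A I \<gamma> t d = coord_vec A c (\<gamma> t) v d"
  proof (cases "d \<in> A \<and> \<gamma> t \<in> fst d")
    case False
    then show ?thesis by (auto simp: velocity_def coord_vec_def)
  next
    case True
    have "((\<lambda>s. snd c (\<gamma> s)) has_derivative (\<lambda>h. h *\<^sub>R v)) (at t within S)"
      using v at_within_openin[OF I(2,3)] by (simp add: has_vector_derivative_def)
    then have "((\<lambda>s. transition c d (snd c (\<gamma> s))) has_derivative
        (\<lambda>h. dtrans c d (\<gamma> t) (h *\<^sub>R v))) (at t within S)"
      by (rule has_derivative_compose[where f = "\<lambda>s. snd c (\<gamma> s)" and g = "transition c d",
            OF _ transition_has_derivative]) (use c True I in auto)
    then have "((\<lambda>s. snd d (\<gamma> s)) has_derivative (\<lambda>h. dtrans c d (\<gamma> t) (h *\<^sub>R v))) (at t within S)"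
      by (rule has_derivative_transform[OF I(3), rotated]) (use c in auto)
    then have "((\<lambda>s. snd d (\<gamma> s)) has_vector_derivative dtrans c d (\<gamma> t) v) (at t within I)"
      using linear_scale[OF linear_dtrans[of c d "\<gamma> t"]] c True I at_within_openin[OF I(2,3)]
      by (simp add: has_vector_derivative_def)
    from vector_derivative_interval[OF I(1) tI this]
    show ?thesis using True by (simp add: velocity_def coord_vec_def)
  qed
qed

lemma velocity_tangent:
  assumes "curve_interval I" "smooth_curve A I \<gamma>" "t \<in> I"
  shows "velocity A I \<gamma> t \<in> tangent_space A (\<gamma> t)"
proof -
  obtain c where c: "c \<in> A" "\<gamma> t \<in> fst c"
    using smooth_curve_in_carrier[OF assms(2,3)] mcarrier_chart by blast
  have "velocity A I \<gamma> t = coord_vec A c (\<gamma> t) (velocity A I \<gamma> t c)"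
    by (rule velocity_from_chart[OF assms(1) smooth_curve_preimage_openin[OF assms(2) c(1)] _ c(1)])
       (use assms c smooth_curve_has_vector_derivative in auto)
  then show ?thesis using coord_vec_tangent[OF c] by metis
qed

lemma smooth_curve_from_chart:
  assumes I: "curve_interval I" and c: "c \<in> A" "\<And>s. s \<in> I \<Longrightarrow> \<gamma> s \<in> fst c"
    and sm: "smooth_on I (\<lambda>s. snd c (\<gamma> s))"
  shows "smooth_curve A I \<gamma>"
proof -
  have pre: "openin (top_of_set I) {t \<in> I. \<gamma> t \<in> W}" if W: "openin (manifold_topology A) W" for W
  proof -
    have "{t \<in> I. \<gamma> t \<in> W} = I \<inter> (\<lambda>s. snd c (\<gamma> s)) -` (snd c ` (W \<inter> fst c))"
      using c inj_onD[OF inj_chart[OF c(1)]] by auto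
    then show ?thesis
      using continuous_openin_preimage_gen[OF smooth_on_continuous_on[OF sm] openin_chart_image[OF W c(1)]]
      by simp
  qed
  have "\<gamma> t \<in> mcarrier A" if "t \<in> I" for t
    using c that by (auto simp: mcarrier_def)
  then have "continuous_map (top_of_set I) (manifold_topology A) \<gamma>"
    using pre by (auto simp: continuous_map_def topspace_manifold)
  moreover have "smooth_on {t\<in>I. \<gamma> t \<in> fst d} (\<lambda>t. snd d (\<gamma> t))" if d: "d \<in> A" for d
  proof -
    have acc: "accessible {t\<in>I. \<gamma> t \<in> fst d}"
      using accessible_interval_part[OF I pre[OF openin_chart[OF d]]] .
    have "smooth_on {t\<in>I. \<gamma> t \<in> fst d} (\<lambda>t. transition c d (snd c (\<gamma> t)))"
      by (rule smooth_on_compose[OF smooth_transition[OF c(1) d] smooth_on_subset[OF sm _ acc] acc])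
         (use c in auto)
    then show ?thesis by (rule smooth_on_eq) (use c in auto)
  qed
  ultimately show ?thesis by (simp add: smooth_curve_def)
qed

subsection \<open>Vector fields and their brackets\<close>

text \<open>The derivative of the transformation law \<open>Y\<^sub>d (\<tau> u) = D\<tau>(u) (Y\<^sub>c u)\<close> of the coordinates of a vector
  field, where \<open>\<tau>\<close> is the transition map.\<close>

lemma vector_field_transition_derivative:
  assumes Y: "smooth_vector_field A W Y" and p: "p \<in> W"
    and c: "c \<in> A" "p \<in> fst c" and d: "d \<in> A" "p \<in> fst d"
  shows "frechet_derivative (\<lambda>u. Y (chart_inv d u) d) (at (snd d p)) (dtrans c d p h)
       = frechet_derivative (\<lambda>u. frechet_derivative (transition c d) (at u) (Y p c)) (at (snd c p)) h
       + dtrans c d p (frechet_derivative (\<lambda>u. Y (chart_inv c u) c) (at (snd c p)) h)"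
proof -
  let ?O = "snd c ` (W \<inter> fst c) \<inter> overlap c d"
  have W: "openin (manifold_topology A) W" using Y by (simp add: smooth_vector_field_def)
  have oO: "open ?O" using openin_chart_image[OF W c(1)] open_overlap[OF c(1) d(1)] by blast
  have pO: "snd c p \<in> ?O" using p c d by auto
  have Yd: "((\<lambda>u. Y (chart_inv e u) e) has_derivative
      frechet_derivative (\<lambda>u. Y (chart_inv e u) e) (at (snd e p))) (at (snd e p))"
    if "e \<in> A" "p \<in> fst e" for e
    by (rule smooth_on_has_derivative_at[OF _ openin_chart_image[OF W that(1)]])
       (use Y p that in \<open>auto simp: smooth_vector_field_def\<close>)
  have tr: "transition c d (snd c p) = snd d p" using c d by simp
  have "((\<lambda>u. Y (chart_inv d (transition c d u)) d) has_derivative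
      (\<lambda>h. frechet_derivative (\<lambda>u. Y (chart_inv d u) d) (at (snd d p)) (dtrans c d p h))) (at (snd c p))"
    by (rule has_derivative_compose[where g = "\<lambda>u. Y (chart_inv d u) d",
          OF transition_has_derivative[OF c(1) d(1) c(2) d(2)]]) (simp only: tr Yd[OF d])
  then have 1: "((\<lambda>u. frechet_derivative (transition c d) (at u) (Y (chart_inv c u) c)) has_derivative
      (\<lambda>h. frechet_derivative (\<lambda>u. Y (chart_inv d u) d) (at (snd d p)) (dtrans c d p h))) (at (snd c p))"
  proof (rule has_derivative_transform_within_open[OF _ oO pO])
    fix u assume "u \<in> ?O"
    then obtain x where x: "x \<in> fst c" "u = snd c x" "x \<in> W" "x \<in> fst d"
      using inj_onD[OF inj_chart[OF c(1)]] by (auto; metis)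
    then have "Y x d = dtrans c d x (Y x c)"
      using Y c d by (intro tangent_spaceD) (auto simp: smooth_vector_field_def)
    then show "Y (chart_inv d (transition c d u)) d
       = frechet_derivative (transition c d) (at u) (Y (chart_inv c u) c)"
      using x c d by simp
  qed
  have at: "at (snd c p) within overlap c d = at (snd c p)"
    using at_within_open[OF _ open_overlap[OF c(1) d(1)]] pO by blast
  have "((\<lambda>u. frechet_derivative (transition c d) (at u) (Y (chart_inv c u) c)) has_derivative
     (\<lambda>h. frechet_derivative (\<lambda>u. frechet_derivative (transition c d) (at u) (Y (chart_inv c (snd c p)) c)) (at (snd c p)) h
       + frechet_derivative (transition c d) (at (snd c p))
           (frechet_derivative (\<lambda>u. Y (chart_inv c u) c) (at (snd c p)) h)))
     (at (snd c p) within overlap c d)"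
  proof (rule has_derivative_linear_family[where Q = "\<lambda>u. frechet_derivative (transition c d) (at u)"
        and Q' = "\<lambda>v. frechet_derivative (\<lambda>u. frechet_derivative (transition c d) (at u) v) (at (snd c p))"
        and V = "\<lambda>u. Y (chart_inv c u) c"])
    show "((\<lambda>u. frechet_derivative (transition c d) (at u) v) has_derivative
       frechet_derivative (\<lambda>u. frechet_derivative (transition c d) (at u) v) (at (snd c p)))
       (at (snd c p) within overlap c d)" for v
      unfolding at
      by (rule smooth_on_has_derivative_at[OF smooth_on_frechet_derivative[OF smooth_transition[OF c(1) d(1)]
            open_overlap[OF c(1) d(1)]] open_overlap[OF c(1) d(1)]]) (use pO in blast)
    show "linear (frechet_derivative (transition c d) (at u))" if "u \<in> overlap c d" for u
      using that linear_dtrans[OF c(1) d(1)] by auto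
  qed (use pO Yd[OF c] at in auto)
  from has_derivative_unique[OF 1 this[unfolded at]] show ?thesis
    using c by (simp add: fun_eq_iff)
qed

text \<open>The two terms of the bracket each pick up a second derivative of the transition map. These agree
  by symmetry and cancel.\<close>

lemma lie_bracket_tangent:
  assumes X: "smooth_vector_field A W X" and Y: "smooth_vector_field A W Y" and p: "p \<in> W"
  shows "lie_bracket A X Y p \<in> tangent_space A p"
proof -
  have "lie_bracket A X Y p d = dtrans c d p (lie_bracket A X Y p c)"
    if c: "c \<in> A" "p \<in> fst c" and d: "d \<in> A" "p \<in> fst d" for c d
  proof -
    have Xt: "X p d = dtrans c d p (X p c)" and Yt: "Y p d = dtrans c d p (Y p c)"
      using X Y p c d by (auto intro!: tangent_spaceD simp: smooth_vector_field_def)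
    have "frechet_derivative (\<lambda>u. frechet_derivative (transition c d) (at u) (Y p c)) (at (snd c p)) (X p c)
       = frechet_derivative (\<lambda>u. frechet_derivative (transition c d) (at u) (X p c)) (at (snd c p)) (Y p c)"
      by (rule symmetric_second_derivative[OF smooth_transition[OF c(1) d(1)] open_overlap[OF c(1) d(1)]])
         (use c d in auto)
    then show ?thesis
      using c d vector_field_transition_derivative[OF Y p c d, of "X p c"]
        vector_field_transition_derivative[OF X p c d, of "Y p c"]
      by (simp add: lie_bracket_def Xt Yt linear_diff[OF linear_dtrans])
  qed
  note tr = this
  show ?thesis
    unfolding tangent_space_def mem_Collect_eq
  proof (intro conjI allI ballI impI)
    show "lie_bracket A X Y p c = 0" if "\<not> (c \<in> A \<and> p \<in> fst c)" for c
      unfolding lie_bracket_def using that by (rule if_not_P)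
  qed (use tr in blast)
qed

end

section \<open>Riemannian metrics in coordinates of the plane\<close>

text \<open>Metrics and Christoffel symbols are families of bilinear maps over an open set. The product rule
  follows by applying the one for families of linear maps to each argument in turn.\<close>

lemma has_derivative_bilinear_family:
  fixes u :: "'x::real_normed_vector \<Rightarrow> 'u::euclidean_space"
    and V :: "'x \<Rightarrow> 'a::euclidean_space" and W :: "'x \<Rightarrow> 'b::euclidean_space"
    and B :: "'u \<Rightarrow> 'a \<Rightarrow> 'b \<Rightarrow> 'c::real_normed_vector"
  assumes U: "open U" and sm: "\<And>v w. smooth_on U (\<lambda>p. B p v w)"
    and lin1: "\<And>p w. p \<in> U \<Longrightarrow> linear (\<lambda>v. B p v w)"
    and lin2: "\<And>p v. p \<in> U \<Longrightarrow> linear (B p v)"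
    and S: "\<And>s. s \<in> S \<Longrightarrow> u s \<in> U" "s0 \<in> S"
    and u: "(u has_derivative u') (at s0 within S)"
    and V: "(V has_derivative V') (at s0 within S)"
    and W: "(W has_derivative W') (at s0 within S)"
  shows "((\<lambda>s. B (u s) (V s) (W s)) has_derivative
     (\<lambda>h. frechet_derivative (\<lambda>p. B p (V s0) (W s0)) (at (u s0)) (u' h)
        + B (u s0) (V' h) (W s0) + B (u s0) (V s0) (W' h))) (at s0 within S)"
proof -
  have 0: "((\<lambda>s. B (u s) v w) has_derivative
      (\<lambda>h. frechet_derivative (\<lambda>p. B p v w) (at (u s0)) (u' h))) (at s0 within S)" for v w
    by (rule has_derivative_compose[where f = u and g = "\<lambda>p. B p v w", OF u
          smooth_on_has_derivative_at[OF sm U S(1)[OF S(2)]]])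
  have 1: "((\<lambda>s. B (u s) (V s) w) has_derivative
      (\<lambda>h. frechet_derivative (\<lambda>p. B p (V s0) w) (at (u s0)) (u' h) + B (u s0) (V' h) w)) (at s0 within S)" for w
    by (rule has_derivative_linear_family[where Q = "\<lambda>s v. B (u s) v w" and V = V
          and Q' = "\<lambda>v h. frechet_derivative (\<lambda>p. B p v w) (at (u s0)) (u' h)", OF 0 lin1[OF S(1)] S(2) V])
  show ?thesis
    by (rule has_derivative_linear_family[where Q = "\<lambda>s w. B (u s) (V s) w" and V = W
          and Q' = "\<lambda>w h. frechet_derivative (\<lambda>p. B p (V s0) w) (at (u s0)) (u' h) + B (u s0) (V' h) w",
          OF 1 lin2[OF S(1)] S(2) W])
qed

lemma has_vector_derivative_bilinear_family:
  fixes u :: "real \<Rightarrow> 'u::euclidean_space"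
    and V :: "real \<Rightarrow> 'a::euclidean_space" and W :: "real \<Rightarrow> 'b::euclidean_space"
    and B :: "'u \<Rightarrow> 'a \<Rightarrow> 'b \<Rightarrow> 'c::real_normed_vector"
  assumes U: "open U" and sm: "\<And>v w. smooth_on U (\<lambda>p. B p v w)"
    and lin1: "\<And>p w. p \<in> U \<Longrightarrow> linear (\<lambda>v. B p v w)"
    and lin2: "\<And>p v. p \<in> U \<Longrightarrow> linear (B p v)"
    and S: "\<And>s. s \<in> S \<Longrightarrow> u s \<in> U" "t \<in> S"
    and u: "(u has_vector_derivative u') (at t within S)"
    and V: "(V has_vector_derivative V') (at t within S)"
    and W: "(W has_vector_derivative W') (at t within S)"
  shows "((\<lambda>s. B (u s) (V s) (W s)) has_vector_derivative
     frechet_derivative (\<lambda>p. B p (V t) (W t)) (at (u t)) u' + B (u t) V' (W t) + B (u t) (V t) W')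
     (at t within S)"
proof -
  have ut: "u t \<in> U" using S by blast
  have lin: "linear (frechet_derivative (\<lambda>p. B p (V t) (W t)) (at (u t)))"
    by (rule has_derivative_linear[OF smooth_on_has_derivative_at[OF sm U ut]])
  have "(\<lambda>h. frechet_derivative (\<lambda>p. B p (V t) (W t)) (at (u t)) (h *\<^sub>R u')
        + B (u t) (h *\<^sub>R V') (W t) + B (u t) (V t) (h *\<^sub>R W'))
      = (\<lambda>h. h *\<^sub>R (frechet_derivative (\<lambda>p. B p (V t) (W t)) (at (u t)) u'
        + B (u t) V' (W t) + B (u t) (V t) W'))"
    by (simp add: linear_scale[OF lin] linear_scale[OF lin1[OF ut]] linear_scale[OF lin2[OF ut]]
        scaleR_add_right)
  then show ?thesis
    using has_derivative_bilinear_family[OF U sm lin1 lin2 S u[unfolded has_vector_derivative_def]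
        V[unfolded has_vector_derivative_def] W[unfolded has_vector_derivative_def]]
    unfolding has_vector_derivative_def by simp
qed

lemma smooth_on_bilinear_family:
  fixes u :: "'x::euclidean_space \<Rightarrow> 'u::euclidean_space"
    and V :: "'x \<Rightarrow> 'a::euclidean_space" and W :: "'x \<Rightarrow> 'b::euclidean_space"
    and B :: "'u \<Rightarrow> 'a \<Rightarrow> 'b \<Rightarrow> 'c::real_normed_vector"
  assumes S: "accessible S" and sm: "\<And>v w. smooth_on U (\<lambda>p. B p v w)"
    and lin1: "\<And>p w. p \<in> U \<Longrightarrow> linear (\<lambda>v. B p v w)"
    and lin2: "\<And>p v. p \<in> U \<Longrightarrow> linear (B p v)"
    and u: "\<And>s. s \<in> S \<Longrightarrow> u s \<in> U" "smooth_on S u"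
    and V: "smooth_on S V" and W: "smooth_on S W"
  shows "smooth_on S (\<lambda>s. B (u s) (V s) (W s))"
proof (rule smooth_on_linear_family[where Q = "\<lambda>s w. B (u s) (V s) w", OF S _ lin2[OF u(1)] W])
  have US: "u ` S \<subseteq> U" using u(1) by blast
  show "smooth_on S (\<lambda>s. B (u s) (V s) w)" for w
    by (rule smooth_on_linear_family[where Q = "\<lambda>s v. B (u s) v w", OF S _ lin1[OF u(1)] V])
       (rule smooth_on_compose[OF sm u(2) S US])
qed

abbreviation (input) b1 :: "real^2" where "b1 \<equiv> axis 1 1"
abbreviation (input) b2 :: "real^2" where "b2 \<equiv> axis 2 1"

lemma vec2_basis: "(v :: real^2) = v $ 1 *\<^sub>R b1 + v $ 2 *\<^sub>R b2"
  by (simp add: vec_eq_iff forall_2 axis_def)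

lemma vec2_eqI: "(v :: real^2) $ 1 = w $ 1 \<Longrightarrow> v $ 2 = w $ 2 \<Longrightarrow> v = w"
  by (simp add: vec_eq_iff forall_2)

lemma axis2_components [simp]:
  "b1 $ 1 = 1" "b1 $ 2 = 0" "b2 $ 1 = 0" "b2 $ 2 = 1"
  by (simp_all add: axis_def)

lemma axis2_nonzero: "b1 \<noteq> 0" "b2 \<noteq> 0"
  by (simp_all add: vec_eq_iff axis_def)

text \<open>A Riemannian metric as it appears in a chart of a surface.\<close>

locale coord_metric =
  fixes U :: "(real^2) set" and G :: "real^2 \<Rightarrow> real^2 \<Rightarrow> real^2 \<Rightarrow> real"
  assumes open_U: "open U"
    and G_sym: "u \<in> U \<Longrightarrow> G u v w = G u w v"
    and lin1: "u \<in> U \<Longrightarrow> linear (\<lambda>v. G u v w)"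
    and pos: "u \<in> U \<Longrightarrow> v \<noteq> 0 \<Longrightarrow> G u v v > 0"
    and smooth: "smooth_on U (\<lambda>u. G u v w)"
begin

lemma lin2:
  assumes "u \<in> U"
  shows "linear (G u v)"
proof -
  have "G u v = (\<lambda>w. G u w v)" by (rule ext) (rule G_sym[OF assms])
  then show ?thesis using arg_cong[of _ _ linear, THEN iffD2] lin1[OF assms, of v] by metis
qed

lemma G_simps:
  assumes "u \<in> U"
  shows "G u (v + v') w = G u v w + G u v' w" "G u (v - v') w = G u v w - G u v' w"
    "G u (r *\<^sub>R v) w = r * G u v w" "G u (- v) w = - G u v w" "G u 0 w = 0"
    "G u w (v + v') = G u w v + G u w v'" "G u w (v - v') = G u w v - G u w v'"
    "G u w (r *\<^sub>R v) = r * G u w v" "G u w (- v) = - G u w v" "G u w 0 = 0"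
  using linear_add[OF lin1[OF assms]] linear_diff[OF lin1[OF assms]] linear_scale[OF lin1[OF assms]]
    linear_neg[OF lin1[OF assms]] linear_0[OF lin1[OF assms]]
    linear_add[OF lin2[OF assms]] linear_diff[OF lin2[OF assms]] linear_scale[OF lin2[OF assms]]
    linear_neg[OF lin2[OF assms]] linear_0[OF lin2[OF assms]]
  by (simp_all del: real_scaleR_def add: real_scaleR_def[symmetric])

lemma G_components:
  assumes "u \<in> U"
  shows "G u v w = v $ 1 * w $ 1 * G u b1 b1 + (v $ 1 * w $ 2 + v $ 2 * w $ 1) * G u b1 b2
     + v $ 2 * w $ 2 * G u b2 b2"
proof -
  have "G u v w = G u (v $ 1 *\<^sub>R b1 + v $ 2 *\<^sub>R b2) (w $ 1 *\<^sub>R b1 + w $ 2 *\<^sub>R b2)"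
    by (simp only: vec2_basis[symmetric])
  also have "\<dots> = v $ 1 * w $ 1 * G u b1 b1 + (v $ 1 * w $ 2 + v $ 2 * w $ 1) * G u b1 b2
     + v $ 2 * w $ 2 * G u b2 b2"
    unfolding G_simps[OF assms] G_sym[OF assms, of b2 b1] by (simp add: algebra_simps)
  finally show ?thesis .
qed

lemma nondegenerate:
  assumes "u \<in> U" "\<And>e. G u z e = G u z' e"
  shows "z = z'"
proof (rule ccontr)
  assume "z \<noteq> z'"
  then have "G u (z - z') (z - z') > 0" using pos[OF assms(1)] by simp
  then show False using assms(2) by (simp add: G_simps[OF assms(1)])
qed

subsection \<open>The quarter turn\<close>

definition vol :: "real^2 \<Rightarrow> real" where
  "vol u = sqrt (G u b1 b1 * G u b2 b2 - (G u b1 b2)\<^sup>2)"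

text \<open>The Hodge star on vectors. Dividing by the volume density gives \<open>J u e\<close> the length of \<open>e\<close>; the signs
  make the pair \<open>e\<close>, \<open>J u e\<close> positively oriented.\<close>

definition J :: "real^2 \<Rightarrow> real^2 \<Rightarrow> real^2" where
  "J u e = (1 / vol u) *\<^sub>R (G u e b1 *\<^sub>R b2 - G u e b2 *\<^sub>R b1)"

lemma gram_pos:
  assumes "u \<in> U"
  shows "G u b1 b1 * G u b2 b2 - (G u b1 b2)\<^sup>2 > 0"
proof -
  let ?E = "G u b1 b1" and ?F = "G u b1 b2"
  have E: "?E > 0" using pos[OF assms axis2_nonzero(1)] .
  let ?v = "?E *\<^sub>R b2 - ?F *\<^sub>R b1"
  have "?v $ 2 \<noteq> 0" using E by simp
  then have "?v \<noteq> 0" by (metis zero_index)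
  then have "G u ?v ?v > 0" using pos[OF assms] by blast
  then have "?E * (?E * G u b2 b2 - ?F\<^sup>2) > 0"
    by (simp add: G_simps[OF assms] G_sym[OF assms, of b2 b1] algebra_simps power2_eq_square)
  then show ?thesis using E zero_less_mult_pos by blast
qed

lemma vol_pos: "u \<in> U \<Longrightarrow> vol u > 0"
  and vol_square: "u \<in> U \<Longrightarrow> vol u * vol u = G u b1 b1 * G u b2 b2 - (G u b1 b2)\<^sup>2"
  using gram_pos[of u] by (simp_all add: vol_def)

lemma J_components:
  assumes "u \<in> U"
  shows "J u e $ 1 = - (e $ 1 * G u b1 b2 + e $ 2 * G u b2 b2) / vol u"
    "J u e $ 2 = (e $ 1 * G u b1 b1 + e $ 2 * G u b1 b2) / vol u"
  using G_components[OF assms, of e b1] G_components[OF assms, of e b2] by (simp_all add: J_def)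

lemma linear_J:
  assumes "u \<in> U"
  shows "linear (J u)"
  by (rule linearI) (simp_all add: J_def G_simps[OF assms] algebra_simps)

lemma J_orthogonal: "u \<in> U \<Longrightarrow> G u (J u e) e = 0"
  by (simp add: J_def G_simps G_sym[of u b1 e] G_sym[of u b2 e])

lemma J_norm:
  assumes "u \<in> U"
  shows "G u (J u e) (J u e) = G u e e"
proof -
  let ?E = "G u b1 b1" and ?F = "G u b1 b2" and ?H = "G u b2 b2"
  let ?p = "e $ 1" and ?q = "e $ 2"
  have s: "vol u \<noteq> 0" using vol_pos[OF assms] by simp
  have "(vol u * vol u) * G u (J u e) (J u e)
     = (?p * ?F + ?q * ?H)\<^sup>2 * ?E - 2 * (?p * ?F + ?q * ?H) * (?p * ?E + ?q * ?F) * ?F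
       + (?p * ?E + ?q * ?F)\<^sup>2 * ?H"
    unfolding G_components[OF assms, of "J u e"] J_components[OF assms]
    using s by (simp add: field_simps power2_eq_square)
  also have "\<dots> = (?E * ?H - ?F\<^sup>2) * G u e e"
    unfolding G_components[OF assms, of e e] by algebra
  finally show ?thesis using vol_square[OF assms] s by (metis mult_cancel_left mult_eq_0_iff)
qed

lemma J_J:
  assumes "u \<in> U"
  shows "J u (J u e) = - e"
proof -
  let ?E = "G u b1 b1" and ?F = "G u b1 b2" and ?H = "G u b2 b2"
  have s: "vol u \<noteq> 0" using vol_pos[OF assms] by simp
  have "J u (J u e) $ 1 = - (e $ 1 * (?E * ?H - ?F\<^sup>2)) / (vol u * vol u)"
    "J u (J u e) $ 2 = - (e $ 2 * (?E * ?H - ?F\<^sup>2)) / (vol u * vol u)"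
    unfolding J_components[OF assms, of "J u e"] J_components[OF assms, of e]
    using s by (simp_all add: field_simps power2_eq_square)
  then show ?thesis using s unfolding vol_square[OF assms, symmetric] by (intro vec2_eqI) simp_all
qed

lemma det_J_pos:
  assumes "u \<in> U" "e \<noteq> 0"
  shows "det (vector [e, J u e] :: real^2^2) > 0"
proof -
  have "det (vector [e, J u e] :: real^2^2) = G u e e / vol u"
    unfolding det_2 vector_2 J_components[OF assms(1)] G_components[OF assms(1), of e e]
    by (simp add: algebra_simps diff_divide_distrib add_divide_distrib)
  then show ?thesis using pos[OF assms] vol_pos[OF assms(1)] by simp
qed

lemma J_nonzero: "u \<in> U \<Longrightarrow> e \<noteq> 0 \<Longrightarrow> J u e \<noteq> 0"
  using J_norm[of u e] pos[of u e] G_simps(5)[of u] by force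

text \<open>The difference of both sides is orthogonal to \<open>e\<close> and \<open>J u e\<close>. By Cramer's rule a nonzero multiple
  of it is a combination of these two vectors, so that it is orthogonal to itself.\<close>

lemma orthogonal_decomposition:
  assumes "u \<in> U" "e \<noteq> 0"
  shows "v = (G u v e / G u e e) *\<^sub>R e + (G u v (J u e) / G u e e) *\<^sub>R J u e" (is "v = ?w")
proof -
  have e: "G u e e > 0" using pos[OF assms] .
  have "J u e \<noteq> 0" using J_nonzero[OF assms] .
  define z where "z = v - ?w"
  have ze: "G u z e = 0"
    using e J_orthogonal[OF assms(1), of e] by (simp add: z_def G_simps[OF assms(1)])
  have zJ: "G u z (J u e) = 0"
  proof -
    have "G u e (J u e) = 0"
      using J_orthogonal[OF assms(1), of e] G_sym[OF assms(1), of e "J u e"] by linarith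
    then show ?thesis using e by (simp add: z_def G_simps[OF assms(1)] J_norm[OF assms(1)])
  qed
  let ?D = "det (vector [e, J u e] :: real^2^2)"
  have D: "?D \<noteq> 0" using det_J_pos[OF assms] by simp
  have "?D *\<^sub>R z = (z $ 1 * J u e $ 2 - z $ 2 * J u e $ 1) *\<^sub>R e + (z $ 2 * e $ 1 - z $ 1 * e $ 2) *\<^sub>R J u e"
    unfolding det_2 vector_2 by (rule vec2_eqI) (simp_all add: algebra_simps)
  then have "G u z (?D *\<^sub>R z) = 0"
    using ze zJ by (simp add: G_simps[OF assms(1)])
  then have "G u z z = 0" using D by (simp add: G_simps[OF assms(1)])
  then have "z = 0" using pos[OF assms(1), of z] by force
  then show ?thesis by (simp add: z_def)
qed

text \<open>This identifies \<open>J\<close> with the vector that \<open>rperp\<close> describes implicitly.\<close>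

lemma J_unique:
  assumes u: "u \<in> U" and e: "e \<noteq> 0" and S: "G u S e = 0" "G u S S = G u e e"
    and d: "det (vector [e, S] :: real^2^2) > 0"
  shows "S = J u e"
proof -
  have ee: "G u e e > 0" using pos[OF u e] .
  define \<beta> where "\<beta> = G u S (J u e) / G u e e"
  have S\<beta>: "S = \<beta> *\<^sub>R J u e"
    using orthogonal_decomposition[OF u e, of S] S(1) by (simp add: \<beta>_def)
  then have "G u S S = \<beta> * \<beta> * G u e e" by (simp add: G_simps[OF u] J_norm[OF u])
  then have "\<beta> * \<beta> = 1" using S(2) ee by simp
  then have "\<beta> = 1 \<or> \<beta> = -1" by algebra
  moreover have "det (vector [e, S] :: real^2^2) = \<beta> * det (vector [e, J u e] :: real^2^2)"
    unfolding S\<beta> det_2 vector_2 by (simp add: algebra_simps)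
  ultimately show ?thesis using S\<beta> d det_J_pos[OF u e] by auto
qed

lemma smooth_vol: "smooth_on U vol"
  unfolding vol_def power2_eq_square
  by (rule smooth_on_compose[OF smooth_on_sqrt_real])
     (use gram_pos in \<open>auto intro!: smooth_on_diff smooth_on_mult smooth accessible_open open_U
        simp: power2_eq_square\<close>)

lemma smooth_J: "smooth_on U (\<lambda>u. J u e)"
proof -
  have acc: "accessible U" by (rule accessible_open[OF open_U])
  have "smooth_on U (\<lambda>u. 1 / vol u)"
    by (rule smooth_on_divide[OF acc smooth_on_const[OF acc] smooth_vol])
       (use vol_pos in force)
  then show ?thesis
    unfolding J_def by (intro smooth_on_scaleR smooth_on_diff acc smooth smooth_on_const)
qed

subsection \<open>Christoffel symbols\<close>

abbreviation dG :: "real^2 \<Rightarrow> real^2 \<Rightarrow> real^2 \<Rightarrow> real^2 \<Rightarrow> real" where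
  "dG u v w h \<equiv> frechet_derivative (\<lambda>u. G u v w) (at u) h"

definition chr :: "real^2 \<Rightarrow> real^2 \<Rightarrow> real^2 \<Rightarrow> real^2" where
  "chr u v w = (THE z. \<forall>e. 2 * G u z e = dG u w e v + dG u v e w - dG u v w e)"

lemma dG_has_derivative: "u \<in> U \<Longrightarrow> ((\<lambda>u. G u v w) has_derivative dG u v w) (at u)"
  by (rule smooth_on_has_derivative_at[OF smooth open_U])

lemma dG_sym: 
  assumes "u \<in> U"
  shows "dG u v w h = dG u w v h"
proof -
  have "((\<lambda>u. G u w v) has_derivative dG u v w) (at u)"
    by (rule has_derivative_transform_within_open[OF dG_has_derivative[OF assms] open_U assms])
       (rule G_sym)
  from frechet_derivative_at[OF this] show ?thesis by simp
qed

lemma linear_dG: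
  assumes u: "u \<in> U"
  shows "linear (\<lambda>w. dG u v w h)" "linear (\<lambda>v. dG u v w h)" "linear (dG u v w)"
proof -
  show 2: "linear (\<lambda>w. dG u v w h)" for v
  proof (rule linearI)
    fix w w' r
    have "((\<lambda>u. G u v (w + w')) has_derivative (\<lambda>h. dG u v w h + dG u v w' h)) (at u)"
      by (rule has_derivative_transform_within_open[OF has_derivative_add[OF dG_has_derivative[OF u]
            dG_has_derivative[OF u]] open_U u]) (simp add: G_simps)
    from frechet_derivative_at[OF this] show "dG u v (w + w') h = dG u v w h + dG u v w' h"
      by (simp add: fun_eq_iff)
    have "((\<lambda>u. G u v (r *\<^sub>R w)) has_derivative (\<lambda>h. r *\<^sub>R dG u v w h)) (at u)"
      by (rule has_derivative_transform_within_open[OF has_derivative_scaleR_right[OF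
            dG_has_derivative[OF u]] open_U u]) (simp add: G_simps)
    from frechet_derivative_at[OF this] show "dG u v (r *\<^sub>R w) h = r *\<^sub>R dG u v w h"
      by (simp add: fun_eq_iff)
  qed
  show "linear (\<lambda>v. dG u v w h)"
    using 2[of w] by (subst dG_sym[OF u])
  show "linear (dG u v w)" using dG_has_derivative[OF u] by (rule has_derivative_linear)
qed

text \<open>The orthogonal basis \<open>b1\<close>, \<open>J u b1\<close> represents a linear form explicitly. Applied to the form that
  defines the Christoffel symbols it shows that they exist and are smooth.\<close>

lemma riesz:
  assumes u: "u \<in> U" and K: "linear K"
  shows "G u ((K b1 / G u b1 b1) *\<^sub>R b1 + (K (J u b1) / G u b1 b1) *\<^sub>R J u b1) e = K e"
    (is "G u ?z e = _")
proof -
  have e: "K e = (G u e b1 / G u b1 b1) * K b1 + (G u e (J u b1) / G u b1 b1) * K (J u b1)"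
  proof -
    have "K e = K ((G u e b1 / G u b1 b1) *\<^sub>R b1 + (G u e (J u b1) / G u b1 b1) *\<^sub>R J u b1)"
      using orthogonal_decomposition[OF u axis2_nonzero(1), of e] by (rule arg_cong)
    then show ?thesis by (simp add: linear_add[OF K] linear_scale[OF K])
  qed
  show ?thesis
    unfolding e by (simp add: G_simps[OF u] G_sym[OF u, of b1 e] G_sym[OF u, of "J u b1" e] mult.commute)
qed

abbreviation lowered_chr :: "real^2 \<Rightarrow> real^2 \<Rightarrow> real^2 \<Rightarrow> real^2 \<Rightarrow> real" where
  "lowered_chr u v w e \<equiv> dG u w e v + dG u v e w - dG u v w e"

lemma linear_lowered_chr: 
  assumes u: "u \<in> U"
  shows "linear (lowered_chr u v w)"
  by (intro linear_compose_add linear_compose_sub linear_dG[OF u])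

lemma chr_formula:
  assumes u: "u \<in> U"
  shows "chr u v w = (lowered_chr u v w b1 / (2 * G u b1 b1)) *\<^sub>R b1
     + (lowered_chr u v w (J u b1) / (2 * G u b1 b1)) *\<^sub>R J u b1" (is "_ = ?z")
  unfolding chr_def
proof (rule the_equality)
  show *: "\<forall>e. 2 * G u ?z e = lowered_chr u v w e"
  proof
    fix e
    have "2 * G u ?z e = G u ((lowered_chr u v w b1 / G u b1 b1) *\<^sub>R b1
        + (lowered_chr u v w (J u b1) / G u b1 b1) *\<^sub>R J u b1) e"
      by (simp add: G_simps[OF u])
    then show "2 * G u ?z e = lowered_chr u v w e"
      using riesz[OF u linear_lowered_chr[OF u]] by simp
  qed
  show "z = ?z" if z: "\<forall>e. 2 * G u z e = lowered_chr u v w e" for z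
  proof (rule nondegenerate[OF u])
    show "G u z e = G u ?z e" for e using spec[OF z, of e] spec[OF *, of e] by linarith
  qed
qed

lemma G_chr:
  assumes u: "u \<in> U"
  shows "2 * G u (chr u v w) e = dG u w e v + dG u v e w - dG u v w e"
proof -
  have "2 * G u (chr u v w) e = G u ((lowered_chr u v w b1 / G u b1 b1) *\<^sub>R b1
        + (lowered_chr u v w (J u b1) / G u b1 b1) *\<^sub>R J u b1) e"
    unfolding chr_formula[OF u] by (simp add: G_simps[OF u])
  then show ?thesis using riesz[OF u linear_lowered_chr[OF u]] by simp
qed

lemma chr_eqI:
  assumes "u \<in> U" "\<And>e. 2 * G u z e = dG u w e v + dG u v e w - dG u v w e"
  shows "chr u v w = z"
proof (rule nondegenerate[OF assms(1)])
  show "G u (chr u v w) e = G u z e" for e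
    using G_chr[OF assms(1), of v w e] assms(2)[of e] by linarith
qed

lemma chr_sym: "u \<in> U \<Longrightarrow> chr u v w = chr u w v"
  by (rule chr_eqI) (simp_all add: G_chr dG_sym[of u v w])

lemma linear_chr2:
  assumes u: "u \<in> U"
  shows "linear (chr u v)"
proof (rule linearI)
  note lin = linear_dG[OF u, THEN linear_add] linear_dG[OF u, THEN linear_scale]
  show "chr u v (w + w') = chr u v w + chr u v w'" for w w'
  proof (rule chr_eqI[OF u])
    show "2 * G u (chr u v w + chr u v w') e
      = dG u (w + w') e v + dG u v e (w + w') - dG u v (w + w') e" for e
      using G_chr[OF u, of v w e] G_chr[OF u, of v w' e] unfolding lin G_simps[OF u] by argo
  qed
  show "chr u v (r *\<^sub>R w) = r *\<^sub>R chr u v w" for w r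
  proof (rule chr_eqI[OF u])
    show "2 * G u (r *\<^sub>R chr u v w) e
      = dG u (r *\<^sub>R w) e v + dG u v e (r *\<^sub>R w) - dG u v (r *\<^sub>R w) e" for e
      using G_chr[OF u, of v w e] unfolding lin G_simps[OF u] by (simp, algebra)
  qed
qed

lemma linear_chr1: "u \<in> U \<Longrightarrow> linear (\<lambda>v. chr u v w)"
  using linear_chr2[of u w] by (subst chr_sym)

lemma smooth_chr: "smooth_on U (\<lambda>u. chr u v w)"
proof -
  have acc: "accessible U" by (rule accessible_open[OF open_U])
  have lc: "smooth_on U (\<lambda>u. lowered_chr u v w e)" for e
    by (intro smooth_on_add smooth_on_diff acc smooth_on_frechet_derivative smooth open_U)
  have lJ: "smooth_on U (\<lambda>u. lowered_chr u v w (J u b1))"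
    by (rule smooth_on_linear_family[where Q = "\<lambda>u. lowered_chr u v w", OF acc lc linear_lowered_chr smooth_J])
  have nz: "2 * G u b1 b1 \<noteq> 0" if "u \<in> U" for u using pos[OF that axis2_nonzero(1)] by simp
  have "smooth_on U (\<lambda>u. (lowered_chr u v w b1 / (2 * G u b1 b1)) *\<^sub>R b1
     + (lowered_chr u v w (J u b1) / (2 * G u b1 b1)) *\<^sub>R J u b1)"
    by (intro smooth_on_add smooth_on_scaleR smooth_on_divide[OF acc _ _ nz] smooth_on_mult acc lc lJ
        smooth_J smooth smooth_on_const)
  then show ?thesis by (rule smooth_on_eq) (rule chr_formula)
qed

text \<open>The connection is metric: in the sum of the defining equations of \<open>chr u h v\<close>, paired with \<open>w\<close>, and
  of \<open>chr u h w\<close>, paired with \<open>v\<close>, only the derivative of the metric in the direction \<open>h\<close> remains.\<close>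

lemma dG_chr:
  assumes u: "u \<in> U"
  shows "dG u v w h = G u (chr u h v) w + G u v (chr u h w)"
  using G_chr[OF u, of h v w] G_chr[OF u, of h w v] G_sym[OF u, of v "chr u h w"]
    dG_sym[OF u, of v w h] dG_sym[OF u, of h w v] dG_sym[OF u, of h v w] by linarith

lemma metric_derivative_along:
  fixes u V W :: "real \<Rightarrow> real^2"
  assumes S: "\<And>s. s \<in> S \<Longrightarrow> u s \<in> U" "t \<in> S"
    and u: "(u has_vector_derivative u') (at t within S)"
    and V: "(V has_vector_derivative V') (at t within S)"
    and W: "(W has_vector_derivative W') (at t within S)"
  shows "((\<lambda>s. G (u s) (V s) (W s)) has_vector_derivative
     G (u t) (V' + chr (u t) u' (V t)) (W t) + G (u t) (V t) (W' + chr (u t) u' (W t))) (at t within S)"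
proof -
  have ut: "u t \<in> U" using S by blast
  have eq: "dG (u t) (V t) (W t) u' + G (u t) V' (W t) + G (u t) (V t) W'
     = G (u t) (V' + chr (u t) u' (V t)) (W t) + G (u t) (V t) (W' + chr (u t) u' (W t))"
    unfolding dG_chr[OF ut] G_simps[OF ut] by simp
  show ?thesis
    using has_vector_derivative_bilinear_family[of U G, OF open_U smooth lin1 lin2 S u V W] unfolding eq .
qed

end

section \<open>The slit tangent bundle as a manifold\<close>

text \<open>Second countability is passed on to the slit bundle through countable families of charts that
  cover the manifold. Here each basic open set that fits into the domain of a chart selects one
  such chart; conversely, in the lemma after it, the charts of a countable cover transport a
  countable basis of the model space.\<close>

lemma (in atlas) second_countable_imp_countable_cover:
  assumes "second_countable (manifold_topology A)"
  shows "\<exists>C\<subseteq>A. countable C \<and> mcarrier A = (\<Union>c\<in>C. fst c)"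
proof -
  obtain \<B> where B: "countable \<B>" "\<And>U x. openin (manifold_topology A) U \<Longrightarrow> x \<in> U \<Longrightarrow> \<exists>V\<in>\<B>. x \<in> V \<and> V \<subseteq> U"
    using assms unfolding second_countable_def by metis
  define \<B>' where "\<B>' = {V \<in> \<B>. \<exists>c\<in>A. V \<subseteq> fst c}"
  have "\<forall>V\<in>\<B>'. \<exists>c. c \<in> A \<and> V \<subseteq> fst c" unfolding \<B>'_def by blast
  then obtain f where f: "\<And>V. V \<in> \<B>' \<Longrightarrow> f V \<in> A \<and> V \<subseteq> fst (f V)" by metis
  have "mcarrier A \<subseteq> (\<Union>c\<in>f ` \<B>'. fst c)"
  proof
    fix x assume "x \<in> mcarrier A"
    then obtain c where c: "c \<in> A" "x \<in> fst c" using mcarrier_chart by metis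
    obtain V where V: "V \<in> \<B>" "x \<in> V" "V \<subseteq> fst c" using B(2)[OF openin_chart[OF c(1)] c(2)] by metis
    then have "V \<in> \<B>'" unfolding \<B>'_def using c(1) by blast
    then show "x \<in> (\<Union>c\<in>f ` \<B>'. fst c)" using f[of V] V(2) by (intro UN_I[of "f V"]) auto
  qed
  moreover have sub: "f ` \<B>' \<subseteq> A"
    by (rule image_subsetI) (rule conjunct1[OF f])
  moreover have "(\<Union>c\<in>f ` \<B>'. fst c) \<subseteq> mcarrier A"
    unfolding mcarrier_def by (rule UN_mono[OF sub order_refl])
  moreover have "countable (f ` \<B>')" using B(1) by (simp add: \<B>'_def)
  ultimately show ?thesis by (intro exI[of _ "f ` \<B>'"] conjI equalityI)
qed

lemma (in atlas) countable_cover_imp_second_countable: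
  assumes "C \<subseteq> A" "countable C" "mcarrier A = (\<Union>c\<in>C. fst c)"
  shows "second_countable (manifold_topology A)"
proof -
  obtain \<B> :: "'e set set" where B: "countable \<B>" "topological_basis \<B>"
    using ex_countable_basis by metis
  define \<V> where "\<V> = (\<lambda>(c, b). chart_inv c ` (b \<inter> snd c ` fst c)) ` (C \<times> \<B>)"
  have "countable \<V>" unfolding \<V>_def by (intro countable_image countable_SIGMA assms(2) B(1))
  moreover have "openin (manifold_topology A) V" if "V \<in> \<V>" for V
  proof -
    obtain c b where cb: "c \<in> C" "b \<in> \<B>" "V = chart_inv c ` (b \<inter> snd c ` fst c)"
    proof -
      obtain z where z: "z \<in> C \<times> \<B>" "V = (\<lambda>(c, b). chart_inv c ` (b \<inter> snd c ` fst c)) z"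
        using \<open>V \<in> \<V>\<close> unfolding \<V>_def image_iff by (elim bexE)
      obtain c b where "z = (c, b)" by (cases z)
      with z show thesis by (intro that[of c b]) simp_all
    qed
    have "c \<in> A" by (rule subsetD[OF assms(1) cb(1)])
    moreover have "open b" using topological_basis_open[OF B(2) cb(2)] .
    ultimately show ?thesis
      unfolding cb(3) by (intro openin_chart_part open_Int open_chart_image) auto
  qed
  moreover have "\<exists>V\<in>\<V>. x \<in> V \<and> V \<subseteq> U" if U: "openin (manifold_topology A) U" "x \<in> U" for U x
  proof -
    have "x \<in> mcarrier A" using U unfolding openin_manifold_topology by blast
    then obtain c where c: "c \<in> C" "x \<in> fst c" using assms(3) by auto
    have cA: "c \<in> A" by (rule subsetD[OF assms(1) c(1)])
    obtain b where b: "b \<in> \<B>" "snd c x \<in> b" "b \<subseteq> snd c ` (U \<inter> fst c)"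
      using topological_basisE[OF B(2) openin_chart_image[OF U(1) cA], of "snd c x"] c U by auto
    have "chart_inv c ` (b \<inter> snd c ` fst c) \<subseteq> U"
    proof
      fix y assume "y \<in> chart_inv c ` (b \<inter> snd c ` fst c)"
      then obtain v where v: "v \<in> b" "y = chart_inv c v" by blast
      then obtain z where "z \<in> U" "z \<in> fst c" "v = snd c z" using b(3) by blast
      then show "y \<in> U" using v cA by simp
    qed
    moreover have "x \<in> chart_inv c ` (b \<inter> snd c ` fst c)"
      using cA c(2) b(2) by (intro image_eqI[of _ _ "snd c x"]) auto
    moreover have "chart_inv c ` (b \<inter> snd c ` fst c) \<in> \<V>"
      unfolding \<V>_def using c(1) b(1) by (intro image_eqI[of _ _ "(c, b)"]) auto
    ultimately show ?thesis by (intro bexI[of _ "chart_inv c ` (b \<inter> snd c ` fst c)"] conjI)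
  qed
  ultimately show ?thesis
    unfolding second_countable_def by (intro exI[of _ \<V>] conjI ballI allI impI) simp_all
qed


lemma fst_slit_chart: "(x, R) \<in> fst (slit_chart A c) \<longleftrightarrow> x \<in> fst c \<and> R \<in> tangent_space A x \<and> R \<noteq> 0"
  by (simp add: slit_chart_def)

lemma snd_slit_chart [simp]: "snd (slit_chart A c) (x, R) = (snd c x, R c)"
  by (simp add: slit_chart_def)

lemma slit_chart_in: "c \<in> A \<Longrightarrow> slit_chart A c \<in> slit_bundle A"
  by (simp add: slit_bundle_def)

text \<open>The coordinates of a tangent vector \<open>R\<close> in the slit chart of \<open>c\<close> are \<open>R c\<close>, and \<open>R\<close> may be any function
  on charts; so the slit chart remembers \<open>c\<close>.\<close>

lemma slit_chart_eqD:
  fixes A :: "('p, 'e::euclidean_space) chart set"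
  assumes "slit_chart A c = slit_chart A d"
  shows "c = d"
proof (rule ccontr)
  assume "c \<noteq> d"
  obtain b :: 'e where b: "b \<in> Basis" using nonempty_Basis by blast
  define R where "R = (\<lambda>k. if k = c then b else 0)"
  have "snd (slit_chart A c) (x, R) = snd (slit_chart A d) (x, R)" for x using assms by simp
  then have "R c = R d" by simp
  then show False using b \<open>c \<noteq> d\<close> nonzero_Basis by (simp add: R_def)
qed

context atlas
begin

lemma slit_image_overlap:
  assumes "c \<in> A" "d \<in> A"
  shows "snd (slit_chart A c) ` (fst (slit_chart A c) \<inter> fst (slit_chart A d)) = overlap c d \<times> (-{0})"
proof (intro equalityI subsetI)
  fix z assume "z \<in> snd (slit_chart A c) ` (fst (slit_chart A c) \<inter> fst (slit_chart A d))"
  then obtain x R where "z = (snd c x, R c)" "x \<in> fst c" "x \<in> fst d" "R \<in> tangent_space A x" "R \<noteq> 0"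
    by (auto simp: fst_slit_chart)
  then show "z \<in> overlap c d \<times> (-{0})" using tangent_space_nonzero[OF assms(1)] by auto
next
  fix z :: "'e \<times> 'e" assume "z \<in> overlap c d \<times> (-{0})"
  then obtain x e where z: "z = (snd c x, e)" "x \<in> fst c" "x \<in> fst d" "e \<noteq> 0" by auto
  have R: "coord_vec A c x e \<in> tangent_space A x" "coord_vec A c x e c = e"
    using coord_vec_tangent coord_vec_at assms z by simp_all
  then have "coord_vec A c x e \<noteq> 0" using z(4) by force
  then show "z \<in> snd (slit_chart A c) ` (fst (slit_chart A c) \<inter> fst (slit_chart A d))"
    using z R by (intro image_eqI[of _ _ "(x, coord_vec A c x e)"]) (auto simp: fst_slit_chart)
qed

lemma slit_image: "c \<in> A \<Longrightarrow> snd (slit_chart A c) ` fst (slit_chart A c) = (snd c ` fst c) \<times> (-{0})"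
  using slit_image_overlap[of c c] by simp

lemma inj_slit_chart: 
  assumes "c \<in> A"
  shows "inj_on (snd (slit_chart A c)) (fst (slit_chart A c))"
proof (rule inj_onI)
  fix p q assume p: "p \<in> fst (slit_chart A c)" and q: "q \<in> fst (slit_chart A c)"
    and eq: "snd (slit_chart A c) p = snd (slit_chart A c) q"
  obtain x R where pd: "p = (x, R)" by (cases p)
  obtain y S where qd: "q = (y, S)" by (cases q)
  have "x = y" using eq p q inj_onD[OF inj_chart[OF assms]] unfolding pd qd by (simp add: fst_slit_chart)
  moreover have "R = S"
    using eq p q tangent_eqI[OF assms, of y R S] \<open>x = y\<close> unfolding pd qd by (simp add: fst_slit_chart)
  ultimately show "p = q" by (simp add: pd qd)
qed

lemma slit_chart_inv:
  assumes "c \<in> A" "u \<in> snd c ` fst c" "e \<noteq> 0"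
  shows "chart_inv (slit_chart A c) (u, e) = (chart_inv c u, coord_vec A c (chart_inv c u) e)"
proof -
  let ?x = "chart_inv c u"
  have x: "?x \<in> fst c" "snd c ?x = u" using assms(2) by (auto intro: inv_into_into)
  have R: "coord_vec A c ?x e c = e" "coord_vec A c ?x e \<in> tangent_space A ?x"
    using coord_vec_at[OF assms(1) x(1)] coord_vec_tangent[OF assms(1) x(1)] by simp_all
  have "coord_vec A c ?x e \<noteq> 0" using R(1) assms(3) by force
  then have in_chart: "(?x, coord_vec A c ?x e) \<in> fst (slit_chart A c)" using x R by (simp add: fst_slit_chart)
  have "snd (slit_chart A c) (?x, coord_vec A c ?x e) = (u, e)" using x R by simp
  then show ?thesis using inv_into_f_f[OF inj_slit_chart[OF assms(1)] in_chart] by simp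
qed

lemma slit_transition:
  assumes "c \<in> A" "d \<in> A" "u \<in> overlap c d" "e \<noteq> 0"
  shows "transition (slit_chart A c) (slit_chart A d) (u, e)
    = (transition c d u, frechet_derivative (transition c d) (at u) e)"
proof -
  obtain x where x: "u = snd c x" "x \<in> fst c" "x \<in> fst d" using assms(3) by blast
  have "u \<in> snd c ` fst c" using x by blast
  then show ?thesis
    using x assms by (simp add: slit_chart_inv coord_vec_def)
qed

lemma smooth_derivative_map:
  fixes T :: "'e set" and \<tau> :: "'e \<Rightarrow> 'e"
  assumes "smooth_on S \<tau>" "open S" "open T"
  shows "smooth_on (S \<times> T) (\<lambda>(u, e). (\<tau> u, frechet_derivative \<tau> (at u) e))"
proof -
  have acc: "accessible (S \<times> T)" using assms by (intro accessible_open open_Times)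
  have f: "smooth_on (S \<times> T) fst" "smooth_on (S \<times> T) snd"
    using smooth_on_linear[OF bounded_linear_fst acc smooth_on_ident[OF acc]]
      smooth_on_linear[OF bounded_linear_snd acc smooth_on_ident[OF acc]] by simp_all
  have fS: "fst ` (S \<times> T) \<subseteq> S" by auto
  have "smooth_on (S \<times> T) (\<lambda>z. \<tau> (fst z))"
    by (rule smooth_on_compose[OF assms(1) f(1) acc fS])
  moreover have "smooth_on (S \<times> T) (\<lambda>z. frechet_derivative \<tau> (at (fst z)) (snd z))"
  proof (rule smooth_on_linear_family[where Q = "\<lambda>z. frechet_derivative \<tau> (at (fst z))", OF acc _ _ f(2)])
    show "smooth_on (S \<times> T) (\<lambda>z. frechet_derivative \<tau> (at (fst z)) b)" for b
      by (rule smooth_on_compose[OF smooth_on_frechet_derivative[OF assms(1,2)] f(1) acc fS])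
    show "linear (frechet_derivative \<tau> (at (fst z)))" if "z \<in> S \<times> T" for z
      using has_derivative_linear[OF smooth_on_has_derivative_at[OF assms(1,2), of "fst z"]] that by auto
  qed
  ultimately show ?thesis
    unfolding case_prod_beta by (rule smooth_on_Pair[OF acc])
qed

lemma atlas_slit_bundle: "atlas (slit_bundle A)"
  unfolding atlas_def smooth_atlas_def
proof (intro conjI ballI)
  fix sc assume "sc \<in> slit_bundle A"
  then obtain c where c: "c \<in> A" "sc = slit_chart A c" unfolding slit_bundle_def by blast
  show "inj_on (snd sc) (fst sc)" using inj_slit_chart[OF c(1)] c(2) by simp
  show "open (snd sc ` fst sc)"
    unfolding c(2) slit_image[OF c(1)] by (intro open_Times open_chart_image c(1) open_Compl closed_singleton)
  fix sd assume "sd \<in> slit_bundle A"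
  then obtain d where d: "d \<in> A" "sd = slit_chart A d" unfolding slit_bundle_def by blast
  show o: "open (snd sc ` (fst sc \<inter> fst sd))"
    unfolding c(2) d(2) slit_image_overlap[OF c(1) d(1)]
    by (intro open_Times open_overlap c(1) d(1) open_Compl closed_singleton)
  have "smooth_on (overlap c d \<times> -{0}) (\<lambda>(u, e). (transition c d u, frechet_derivative (transition c d) (at u) e))"
    by (rule smooth_derivative_map[OF smooth_transition open_overlap]) (use c d in auto)
  then show "smooth_on (snd sc ` (fst sc \<inter> fst sd)) (transition sc sd)"
    unfolding c(2) d(2) slit_image_overlap[OF c(1) d(1)]
    by (rule smooth_on_eq) (use slit_transition[OF c(1) d(1)] in auto)
qed

lemma mcarrier_slit_bundle:
  "(x, R) \<in> mcarrier (slit_bundle A) \<longleftrightarrow> x \<in> mcarrier A \<and> R \<in> tangent_space A x \<and> R \<noteq> 0"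
  unfolding mcarrier_def slit_bundle_def UN_iff image_iff by (auto simp: fst_slit_chart)

lemma openin_slit_preimage:
  assumes "openin (manifold_topology A) W"
  shows "openin (manifold_topology (slit_bundle A)) {p \<in> mcarrier (slit_bundle A). fst p \<in> W}"
proof -
  interpret slit: atlas "slit_bundle A" by (rule atlas_slit_bundle)
  show ?thesis
    unfolding slit.openin_manifold_topology
  proof (intro conjI ballI)
    fix sc assume "sc \<in> slit_bundle A"
    then obtain c where c: "c \<in> A" "sc = slit_chart A c" unfolding slit_bundle_def by blast
    have "snd sc ` ({p \<in> mcarrier (slit_bundle A). fst p \<in> W} \<inter> fst sc) = snd c ` (W \<inter> fst c) \<times> (-{0})"
    proof (intro equalityI subsetI)
      fix z assume "z \<in> snd sc ` ({p \<in> mcarrier (slit_bundle A). fst p \<in> W} \<inter> fst sc)"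
      then obtain x R where "z = (snd c x, R c)" "x \<in> W" "x \<in> fst c" "R \<in> tangent_space A x" "R \<noteq> 0"
        unfolding c(2) by (auto simp: fst_slit_chart)
      then show "z \<in> snd c ` (W \<inter> fst c) \<times> (-{0})" using tangent_space_nonzero[OF c(1)] by auto
    next
      fix z :: "'e \<times> 'e" assume "z \<in> snd c ` (W \<inter> fst c) \<times> (-{0})"
      then obtain x e where z: "z = (snd c x, e)" "x \<in> W" "x \<in> fst c" "e \<noteq> 0" by auto
      then have "z \<in> snd sc ` fst sc" unfolding c(2) slit_image[OF c(1)] by auto
      then obtain y R where y: "z = (snd c y, R c)" "(y, R) \<in> fst sc" unfolding c(2) by auto
      then have "y = x" using z inj_onD[OF inj_chart[OF c(1)]] unfolding c(2) by (simp add: fst_slit_chart)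
      then show "z \<in> snd sc ` ({p \<in> mcarrier (slit_bundle A). fst p \<in> W} \<inter> fst sc)"
        using y z c slit_chart_in[OF c(1)] unfolding c(2)
        by (intro image_eqI[of _ _ "(y, R)"]) (auto simp: mcarrier_def)
    qed
    then show "open (snd sc ` ({p \<in> mcarrier (slit_bundle A). fst p \<in> W} \<inter> fst sc))"
      using openin_chart_image[OF assms c(1)] by (auto intro!: open_Times)
  qed blast
qed

text \<open>Points over different points of the base are separated in the base, points over the same point
  in a common chart.\<close>

lemma smooth_manifold_slit_bundle:
  assumes "smooth_manifold A"
  shows "smooth_manifold (slit_bundle A)"
  unfolding smooth_manifold_def
proof (intro conjI)
  interpret slit: atlas "slit_bundle A" by (rule atlas_slit_bundle)
  show "smooth_atlas (slit_bundle A)" by (rule slit.atlas)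
  show "Hausdorff_space (manifold_topology (slit_bundle A))"
    unfolding Hausdorff_space_def slit.topspace_manifold
  proof (intro allI impI)
    fix p q assume pq: "p \<in> mcarrier (slit_bundle A) \<and> q \<in> mcarrier (slit_bundle A) \<and> p \<noteq> q"
    show "\<exists>U V. openin (manifold_topology (slit_bundle A)) U \<and> openin (manifold_topology (slit_bundle A)) V
        \<and> p \<in> U \<and> q \<in> V \<and> disjnt U V"
    proof (cases "fst p = fst q")
      case False
      have "fst p \<in> mcarrier A" "fst q \<in> mcarrier A"
        using pq mcarrier_slit_bundle[of "fst p" "snd p"] mcarrier_slit_bundle[of "fst q" "snd q"] by simp_all
      moreover have "Hausdorff_space (manifold_topology A)" using assms by (simp add: smooth_manifold_def)
      ultimately obtain U V where UV: "openin (manifold_topology A) U" "openin (manifold_topology A) V"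
        "fst p \<in> U" "fst q \<in> V" "disjnt U V"
        using False unfolding Hausdorff_space_def topspace_manifold by metis
      have "disjnt {p \<in> mcarrier (slit_bundle A). fst p \<in> U} {p \<in> mcarrier (slit_bundle A). fst p \<in> V}"
        using UV(5) unfolding disjnt_iff by blast
      then show ?thesis
        using openin_slit_preimage[OF UV(1)] openin_slit_preimage[OF UV(2)] UV(3,4) pq
        by (intro exI[of _ "{p \<in> mcarrier (slit_bundle A). fst p \<in> U}"]
            exI[of _ "{p \<in> mcarrier (slit_bundle A). fst p \<in> V}"] conjI) simp_all
    next
      case True
      obtain x R S where pd: "p = (x, R)" and qd: "q = (x, S)" using True by (cases p, cases q) simp
      have x: "x \<in> mcarrier A" "R \<in> tangent_space A x" "R \<noteq> 0" "S \<in> tangent_space A x" "S \<noteq> 0"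
        using pq unfolding pd qd mcarrier_slit_bundle by simp_all
      then obtain c where c: "c \<in> A" "x \<in> fst c" using mcarrier_chart by metis
      let ?sc = "slit_chart A c"
      have in_chart: "p \<in> fst ?sc" "q \<in> fst ?sc" using x c unfolding pd qd by (simp_all add: fst_slit_chart)
      have sc: "?sc \<in> slit_bundle A" by (rule slit_chart_in[OF c(1)])
      have ne: "snd ?sc p \<noteq> snd ?sc q"
        using inj_on_eq_iff[OF inj_slit_chart[OF c(1)] in_chart] pq by simp
      obtain U V where UV: "open U" "open V" "snd ?sc p \<in> U" "snd ?sc q \<in> V" "U \<inter> V = {}"
        using hausdorff[OF ne] by metis
      let ?I = "snd ?sc ` fst ?sc"
      have o: "openin (manifold_topology (slit_bundle A)) (chart_inv ?sc ` (O' \<inter> ?I))" if "open O'" for O'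
        by (rule slit.openin_chart_part[OF sc open_Int[OF that slit.open_chart_image[OF sc]] Int_lower2])
      have mem: "r \<in> chart_inv ?sc ` (O' \<inter> ?I)" if "r \<in> fst ?sc" "snd ?sc r \<in> O'" for r O'
        using that slit.chart_inv_chart[OF sc that(1)] by (intro image_eqI[of _ _ "snd ?sc r"]) auto
      have "disjnt (chart_inv ?sc ` (U \<inter> ?I)) (chart_inv ?sc ` (V \<inter> ?I))"
        unfolding disjnt_iff
      proof (intro allI notI)
        fix r assume r: "r \<in> chart_inv ?sc ` (U \<inter> ?I) \<and> r \<in> chart_inv ?sc ` (V \<inter> ?I)"
        have "snd ?sc r \<in> O'" if rO: "r \<in> chart_inv ?sc ` (O' \<inter> ?I)" for O'
        proof -
          obtain z where z: "z \<in> O' \<inter> ?I" "r = chart_inv ?sc z" using rO unfolding image_iff by (elim bexE)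
          then show ?thesis using slit.chart_chart_inv[of z ?sc] by simp
        qed
        then show False using UV(5) r by (metis IntI empty_iff)
      qed
      then show ?thesis using o[OF UV(1)] o[OF UV(2)] mem[OF in_chart(1) UV(3)] mem[OF in_chart(2) UV(4)]
        by (intro exI[of _ "chart_inv ?sc ` (U \<inter> ?I)"] exI[of _ "chart_inv ?sc ` (V \<inter> ?I)"] conjI)
    qed
  qed
  obtain C where C: "C \<subseteq> A" "countable C" "mcarrier A = (\<Union>c\<in>C. fst c)"
    using second_countable_imp_countable_cover assms by (auto simp: smooth_manifold_def)
  show "second_countable (manifold_topology (slit_bundle A))"
  proof (rule slit.countable_cover_imp_second_countable)
    show "slit_chart A ` C \<subseteq> slit_bundle A" using C(1) by (auto simp: slit_bundle_def)
    show "countable (slit_chart A ` C)" using C(2) by simp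
    show "mcarrier (slit_bundle A) = (\<Union>c\<in>slit_chart A ` C. fst c)"
    proof (intro equalityI subsetI)
      fix p assume p: "p \<in> mcarrier (slit_bundle A)"
      obtain x R where pd: "p = (x, R)" by (cases p)
      have x: "x \<in> mcarrier A" "R \<in> tangent_space A x" "R \<noteq> 0"
        using p unfolding pd mcarrier_slit_bundle by simp_all
      then obtain c where "c \<in> C" "x \<in> fst c" using C(3) by blast
      then show "p \<in> (\<Union>c\<in>slit_chart A ` C. fst c)"
        unfolding pd using x by (intro UN_I[of "slit_chart A c"]) (auto simp: fst_slit_chart)
    next
      fix p assume "p \<in> (\<Union>c\<in>slit_chart A ` C. fst c)"
      then show "p \<in> mcarrier (slit_bundle A)"
        unfolding mcarrier_def slit_bundle_def by (rule subsetD[OF UN_mono[OF image_mono[OF C(1)] order_refl]])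
    qed
  qed
qed

end

section \<open>Oriented Riemannian surfaces\<close>

lemma scaleR_fun_apply [simp]: "(r *\<^sub>R f) x = r *\<^sub>R f x"
  by (simp add: scaleR_fun_def)

locale surface =
  fixes A :: "('p, real^2) chart set" and g :: "('p, real^2) metric"
  assumes oriented: "oriented_surface A" and metric: "riemannian_metric A g"

sublocale surface \<subseteq> atlas A
  using oriented by unfold_locales (simp add: oriented_surface_def smooth_manifold_def)

context surface
begin

abbreviation Gc :: "('p, real^2) chart \<Rightarrow> real^2 \<Rightarrow> real^2 \<Rightarrow> real^2 \<Rightarrow> real" where
  "Gc \<equiv> metric_coord A g"

abbreviation Jc :: "('p, real^2) chart \<Rightarrow> real^2 \<Rightarrow> real^2 \<Rightarrow> real^2" where
  "Jc c \<equiv> coord_metric.J (Gc c)"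

abbreviation \<Gamma> :: "('p, real^2) chart \<Rightarrow> real^2 \<Rightarrow> real^2 \<Rightarrow> real^2 \<Rightarrow> real^2" where
  "\<Gamma> c \<equiv> coord_metric.chr (Gc c)"

lemma tangent_in_carrier:
  assumes "v \<in> tangent_space A x" "v \<noteq> 0"
  shows "x \<in> mcarrier A"
proof (rule ccontr)
  assume x: "x \<notin> mcarrier A"
  have "v c = 0" for c
    by (rule tangent_space_outside[OF assms(1)]) (use x in \<open>auto simp: mcarrier_def\<close>)
  then show False using assms(2) by (simp add: fun_eq_iff)
qed

lemmas tangent_add = subspace_add[OF subspace_tangent_space]
  and tangent_diff = subspace_diff[OF subspace_tangent_space]
  and tangent_scale = subspace_scale[OF subspace_tangent_space]
  and tangent_zero = subspace_0[OF subspace_tangent_space]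
  and tangent_neg = subspace_neg[OF subspace_tangent_space]

lemma metric_facts:
  assumes "x \<in> mcarrier A" "u \<in> tangent_space A x" "v \<in> tangent_space A x"
  shows "g x u v = g x v u"
    and "w \<in> tangent_space A x \<Longrightarrow> g x (u + v) w = g x u w + g x v w"
    and "g x (a *\<^sub>R u) v = a * g x u v"
    and "u \<noteq> 0 \<Longrightarrow> g x u u > 0"
  using metric assms unfolding riemannian_metric_def by auto

lemma coord_vec_add:
  assumes "c \<in> A" "x \<in> fst c"
  shows "coord_vec A c x (v + w) = coord_vec A c x v + coord_vec A c x w"
  by (rule tangent_eqI[OF assms]) (simp_all add: assms coord_vec_tangent tangent_add)

lemma coord_vec_scale:
  assumes "c \<in> A" "x \<in> fst c"
  shows "coord_vec A c x (r *\<^sub>R v) = r *\<^sub>R coord_vec A c x v"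
  by (rule tangent_eqI[OF assms]) (simp_all add: assms coord_vec_tangent tangent_scale)

lemma metric_coord_at:
  assumes "c \<in> A" "x \<in> fst c" "v \<in> tangent_space A x" "w \<in> tangent_space A x"
  shows "Gc c (snd c x) (v c) (w c) = g x v w"
  using coord_vec_tangent_eq[OF assms(1,2,3)] coord_vec_tangent_eq[OF assms(1,2,4)] assms(1,2)
  by (simp add: metric_coord_def)

lemma metric_coord_vec:
  assumes "c \<in> A" "x \<in> fst c"
  shows "Gc c (snd c x) v w = g x (coord_vec A c x v) (coord_vec A c x w)"
  using assms by (simp add: metric_coord_def)

lemma coord_metric:
  assumes c: "c \<in> A"
  shows "coord_metric (snd c ` fst c) (Gc c)"
proof (rule coord_metric.intro)
  show "open (snd c ` fst c)" by (rule open_chart_image[OF c])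
  fix u v w
  show "smooth_on (snd c ` fst c) (\<lambda>u. Gc c u v w)"
    by (rule metric[unfolded riemannian_metric_def, THEN conjunct2, THEN bspec, OF c, THEN spec, THEN spec])
  assume "u \<in> snd c ` fst c"
  then obtain x where x: "u = snd c x" "x \<in> fst c" by blast
  have xc: "x \<in> mcarrier A" using x c by (auto simp: mcarrier_def)
  note t = coord_vec_tangent[OF c x(2)]
  show "Gc c u v w = Gc c u w v"
    unfolding x(1) metric_coord_vec[OF c x(2)] by (rule metric_facts(1)[OF xc t t])
  show "linear (\<lambda>v. Gc c u v w)"
    unfolding x(1) metric_coord_vec[OF c x(2)]
    by (rule linearI) (simp_all add: coord_vec_add[OF c x(2)] coord_vec_scale[OF c x(2)]
        metric_facts(2,3)[OF xc t t] t)
  assume "v \<noteq> 0"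
  then have "coord_vec A c x v \<noteq> 0" using coord_vec_at[OF c x(2), of v] by force
  then show "Gc c u v v > 0"
    unfolding x(1) metric_coord_vec[OF c x(2)] using metric_facts(4)[OF xc t t] by simp
qed

lemma christoffel_eq: "c \<in> A \<Longrightarrow> christoffel A g c = \<Gamma> c"
  by (intro ext) (simp add: christoffel_def coord_metric.chr_def[OF coord_metric])

lemma g_simps:
  assumes "x \<in> mcarrier A" "u \<in> tangent_space A x" "v \<in> tangent_space A x" "w \<in> tangent_space A x"
  shows "g x (u + v) w = g x u w + g x v w" "g x (u - v) w = g x u w - g x v w"
    "g x (a *\<^sub>R u) v = a * g x u v" "g x (- u) v = - g x u v"
    "g x w (u + v) = g x w u + g x w v" "g x w (u - v) = g x w u - g x w v"
    "g x v (a *\<^sub>R u) = a * g x v u" "g x v (- u) = - g x v u" "g x 0 v = 0" "g x v 0 = 0"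
proof -
  obtain c where c: "c \<in> A" "x \<in> fst c" using mcarrier_chart[OF assms(1)] by metis
  interpret coord_metric "snd c ` fst c" "Gc c" by (rule coord_metric[OF c(1)])
  have u: "snd c x \<in> snd c ` fst c" using c by blast
  note at = metric_coord_at[OF c, symmetric]
  note t = assms tangent_add tangent_diff tangent_scale tangent_neg tangent_zero
  show "g x (u + v) w = g x u w + g x v w" "g x (u - v) w = g x u w - g x v w"
    "g x (a *\<^sub>R u) v = a * g x u v" "g x (- u) v = - g x u v"
    "g x w (u + v) = g x w u + g x w v" "g x w (u - v) = g x w u - g x w v"
    "g x v (a *\<^sub>R u) = a * g x v u" "g x v (- u) = - g x v u" "g x 0 v = 0" "g x v 0 = 0"
    by (simp_all add: at t G_simps[OF u])
qed

subsection \<open>The rotated vector\<close>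

lemma transition_det_pos:
  assumes "c \<in> A" "d \<in> A" "x \<in> fst c" "x \<in> fst d"
    and "det (vector [v, w] :: real^2^2) > 0"
  shows "det (vector [dtrans c d x v, dtrans c d x w] :: real^2^2) > 0"
proof -
  define M where "M = jacobian (transition c d) (at (snd c x))"
  have "(transition c d has_derivative (\<lambda>h. M *v h)) (at (snd c x))"
    unfolding M_def
    by (rule jacobian_works[THEN iffD1, OF differentiableI[OF transition_has_derivative[OF assms(1-4)]]])
  from frechet_derivative_at[OF this] have D: "dtrans c d x h = M *v h" for h by metis
  have M: "det M > 0"
    using oriented assms(1-4) unfolding oriented_surface_def M_def by blast
  have "(vector [dtrans c d x v, dtrans c d x w] :: real^2^2) = vector [v, w] ** transpose M"
    unfolding D
    by (simp add: vec_eq_iff forall_2 vector_2 matrix_matrix_mult_def matrix_vector_mult_def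
        transpose_def sum_2 mult.commute)
  then have "det (vector [dtrans c d x v, dtrans c d x w] :: real^2^2) = det (vector [v, w] :: real^2^2) * det M"
    by (simp only: det_mul det_transpose)
  then show ?thesis using assms(5) M by simp
qed

text \<open>Transition maps preserve the metric and the orientation. Hence the vector that \<open>J\<close> yields in one
  chart satisfies the conditions of \<open>rperp\<close> in every chart.\<close>

lemma rperp_coord_vec:
  assumes c: "c \<in> A" "x \<in> fst c" and R: "R \<in> tangent_space A x" "R \<noteq> 0"
  shows "rperp A g x R = coord_vec A c x (Jc c (snd c x) (R c))"
  unfolding rperp_def
proof (rule the_equality)
  interpret coord_metric "snd c ` fst c" "Gc c" by (rule coord_metric[OF c(1)])
  have u: "snd c x \<in> snd c ` fst c" using c by blast
  have Rc: "R c \<noteq> 0" using R tangent_space_nonzero[OF c R(1)] by simp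
  let ?S = "coord_vec A c x (J (snd c x) (R c))"
  have S: "?S \<in> tangent_space A x" "?S c = J (snd c x) (R c)"
    using coord_vec_tangent[OF c] coord_vec_at[OF c] by simp_all
  show "?S \<in> tangent_space A x \<and> g x ?S R = 0 \<and> gnorm g x ?S = gnorm g x R \<and> positively_oriented A x R ?S"
  proof (intro conjI S(1))
    show "g x ?S R = 0"
      using metric_coord_at[OF c S(1) R(1)] J_orthogonal[OF u] S(2) by simp
    show "gnorm g x ?S = gnorm g x R"
      using metric_coord_at[OF c S(1) S(1)] metric_coord_at[OF c R(1) R(1)] J_norm[OF u] S(2)
      by (simp add: gnorm_def)
    show "positively_oriented A x R ?S"
      unfolding positively_oriented_def
    proof (intro ballI impI)
      fix d assume d: "d \<in> A" "x \<in> fst d"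
      show "det (vector [R d, ?S d] :: real^2^2) > 0"
        unfolding tangent_spaceD[OF R(1) c(1) d(1) c(2) d(2)] tangent_spaceD[OF S(1) c(1) d(1) c(2) d(2)] S(2)
        by (rule transition_det_pos[OF c(1) d(1) c(2) d(2) det_J_pos[OF u Rc]])
    qed
  qed
  fix S
  assume a: "S \<in> tangent_space A x \<and> g x S R = 0 \<and> gnorm g x S = gnorm g x R \<and> positively_oriented A x R S"
  have "S c = J (snd c x) (R c)"
  proof (rule J_unique[OF u Rc])
    show "Gc c (snd c x) (S c) (R c) = 0" using metric_coord_at[OF c] a R by simp
    have "g x S S = g x R R" using a by (simp add: gnorm_def)
    then show "Gc c (snd c x) (S c) (S c) = Gc c (snd c x) (R c) (R c)"
      using metric_coord_at[OF c] a R by simp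
    show "det (vector [R c, S c] :: real^2^2) > 0" using a c unfolding positively_oriented_def by blast
  qed
  then show "S = ?S" by (intro tangent_eqI[OF c _ S(1)]) (use a S(2) in simp_all)
qed

lemma
  assumes R: "R \<in> tangent_space A x" "R \<noteq> 0"
  shows rperp_tangent: "rperp A g x R \<in> tangent_space A x"
    and rperp_orthogonal: "g x (rperp A g x R) R = 0"
    and rperp_norm: "g x (rperp A g x R) (rperp A g x R) = g x R R"
    and rperp_nonzero: "rperp A g x R \<noteq> 0"
    and rperp_coord: "c \<in> A \<Longrightarrow> x \<in> fst c \<Longrightarrow> rperp A g x R c = Jc c (snd c x) (R c)"
    and rperp_decomposition: "v \<in> tangent_space A x \<Longrightarrow>
      v = (g x v R / g x R R) *\<^sub>R R + (g x v (rperp A g x R) / g x R R) *\<^sub>R rperp A g x R"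
proof -
  show coord: "rperp A g x R c = Jc c (snd c x) (R c)" if "c \<in> A" "x \<in> fst c" for c
    using rperp_coord_vec[OF that R] coord_vec_at[OF that] by simp
  obtain c where c: "c \<in> A" "x \<in> fst c"
    using mcarrier_chart[OF tangent_in_carrier[OF R]] by metis
  interpret coord_metric "snd c ` fst c" "Gc c" by (rule coord_metric[OF c(1)])
  have u: "snd c x \<in> snd c ` fst c" using c by blast
  have Rc: "R c \<noteq> 0" using R tangent_space_nonzero[OF c R(1)] by simp
  show t: "rperp A g x R \<in> tangent_space A x"
    using rperp_coord_vec[OF c R] coord_vec_tangent[OF c] by simp
  show "g x (rperp A g x R) R = 0"
    using metric_coord_at[OF c t R(1)] J_orthogonal[OF u] coord[OF c] by simp
  show "g x (rperp A g x R) (rperp A g x R) = g x R R"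
    using metric_coord_at[OF c t t] metric_coord_at[OF c R(1) R(1)] J_norm[OF u] coord[OF c] by simp
  show "rperp A g x R \<noteq> 0"
    using J_nonzero[OF u Rc] coord[OF c] by force
  show "v = (g x v R / g x R R) *\<^sub>R R + (g x v (rperp A g x R) / g x R R) *\<^sub>R rperp A g x R" (is "v = ?w")
    if v: "v \<in> tangent_space A x" for v
  proof (rule tangent_eqI[OF c v])
    show "?w \<in> tangent_space A x" by (intro tangent_add tangent_scale R(1) t)
    show "v c = ?w c"
      using orthogonal_decomposition[OF u Rc, of "v c"]
        metric_coord_at[OF c v t] metric_coord_at[OF c v R(1)] metric_coord_at[OF c R(1) R(1)] coord[OF c]
      by simp
  qed
qed

subsection \<open>The Christoffel symbols under a change of charts\<close>

abbreviation D2 :: "('p, real^2) chart \<Rightarrow> ('p, real^2) chart \<Rightarrow> 'p \<Rightarrow> real^2 \<Rightarrow> real^2 \<Rightarrow> real^2" where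
  "D2 c d x h v \<equiv> frechet_derivative (\<lambda>u. frechet_derivative (transition c d) (at u) v) (at (snd c x)) h"

lemma D2_sym:
  assumes "c \<in> A" "d \<in> A" "x \<in> fst c" "x \<in> fst d"
  shows "D2 c d x h v = D2 c d x v h"
  by (rule symmetric_second_derivative[OF smooth_transition open_overlap]) (use assms in auto)

lemma dtrans_has_derivative:
  assumes "c \<in> A" "d \<in> A" "x \<in> fst c" "x \<in> fst d"
  shows "((\<lambda>u. frechet_derivative (transition c d) (at u) v) has_derivative (\<lambda>h. D2 c d x h v)) (at (snd c x))"
  by (rule smooth_on_has_derivative_at[OF smooth_on_frechet_derivative[OF smooth_transition open_overlap] open_overlap])
     (use assms in auto)

lemma metric_coord_transition:
  assumes "c \<in> A" "d \<in> A" "u \<in> overlap c d"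
  shows "Gc c u v w = Gc d (transition c d u) (frechet_derivative (transition c d) (at u) v)
     (frechet_derivative (transition c d) (at u) w)"
proof -
  obtain x where x: "u = snd c x" "x \<in> fst c" "x \<in> fst d" using assms(3) by blast
  note t = coord_vec_tangent[OF assms(1) x(2)]
  show ?thesis
    using metric_coord_at[OF assms(2) x(3) t t, of v w] metric_coord_vec[OF assms(1) x(2)] x assms(1,2)
    by (simp add: coord_vec_def)
qed

lemma metric_derivative_transition:
  assumes c: "c \<in> A" "x \<in> fst c" and d: "d \<in> A" "x \<in> fst d"
  shows "frechet_derivative (\<lambda>u. Gc c u v w) (at (snd c x)) h
     = frechet_derivative (\<lambda>u. Gc d u (dtrans c d x v) (dtrans c d x w)) (at (snd d x)) (dtrans c d x h)
       + Gc d (snd d x) (D2 c d x h v) (dtrans c d x w) + Gc d (snd d x) (dtrans c d x v) (D2 c d x h w)"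
proof -
  interpret d: coord_metric "snd d ` fst d" "Gc d" by (rule coord_metric[OF d(1)])
  have xo: "snd c x \<in> overlap c d" using c d by blast
  note o = open_overlap[OF c(1) d(1)]
  have at: "at (snd c x) within overlap c d = at (snd c x)" by (rule at_within_open[OF xo o])
  have tr: "transition c d (snd c x) = snd d x" using c by simp
  let ?D = "\<lambda>v u. frechet_derivative (transition c d) (at u) v"
  have "((\<lambda>s. Gc d (transition c d s) (?D v s) (?D w s)) has_derivative
     (\<lambda>h. frechet_derivative (\<lambda>p. Gc d p (?D v (snd c x)) (?D w (snd c x))) (at (transition c d (snd c x))) (dtrans c d x h)
        + Gc d (transition c d (snd c x)) (D2 c d x h v) (?D w (snd c x))
        + Gc d (transition c d (snd c x)) (?D v (snd c x)) (D2 c d x h w))) (at (snd c x) within overlap c d)"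
  proof (rule has_derivative_bilinear_family[OF d.open_U d.smooth d.lin1 d.lin2 _ xo])
    show "transition c d s \<in> snd d ` fst d" if "s \<in> overlap c d" for s
      using that c by auto
    show "(transition c d has_derivative dtrans c d x) (at (snd c x) within overlap c d)"
      unfolding at by (rule transition_has_derivative[OF c(1) d(1) c(2) d(2)])
    show "(?D v has_derivative (\<lambda>h. D2 c d x h v)) (at (snd c x) within overlap c d)" for v
      unfolding at by (rule dtrans_has_derivative[OF c(1) d(1) c(2) d(2)])
    then show "(?D w has_derivative (\<lambda>h. D2 c d x h w)) (at (snd c x) within overlap c d)" .
  qed
  then have "((\<lambda>s. Gc c s v w) has_derivative
     (\<lambda>h. frechet_derivative (\<lambda>p. Gc d p (?D v (snd c x)) (?D w (snd c x))) (at (transition c d (snd c x))) (dtrans c d x h)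
        + Gc d (transition c d (snd c x)) (D2 c d x h v) (?D w (snd c x))
        + Gc d (transition c d (snd c x)) (?D v (snd c x)) (D2 c d x h w))) (at (snd c x))"
    unfolding at
    by (rule has_derivative_transform_within_open[OF _ o xo])
       (rule metric_coord_transition[OF c(1) d(1), symmetric])
  from fun_cong[OF frechet_derivative_at[OF this], of h] show ?thesis unfolding tr by (rule sym)
qed

text \<open>The derivative of \<open>g\<^sub>c(v, w) = g\<^sub>d(D\<tau> v, D\<tau> w)\<close> transforms each of the three terms that define the
  Christoffel symbols. With their signs, the second derivatives of \<open>\<tau>\<close> in them combine to
  \<open>2 D\<^sup>2\<tau>(v, w)\<close>, by the symmetry of \<open>D\<^sup>2\<tau>\<close>.\<close>

lemma christoffel_transition:
  assumes c: "c \<in> A" "x \<in> fst c" and d: "d \<in> A" "x \<in> fst d"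
  shows "dtrans c d x (\<Gamma> c (snd c x) v w)
    = \<Gamma> d (snd d x) (dtrans c d x v) (dtrans c d x w) + D2 c d x v w"
proof -
  interpret c: coord_metric "snd c ` fst c" "Gc c" by (rule coord_metric[OF c(1)])
  interpret d: coord_metric "snd d ` fst d" "Gc d" by (rule coord_metric[OF d(1)])
  have uc: "snd c x \<in> snd c ` fst c" and ud: "snd d x \<in> snd d ` fst d" using c d by auto
  let ?D = "dtrans c d x" and ?u = "snd d x"
  have "d.chr ?u (?D v) (?D w) = ?D (c.chr (snd c x) v w) - D2 c d x v w"
  proof (rule d.chr_eqI[OF ud])
    fix e'
    define e where "e = dtrans d c x e'"
    have e': "e' = ?D e"
      unfolding e_def using dtrans_cocycle[OF d(1) c(1) d(1) d(2) c(2) d(2)] dtrans_self[OF d] by simp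
    have G: "Gc c (snd c x) p q = Gc d ?u (?D p) (?D q)" for p q
      using metric_coord_transition[OF c(1) d(1), of "snd c x" p q] c d by auto
    note m = metric_derivative_transition[OF c d]
    have s: "D2 c d x w v = D2 c d x v w" "D2 c d x e v = D2 c d x v e" "D2 c d x e w = D2 c d x w e"
      by (rule D2_sym[OF c(1) d(1) c(2) d(2)])+
    have 1: "c.dG (snd c x) w e v = d.dG ?u (?D w) (?D e) (?D v) + Gc d ?u (D2 c d x v w) (?D e) + Gc d ?u (?D w) (D2 c d x v e)"
      by (rule m)
    have 2: "c.dG (snd c x) v e w = d.dG ?u (?D v) (?D e) (?D w) + Gc d ?u (D2 c d x v w) (?D e) + Gc d ?u (?D v) (D2 c d x w e)"
      using m[of v e w] unfolding s(1) .
    have 3: "c.dG (snd c x) v w e = d.dG ?u (?D v) (?D w) (?D e) + Gc d ?u (?D w) (D2 c d x v e) + Gc d ?u (?D v) (D2 c d x w e)"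
      using m[of v w e] d.G_sym[OF ud, of "D2 c d x v e" "?D w"] unfolding s(2,3) by linarith
    have 4: "2 * Gc d ?u (?D (c.chr (snd c x) v w)) (?D e) = c.dG (snd c x) w e v + c.dG (snd c x) v e w - c.dG (snd c x) v w e"
      using c.G_chr[OF uc, of v w e] unfolding G .
    show "2 * Gc d ?u (?D (c.chr (snd c x) v w) - D2 c d x v w) e'
       = d.dG ?u (?D w) e' (?D v) + d.dG ?u (?D v) e' (?D w) - d.dG ?u (?D v) (?D w) e'"
      unfolding e' d.G_simps[OF ud] using 1 2 3 4 by argo
  qed
  then show ?thesis by simp
qed

subsection \<open>Vector fields along curves\<close>

definition smooth_along :: "real set \<Rightarrow> (real \<Rightarrow> 'p) \<Rightarrow> (real \<Rightarrow> ('p, real^2) tangent) \<Rightarrow> bool" where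
  "smooth_along I \<gamma> V \<longleftrightarrow> (\<forall>t\<in>I. V t \<in> tangent_space A (\<gamma> t)) \<and>
     (\<forall>c\<in>A. smooth_on {t\<in>I. \<gamma> t \<in> fst c} (\<lambda>t. V t c))"

end

locale surface_curve = surface +
  fixes I :: "real set" and \<gamma> :: "real \<Rightarrow> 'a"
  assumes interval: "curve_interval I" and curve: "smooth_curve A I \<gamma>"
begin

abbreviation dom :: "('a, real^2) chart \<Rightarrow> real set" where
  "dom c \<equiv> {t\<in>I. \<gamma> t \<in> fst c}"

lemma dom_openin: "c \<in> A \<Longrightarrow> openin (top_of_set I) (dom c)"
  by (rule smooth_curve_preimage_openin[OF curve])

lemma dom_accessible: "c \<in> A \<Longrightarrow> accessible (dom c)"
  by (rule accessible_interval_part[OF interval dom_openin])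

lemma at_dom: "c \<in> A \<Longrightarrow> t \<in> dom c \<Longrightarrow> at t within dom c = at t within I"
  by (rule at_within_openin[OF dom_openin])

lemma coord_derivative:
  assumes "c \<in> A" "t \<in> dom c"
  shows "((\<lambda>s. snd c (\<gamma> s)) has_vector_derivative velocity A I \<gamma> t c) (at t within dom c)"
  using smooth_curve_has_vector_derivative[OF interval curve assms(1)] assms at_dom[OF assms] by simp

lemma smooth_along_derivative:
  assumes "smooth_along I \<gamma> V" "c \<in> A" "t \<in> dom c"
  shows "((\<lambda>s. V s c) has_vector_derivative vector_derivative (\<lambda>s. V s c) (at t within I)) (at t within dom c)"
proof -
  have "smooth_on (dom c) (\<lambda>s. V s c)" using assms(1,2) unfolding smooth_along_def by blast
  from smooth_on_has_vector_derivative[OF this assms(3) dom_accessible[OF assms(2)]]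
  show ?thesis unfolding at_dom[OF assms(2,3)] .
qed

lemma cov_deriv_coord:
  assumes "c \<in> A" "t \<in> dom c"
  shows "cov_deriv A g I \<gamma> V t c = vector_derivative (\<lambda>s. V s c) (at t within I)
    + \<Gamma> c (snd c (\<gamma> t)) (velocity A I \<gamma> t c) (V t c)"
  using assms by (simp add: cov_deriv_def christoffel_eq)

lemma velocity_smooth_along: "smooth_along I \<gamma> (velocity A I \<gamma>)"
  unfolding smooth_along_def
proof (intro conjI ballI)
  show "velocity A I \<gamma> t \<in> tangent_space A (\<gamma> t)" if "t \<in> I" for t
    by (rule velocity_tangent[OF interval curve that])
  fix c assume c: "c \<in> A"
  have "smooth_on (dom c) (\<lambda>t. vector_derivative (\<lambda>s. snd c (\<gamma> s)) (at t within dom c))"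
    by (rule smooth_on_vector_derivative[OF smooth_curve_coord_smooth[OF curve c] dom_accessible[OF c]])
  then show "smooth_on (dom c) (\<lambda>t. velocity A I \<gamma> t c)"
    by (rule smooth_on_eq) (simp add: velocity_def c at_dom[OF c])
qed

text \<open>Differentiating \<open>V\<^sub>d = D\<tau> V\<^sub>c\<close> along the curve produces a term \<open>D\<^sup>2\<tau>(\<gamma>', V)\<close>, which the inhomogeneous
  term in the transformation law of the Christoffel symbols removes.\<close>

lemma cov_deriv_tangent:
  assumes V: "smooth_along I \<gamma> V" and t: "t \<in> I"
  shows "cov_deriv A g I \<gamma> V t \<in> tangent_space A (\<gamma> t)"
  unfolding tangent_space_def mem_Collect_eq
proof (intro conjI allI ballI impI)
  show "cov_deriv A g I \<gamma> V t c = 0" if "\<not> (c \<in> A \<and> \<gamma> t \<in> fst c)" for c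
    unfolding cov_deriv_def using that by (rule if_not_P)
  fix c d assume c: "c \<in> A" and d: "d \<in> A" and x: "\<gamma> t \<in> fst c \<inter> fst d"
  let ?S = "dom c \<inter> dom d"
  have tc: "t \<in> dom c" and td: "t \<in> dom d" and tS: "t \<in> ?S" using x t by auto
  have oS: "openin (top_of_set I) ?S" by (intro openin_Int dom_openin c d)
  have at: "at t within ?S = at t within I" by (rule at_within_openin[OF oS tS])
  let ?D = "dtrans c d (\<gamma> t)" and ?u' = "velocity A I \<gamma> t c"
  let ?V' = "\<lambda>c. vector_derivative (\<lambda>s. V s c) (at t within I)"
  have Vt: "V s \<in> tangent_space A (\<gamma> s)" if "s \<in> I" for s using V that unfolding smooth_along_def by blast
  have vel: "velocity A I \<gamma> t d = ?D ?u'" "V t d = ?D (V t c)"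
    using tangent_spaceD[OF velocity_tangent[OF interval curve t] c d] tangent_spaceD[OF Vt[OF t] c d] x by auto
  have lin2: "linear (\<lambda>h. D2 c d (\<gamma> t) h v)" for v
    using dtrans_has_derivative[OF c d, of "\<gamma> t" v] x has_derivative_linear by auto
  have linD: "linear ?D" using linear_dtrans[OF c d] x by simp
  have Vc: "((\<lambda>s. V s c) has_derivative (\<lambda>h. h *\<^sub>R ?V' c)) (at t within ?S)"
    using smooth_along_derivative[OF V c tc] at at_dom[OF c tc] by (simp add: has_vector_derivative_def)
  have u: "((\<lambda>s. snd c (\<gamma> s)) has_derivative (\<lambda>h. h *\<^sub>R ?u')) (at t within ?S)"
    using coord_derivative[OF c tc] at at_dom[OF c tc] by (simp add: has_vector_derivative_def)
  have "((\<lambda>s. frechet_derivative (transition c d) (at (snd c (\<gamma> s))) (V s c)) has_derivative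
     (\<lambda>h. D2 c d (\<gamma> t) (h *\<^sub>R ?u') (V t c) + ?D (h *\<^sub>R ?V' c))) (at t within ?S)"
  proof (rule has_derivative_linear_family[where Q = "\<lambda>s. frechet_derivative (transition c d) (at (snd c (\<gamma> s)))"
        and Q' = "\<lambda>v h. D2 c d (\<gamma> t) (h *\<^sub>R ?u') v" and V = "\<lambda>s. V s c", OF _ _ tS Vc])
    show "((\<lambda>s. frechet_derivative (transition c d) (at (snd c (\<gamma> s))) v) has_derivative
        (\<lambda>h. D2 c d (\<gamma> t) (h *\<^sub>R ?u') v)) (at t within ?S)" for v
      by (rule has_derivative_compose[where f = "\<lambda>s. snd c (\<gamma> s)"
            and g = "\<lambda>u. frechet_derivative (transition c d) (at u) v", OF u dtrans_has_derivative])
         (use c d x in auto)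
    show "linear (frechet_derivative (transition c d) (at (snd c (\<gamma> s))))" if "s \<in> ?S" for s
      using linear_dtrans[OF c d] that by simp
  qed
  then have "((\<lambda>s. V s d) has_derivative (\<lambda>h. D2 c d (\<gamma> t) (h *\<^sub>R ?u') (V t c) + ?D (h *\<^sub>R ?V' c)))
     (at t within ?S)"
  proof (rule has_derivative_transform[OF tS, rotated])
    show "V s d = frechet_derivative (transition c d) (at (snd c (\<gamma> s))) (V s c)" if "s \<in> ?S" for s
      using tangent_spaceD[OF Vt c d] that by simp
  qed
  then have "((\<lambda>s. V s d) has_vector_derivative D2 c d (\<gamma> t) ?u' (V t c) + ?D (?V' c)) (at t within I)"
    unfolding at has_vector_derivative_def
    by (simp only: linear_scale[OF lin2] linear_scale[OF linD] scaleR_add_right)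
  from vector_derivative_interval[OF interval t this]
  have Vd: "?V' d = D2 c d (\<gamma> t) ?u' (V t c) + ?D (?V' c)" .
  show "cov_deriv A g I \<gamma> V t d = ?D (cov_deriv A g I \<gamma> V t c)"
    unfolding cov_deriv_coord[OF c tc] cov_deriv_coord[OF d td] linear_add[OF linD] Vd vel
    using christoffel_transition[OF c _ d, of "\<gamma> t" ?u' "V t c"] x by simp
qed

lemma coord_in_domain: "s \<in> dom c \<Longrightarrow> snd c (\<gamma> s) \<in> snd c ` fst c"
  by blast

lemma smooth_along_coord: "smooth_along I \<gamma> V \<Longrightarrow> c \<in> A \<Longrightarrow> smooth_on (dom c) (\<lambda>s. V s c)"
  unfolding smooth_along_def by blast

lemma cov_deriv_smooth_along:
  assumes V: "smooth_along I \<gamma> V"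
  shows "smooth_along I \<gamma> (cov_deriv A g I \<gamma> V)"
  unfolding smooth_along_def
proof (intro conjI ballI)
  show "cov_deriv A g I \<gamma> V t \<in> tangent_space A (\<gamma> t)" if "t \<in> I" for t
    by (rule cov_deriv_tangent[OF V that])
  fix c assume c: "c \<in> A"
  interpret coord_metric "snd c ` fst c" "Gc c" by (rule coord_metric[OF c])
  note acc = dom_accessible[OF c] and Vc = smooth_along_coord[OF V c]
  have "smooth_on (dom c) (\<lambda>t. \<Gamma> c (snd c (\<gamma> t)) (velocity A I \<gamma> t c) (V t c))"
    by (rule smooth_on_bilinear_family[OF acc smooth_chr linear_chr1 linear_chr2 coord_in_domain
          smooth_curve_coord_smooth[OF curve c] smooth_along_coord[OF velocity_smooth_along c] Vc])
  then have "smooth_on (dom c) (\<lambda>t. vector_derivative (\<lambda>s. V s c) (at t within dom c)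
      + \<Gamma> c (snd c (\<gamma> t)) (velocity A I \<gamma> t c) (V t c))"
    by (rule smooth_on_add[OF acc smooth_on_vector_derivative[OF Vc acc]])
  then show "smooth_on (dom c) (\<lambda>t. cov_deriv A g I \<gamma> V t c)"
    by (rule smooth_on_eq) (simp only: cov_deriv_coord[OF c] at_dom[OF c])
qed

lemma metric_compatible:
  assumes V: "smooth_along I \<gamma> V" and W: "smooth_along I \<gamma> W" and t: "t \<in> I"
  shows "((\<lambda>s. g (\<gamma> s) (V s) (W s)) has_vector_derivative
     g (\<gamma> t) (cov_deriv A g I \<gamma> V t) (W t) + g (\<gamma> t) (V t) (cov_deriv A g I \<gamma> W t)) (at t within I)"
proof -
  obtain c where c: "c \<in> A" "\<gamma> t \<in> fst c"
    using mcarrier_chart[OF smooth_curve_in_carrier[OF curve t]] by metis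
  have tc: "t \<in> dom c" using c t by blast
  interpret coord_metric "snd c ` fst c" "Gc c" by (rule coord_metric[OF c(1)])
  have tan: "V s \<in> tangent_space A (\<gamma> s)" "W s \<in> tangent_space A (\<gamma> s)" if "s \<in> I" for s
    using V W that unfolding smooth_along_def by blast+
  note D = metric_derivative_along[OF coord_in_domain tc coord_derivative[OF c(1) tc]
      smooth_along_derivative[OF V c(1) tc] smooth_along_derivative[OF W c(1) tc]]
  have e: "Gc c (snd c (\<gamma> t)) (cov_deriv A g I \<gamma> V t c) (W t c) = g (\<gamma> t) (cov_deriv A g I \<gamma> V t) (W t)"
    "Gc c (snd c (\<gamma> t)) (V t c) (cov_deriv A g I \<gamma> W t c) = g (\<gamma> t) (V t) (cov_deriv A g I \<gamma> W t)"
    by (intro metric_coord_at[OF c] tan[OF t] cov_deriv_tangent[OF _ t] V W)+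
  have "((\<lambda>s. g (\<gamma> s) (V s) (W s)) has_vector_derivative
     g (\<gamma> t) (cov_deriv A g I \<gamma> V t) (W t) + g (\<gamma> t) (V t) (cov_deriv A g I \<gamma> W t)) (at t within dom c)"
    unfolding e[symmetric] cov_deriv_coord[OF c(1) tc]
    by (rule has_vector_derivative_transform[OF tc _ D])
       (use metric_coord_at[OF c(1)] tan in simp)
  then show ?thesis unfolding at_dom[OF c(1) tc] .
qed

end

section \<open>Horizontal and vertical parts of tangent vectors of the slit bundle\<close>

lemma span_insert_iff: "x \<in> span (insert a S) \<longleftrightarrow> (\<exists>k. x - k *\<^sub>R a \<in> span S)"
  by (simp add: span_insert)

lemma span_singleton_iff: "x \<in> span {a} \<longleftrightarrow> (\<exists>k. x = k *\<^sub>R a)"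
  by (auto simp: span_singleton)

lemma dim_span_insert:
  assumes "independent S" "finite S" "a \<notin> span S"
  shows "independent (insert a S)" "dim (span (insert a S)) = Suc (card S)" "a \<notin> S"
proof -
  show a: "a \<notin> S" using assms(3) span_base by blast
  show i: "independent (insert a S)" using assms a by (simp add: independent_insert)
  show "dim (span (insert a S)) = Suc (card S)"
    using dim_span_eq_card_independent[OF i] a assms(2) by simp
qed

context surface
begin

text \<open>The chart that a slit chart is made of; it is determined by \<open>slit_chart_eqD\<close>.\<close>

definition base_chart :: "('p \<times> ('p, real^2) tangent, (real^2) \<times> (real^2)) chart \<Rightarrow> ('p, real^2) chart" where
  "base_chart sc = (THE c. slit_chart A c = sc)"

lemma base_chart [simp]: "base_chart (slit_chart A c) = c"
  unfolding base_chart_def by (rule the_equality) (auto dest: slit_chart_eqD)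

text \<open>The tangent vector at \<open>(x, R)\<close> with horizontal part \<open>v\<close> and vertical part \<open>w\<close> with respect to the
  Levi-Civita connection. The subtracted term comes from \<open>R' = D\<^sub>t R - \<Gamma>(\<gamma>', R)\<close> for a vector field along
  a curve \<open>\<gamma>\<close>.\<close>

definition lift_vec :: "'p \<Rightarrow> ('p, real^2) tangent \<Rightarrow> ('p, real^2) tangent \<Rightarrow> ('p, real^2) tangent
     \<Rightarrow> ('p \<times> ('p, real^2) tangent, (real^2) \<times> (real^2)) tangent" where
  "lift_vec x R v w = (\<lambda>sc. if sc \<in> slit_bundle A \<and> (x, R) \<in> fst sc then
     (let c = base_chart sc in (v c, w c - \<Gamma> c (snd c x) (v c) (R c))) else 0)"

lemma lift_vec_at:
  assumes "c \<in> A" "(x, R) \<in> fst (slit_chart A c)"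
  shows "lift_vec x R v w (slit_chart A c) = (v c, w c - \<Gamma> c (snd c x) (v c) (R c))"
  using assms slit_chart_in[OF assms(1)] by (simp add: lift_vec_def)

lemma slit_bundle_chart:
  assumes "sc \<in> slit_bundle A"
  obtains c where "c \<in> A" "sc = slit_chart A c"
  using assms unfolding slit_bundle_def by blast

lemma slit_carrier_chart:
  assumes "R \<in> tangent_space A x" "R \<noteq> 0"
  obtains c where "c \<in> A" "x \<in> fst c" "(x, R) \<in> fst (slit_chart A c)"
  using mcarrier_chart[OF tangent_in_carrier[OF assms]] assms fst_slit_chart by metis

lemma christoffel_linear:
  assumes "c \<in> A" "x \<in> fst c"
  shows "\<Gamma> c (snd c x) (v + v') w = \<Gamma> c (snd c x) v w + \<Gamma> c (snd c x) v' w"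
    "\<Gamma> c (snd c x) (r *\<^sub>R v) w = r *\<^sub>R \<Gamma> c (snd c x) v w"
    "\<Gamma> c (snd c x) 0 w = 0"
proof -
  interpret coord_metric "snd c ` fst c" "Gc c" by (rule coord_metric[OF assms(1)])
  have l: "linear (\<lambda>v. \<Gamma> c (snd c x) v w)" using assms by (intro linear_chr1) blast
  show "\<Gamma> c (snd c x) (v + v') w = \<Gamma> c (snd c x) v w + \<Gamma> c (snd c x) v' w"
    "\<Gamma> c (snd c x) (r *\<^sub>R v) w = r *\<^sub>R \<Gamma> c (snd c x) v w"
    "\<Gamma> c (snd c x) 0 w = 0"
    using linear_add[OF l] linear_scale[OF l] linear_0[OF l] by simp_all
qed

lemma lift_vec_add: "lift_vec x R v w + lift_vec x R v' w' = lift_vec x R (v + v') (w + w')"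
proof
  fix sc
  show "(lift_vec x R v w + lift_vec x R v' w') sc = lift_vec x R (v + v') (w + w') sc"
  proof (cases "sc \<in> slit_bundle A \<and> (x, R) \<in> fst sc")
    case True
    then obtain c where c: "c \<in> A" "sc = slit_chart A c" using slit_bundle_chart by metis
    then have in_c: "(x, R) \<in> fst (slit_chart A c)" "x \<in> fst c" using True by (simp_all add: fst_slit_chart)
    show ?thesis
      unfolding c(2) plus_fun_apply lift_vec_at[OF c(1) in_c(1)] christoffel_linear[OF c(1) in_c(2)] by simp
  qed (auto simp: lift_vec_def)
qed

lemma lift_vec_scale: "r *\<^sub>R lift_vec x R v w = lift_vec x R (r *\<^sub>R v) (r *\<^sub>R w)"
proof
  fix sc
  show "(r *\<^sub>R lift_vec x R v w) sc = lift_vec x R (r *\<^sub>R v) (r *\<^sub>R w) sc"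
  proof (cases "sc \<in> slit_bundle A \<and> (x, R) \<in> fst sc")
    case True
    then obtain c where c: "c \<in> A" "sc = slit_chart A c" using slit_bundle_chart by metis
    then have in_c: "(x, R) \<in> fst (slit_chart A c)" "x \<in> fst c" using True by (simp_all add: fst_slit_chart)
    show ?thesis
      unfolding c(2) scaleR_fun_apply lift_vec_at[OF c(1) in_c(1)] christoffel_linear[OF c(1) in_c(2)]
      by (simp add: scaleR_diff_right)
  qed (auto simp: lift_vec_def)
qed

lemma lift_vec_diff: "lift_vec x R v w - lift_vec x R v' w' = lift_vec x R (v - v') (w - w')"
proof -
  have "lift_vec x R v w - lift_vec x R v' w' = lift_vec x R v w + (-1) *\<^sub>R lift_vec x R v' w'" by simp
  also have "\<dots> = lift_vec x R (v - v') (w - w')"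
    unfolding lift_vec_scale lift_vec_add by simp
  finally show ?thesis .
qed

lemma lift_vec_zero: "lift_vec x R 0 0 = 0"
  using lift_vec_scale[of 0 x R 0 0] by simp

lemma lift_vec_eq_iff:
  assumes R: "R \<in> tangent_space A x" "R \<noteq> 0"
    and t: "v \<in> tangent_space A x" "v' \<in> tangent_space A x" "w \<in> tangent_space A x" "w' \<in> tangent_space A x"
  shows "lift_vec x R v w = lift_vec x R v' w' \<longleftrightarrow> v = v' \<and> w = w'"
proof
  assume eq: "lift_vec x R v w = lift_vec x R v' w'"
  obtain c where c: "c \<in> A" "x \<in> fst c" "(x, R) \<in> fst (slit_chart A c)" using slit_carrier_chart[OF R] .
  have "lift_vec x R v w (slit_chart A c) = lift_vec x R v' w' (slit_chart A c)" using eq by simp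
  then have "v c = v' c" "w c = w' c" unfolding lift_vec_at[OF c(1,3)] by auto
  then show "v = v' \<and> w = w'" using tangent_eqI[OF c(1,2)] t by blast
qed simp

lemma slit_dtrans:
  assumes c: "c \<in> A" and d: "d \<in> A" and x: "x \<in> fst c" "x \<in> fst d" and e: "e \<noteq> 0"
  shows "frechet_derivative (transition (slit_chart A c) (slit_chart A d)) (at (snd c x, e)) (a, b)
    = (dtrans c d x a, D2 c d x a e + dtrans c d x b)"
proof -
  let ?S = "overlap c d \<times> (-{0::real^2})" and ?z = "(snd c x, e)"
  have oS: "open ?S" by (intro open_Times open_overlap c d open_Compl closed_singleton)
  have zS: "?z \<in> ?S" using x e by auto
  have at: "at ?z within ?S = at ?z" by (rule at_within_open[OF zS oS])
  let ?\<tau> = "transition c d"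
  have f: "(fst has_derivative fst) (at ?z)" and s: "(snd has_derivative snd) (at ?z)"
    by (intro bounded_linear_imp_has_derivative bounded_linear_fst bounded_linear_snd)+
  have "((\<lambda>z. ?\<tau> (fst z)) has_derivative (\<lambda>h. dtrans c d x (fst h))) (at ?z)"
    by (rule has_derivative_compose[where f = fst and g = ?\<tau>, OF f])
       (simp add: transition_has_derivative[OF c d x])
  moreover have "((\<lambda>z. frechet_derivative ?\<tau> (at (fst z)) (snd z)) has_derivative
      (\<lambda>h. D2 c d x (fst h) (snd ?z) + frechet_derivative ?\<tau> (at (fst ?z)) (snd h))) (at ?z within ?S)"
  proof (rule has_derivative_linear_family[where Q = "\<lambda>z. frechet_derivative ?\<tau> (at (fst z))"
        and Q' = "\<lambda>v h. D2 c d x (fst h) v" and V = snd and V' = snd, OF _ _ zS])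
    show "((\<lambda>z. frechet_derivative ?\<tau> (at (fst z)) v) has_derivative (\<lambda>h. D2 c d x (fst h) v)) (at ?z within ?S)" for v
      unfolding at
      by (rule has_derivative_compose[where f = fst and g = "\<lambda>u. frechet_derivative ?\<tau> (at u) v", OF f])
         (simp add: dtrans_has_derivative[OF c d x])
    show "linear (frechet_derivative ?\<tau> (at (fst z)))" if "z \<in> ?S" for z
      using linear_dtrans[OF c d] that by auto
    show "(snd has_derivative snd) (at ?z within ?S)" unfolding at by (rule s)
  qed
  ultimately have "((\<lambda>z. (?\<tau> (fst z), frechet_derivative ?\<tau> (at (fst z)) (snd z))) has_derivative
      (\<lambda>h. (dtrans c d x (fst h), D2 c d x (fst h) e + dtrans c d x (snd h)))) (at ?z)"
    unfolding at fst_conv snd_conv by (rule has_derivative_Pair)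
  then have "(transition (slit_chart A c) (slit_chart A d) has_derivative
      (\<lambda>h. (dtrans c d x (fst h), D2 c d x (fst h) e + dtrans c d x (snd h)))) (at ?z)"
  proof (rule has_derivative_transform_within_open[OF _ oS zS])
    fix z assume z: "z \<in> ?S"
    show "(?\<tau> (fst z), frechet_derivative ?\<tau> (at (fst z)) (snd z)) = transition (slit_chart A c) (slit_chart A d) z"
    proof -
      have "fst z \<in> overlap c d" "snd z \<noteq> 0" using z by (auto simp: mem_Times_iff)
      from slit_transition[OF c d this] show ?thesis by simp
    qed
  qed
  from fun_cong[OF frechet_derivative_at[OF this], of "(a, b)"] show ?thesis by simp
qed

text \<open>The second derivative in the differential of a slit transition map (\<open>slit_dtrans\<close>) is the one by
  which the Christoffel symbols fail to be a tensor.\<close>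

lemma lift_vec_tangent:
  assumes v: "v \<in> tangent_space A x" and w: "w \<in> tangent_space A x"
    and R: "R \<in> tangent_space A x" "R \<noteq> 0"
  shows "lift_vec x R v w \<in> tangent_space (slit_bundle A) (x, R)"
  unfolding tangent_space_def mem_Collect_eq
proof (intro conjI allI ballI impI)
  show "lift_vec x R v w sc = 0" if "\<not> (sc \<in> slit_bundle A \<and> (x, R) \<in> fst sc)" for sc
    unfolding lift_vec_def using that by (rule if_not_P)
  fix sc sd assume sc: "sc \<in> slit_bundle A" and sd: "sd \<in> slit_bundle A" and xR: "(x, R) \<in> fst sc \<inter> fst sd"
  obtain c where c: "c \<in> A" "sc = slit_chart A c" using slit_bundle_chart[OF sc] .
  obtain d where d: "d \<in> A" "sd = slit_chart A d" using slit_bundle_chart[OF sd] .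
  have in_c: "(x, R) \<in> fst (slit_chart A c)" "(x, R) \<in> fst (slit_chart A d)" and x: "x \<in> fst c" "x \<in> fst d"
    using xR c d by (simp_all add: fst_slit_chart)
  have Rc: "R c \<noteq> 0" using tangent_space_nonzero[OF c(1) x(1) R(1)] R(2) by simp
  note D = tangent_spaceD[OF _ c(1) d(1) x]
  show "lift_vec x R v w sd = frechet_derivative (transition sc sd) (at (snd sc (x, R))) (lift_vec x R v w sc)"
    unfolding c(2) d(2) lift_vec_at[OF c(1) in_c(1)] lift_vec_at[OF d(1) in_c(2)] snd_slit_chart
      slit_dtrans[OF c(1) d(1) x Rc] D[OF v] D[OF w] D[OF R(1)]
      linear_diff[OF linear_dtrans[OF c(1) d(1) x]] christoffel_transition[OF c(1) x(1) d(1) x(2)]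
    by simp
qed

lemma tangent_is_lift_vec:
  assumes xi: "\<xi> \<in> tangent_space (slit_bundle A) (x, R)" and R: "R \<in> tangent_space A x" "R \<noteq> 0"
  obtains v w where "v \<in> tangent_space A x" "w \<in> tangent_space A x" "\<xi> = lift_vec x R v w"
proof -
  interpret slit: atlas "slit_bundle A" by (rule atlas_slit_bundle)
  obtain c where c: "c \<in> A" "x \<in> fst c" "(x, R) \<in> fst (slit_chart A c)" using slit_carrier_chart[OF R] .
  obtain a b where ab: "\<xi> (slit_chart A c) = (a, b)" by (cases "\<xi> (slit_chart A c)")
  let ?v = "coord_vec A c x a" and ?w = "coord_vec A c x (b + \<Gamma> c (snd c x) a (R c))"
  note t = coord_vec_tangent[OF c(1,2)]
  have "\<xi> = lift_vec x R ?v ?w"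
  proof (rule slit.tangent_eqI[OF slit_chart_in[OF c(1)] c(3) xi lift_vec_tangent[OF t t R]])
    show "\<xi> (slit_chart A c) = lift_vec x R ?v ?w (slit_chart A c)"
      unfolding ab lift_vec_at[OF c(1,3)] coord_vec_at[OF c(1,2)] by simp
  qed
  then show thesis using that t by blast
qed

subsection \<open>Velocities in the slit bundle\<close>

lemma slit_curve_projection:
  assumes I: "curve_interval I" and p: "smooth_curve (slit_bundle A) I (\<lambda>t. (\<gamma> t, R t))"
  shows "smooth_curve A I \<gamma>" "smooth_along I \<gamma> R" "\<And>t. t \<in> I \<Longrightarrow> R t \<noteq> 0"
proof -
  interpret slit: atlas "slit_bundle A" by (rule atlas_slit_bundle)
  have mc: "\<gamma> t \<in> mcarrier A \<and> R t \<in> tangent_space A (\<gamma> t) \<and> R t \<noteq> 0" if "t \<in> I" for t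
    using slit.smooth_curve_in_carrier[OF p that] unfolding mcarrier_slit_bundle .
  then show "R t \<noteq> 0" if "t \<in> I" for t using that by blast
  have dom: "{t \<in> I. (\<gamma> t, R t) \<in> fst (slit_chart A c)} = {t \<in> I. \<gamma> t \<in> fst c}" for c
    using mc by (auto simp: fst_slit_chart)
  have acc: "accessible {t \<in> I. \<gamma> t \<in> fst c}" if "c \<in> A" for c
    using accessible_interval_part[OF I slit.smooth_curve_preimage_openin[OF p slit_chart_in[OF that]]]
    unfolding dom .
  have sm: "smooth_on {t \<in> I. \<gamma> t \<in> fst c} (\<lambda>t. (snd c (\<gamma> t), R t c))" if "c \<in> A" for c
    using slit.smooth_curve_coord_smooth[OF p slit_chart_in[OF that]] unfolding dom snd_slit_chart .
  have s1: "smooth_on {t \<in> I. \<gamma> t \<in> fst c} (\<lambda>t. snd c (\<gamma> t))" if "c \<in> A" for c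
    using smooth_on_linear[OF bounded_linear_fst acc[OF that] sm[OF that]] by simp
  have s2: "smooth_on {t \<in> I. \<gamma> t \<in> fst c} (\<lambda>t. R t c)" if "c \<in> A" for c
    using smooth_on_linear[OF bounded_linear_snd acc[OF that] sm[OF that]] by simp
  show "smooth_along I \<gamma> R" unfolding smooth_along_def using mc s2 by simp
  have "continuous_map (top_of_set I) (manifold_topology A) \<gamma>"
    unfolding continuous_map_def topspace_manifold
  proof (intro conjI allI impI)
    show "\<gamma> \<in> topspace (top_of_set I) \<rightarrow> mcarrier A" using mc by auto
    fix W assume W: "openin (manifold_topology A) W"
    have "{t \<in> I. (\<gamma> t, R t) \<in> {p \<in> mcarrier (slit_bundle A). fst p \<in> W}} = {t \<in> I. \<gamma> t \<in> W}"
      using mc by (auto simp: mcarrier_slit_bundle)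
    moreover have "openin (top_of_set I) {t \<in> topspace (top_of_set I). (\<gamma> t, R t) \<in> {p \<in> mcarrier (slit_bundle A). fst p \<in> W}}"
      using p openin_slit_preimage[OF W] unfolding smooth_curve_def continuous_map_def by blast
    ultimately show "openin (top_of_set I) {t \<in> topspace (top_of_set I). \<gamma> t \<in> W}" by simp
  qed
  then show "smooth_curve A I \<gamma>" unfolding smooth_curve_def using s1 by simp
qed

lemma slit_velocity:
  assumes I: "curve_interval I" and \<gamma>: "smooth_curve A I \<gamma>" and R: "smooth_along I \<gamma> R" and t: "t \<in> I"
  shows "velocity (slit_bundle A) I (\<lambda>t. (\<gamma> t, R t)) t
    = lift_vec (\<gamma> t) (R t) (velocity A I \<gamma> t) (cov_deriv A g I \<gamma> R t)"
proof
  interpret surface_curve A g I \<gamma> by unfold_locales fact+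
  fix sc
  show "velocity (slit_bundle A) I (\<lambda>t. (\<gamma> t, R t)) t sc
    = lift_vec (\<gamma> t) (R t) (velocity A I \<gamma> t) (cov_deriv A g I \<gamma> R t) sc"
  proof (cases "sc \<in> slit_bundle A \<and> (\<gamma> t, R t) \<in> fst sc")
    case True
    then obtain c where c: "c \<in> A" "sc = slit_chart A c" using slit_bundle_chart by metis
    then have in_c: "(\<gamma> t, R t) \<in> fst (slit_chart A c)" and tc: "t \<in> dom c"
      using True t by (simp_all add: fst_slit_chart)
    have "((\<lambda>s. (snd c (\<gamma> s), R s c)) has_vector_derivative
        (velocity A I \<gamma> t c, vector_derivative (\<lambda>s. R s c) (at t within I))) (at t within I)"
      using has_vector_derivative_Pair[OF coord_derivative[OF c(1) tc] smooth_along_derivative[OF R c(1) tc]]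
      unfolding at_dom[OF c(1) tc] .
    from vector_derivative_interval[OF I t this]
    have "vector_derivative (\<lambda>s. snd sc (\<gamma> s, R s)) (at t within I)
       = (velocity A I \<gamma> t c, vector_derivative (\<lambda>s. R s c) (at t within I))"
      unfolding c(2) snd_slit_chart .
    then show ?thesis
      unfolding c(2) lift_vec_at[OF c(1) in_c] cov_deriv_coord[OF c(1) tc]
      using True c by (simp add: velocity_def)
  next
    case False
    then show ?thesis unfolding velocity_def lift_vec_def by (simp only: if_False)
  qed
qed

subsection \<open>The frame\<close>

text \<open>The fields \<open>vf1\<close> and \<open>vf2\<close> are the asserted $f_1^g$ and $f_2^g$. The third field, a rotated geodesic
  spray, will complete them to a frame of \<open>D + [D, D]\<close>.\<close>

definition vf1 :: "'p \<times> ('p, real^2) tangent \<Rightarrow> ('p \<times> ('p, real^2) tangent, (real^2) \<times> (real^2)) tangent" where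
  "vf1 p = lift_vec (fst p) (snd p) (rperp A g (fst p) (snd p)) (- rperp A g (fst p) (snd p))"

definition vf2 :: "'p \<times> ('p, real^2) tangent \<Rightarrow> ('p \<times> ('p, real^2) tangent, (real^2) \<times> (real^2)) tangent" where
  "vf2 p = lift_vec (fst p) (snd p) 0 (snd p)"

definition vf3 :: "'p \<times> ('p, real^2) tangent \<Rightarrow> ('p \<times> ('p, real^2) tangent, (real^2) \<times> (real^2)) tangent" where
  "vf3 p = lift_vec (fst p) (snd p) (rperp A g (fst p) (snd p)) 0"

lemma vf_coord:
  assumes c: "c \<in> A" and u: "u \<in> snd c ` fst c" and e: "e \<noteq> 0"
  shows "vf1 (chart_inv (slit_chart A c) (u, e)) (slit_chart A c) = (Jc c u e, - Jc c u e - \<Gamma> c u (Jc c u e) e)"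
    "vf2 (chart_inv (slit_chart A c) (u, e)) (slit_chart A c) = (0, e)"
    "vf3 (chart_inv (slit_chart A c) (u, e)) (slit_chart A c) = (Jc c u e, - \<Gamma> c u (Jc c u e) e)"
proof -
  obtain x where x: "x \<in> fst c" "u = snd c x" using u by blast
  have inv: "chart_inv (slit_chart A c) (u, e) = (x, coord_vec A c x e)"
    using slit_chart_inv[OF c u e] x c by simp
  have R: "coord_vec A c x e \<in> tangent_space A x" "coord_vec A c x e c = e"
    using coord_vec_tangent[OF c x(1)] coord_vec_at[OF c x(1)] by simp_all
  then have R0: "coord_vec A c x e \<noteq> 0" using e by force
  have in_c: "(x, coord_vec A c x e) \<in> fst (slit_chart A c)" using x R R0 by (simp add: fst_slit_chart)
  note p = rperp_coord[OF R(1) R0 c x(1)]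
  show "vf1 (chart_inv (slit_chart A c) (u, e)) (slit_chart A c) = (Jc c u e, - Jc c u e - \<Gamma> c u (Jc c u e) e)"
    "vf2 (chart_inv (slit_chart A c) (u, e)) (slit_chart A c) = (0, e)"
    "vf3 (chart_inv (slit_chart A c) (u, e)) (slit_chart A c) = (Jc c u e, - \<Gamma> c u (Jc c u e) e)"
    unfolding vf1_def vf2_def vf3_def inv fst_conv snd_conv lift_vec_at[OF c in_c]
    using p R(2) x(2) christoffel_linear(3)[OF c x(1)] by simp_all
qed

lemma vf_smooth:
  "smooth_vector_field (slit_bundle A) (mcarrier (slit_bundle A)) vf1"
  "smooth_vector_field (slit_bundle A) (mcarrier (slit_bundle A)) vf2"
  "smooth_vector_field (slit_bundle A) (mcarrier (slit_bundle A)) vf3"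
proof -
  interpret slit: atlas "slit_bundle A" by (rule atlas_slit_bundle)
  have tangent: "vf1 p \<in> tangent_space (slit_bundle A) p" "vf2 p \<in> tangent_space (slit_bundle A) p"
    "vf3 p \<in> tangent_space (slit_bundle A) p" if "p \<in> mcarrier (slit_bundle A)" for p
  proof -
    obtain x R where p: "p = (x, R)" by (cases p)
    have R: "R \<in> tangent_space A x" "R \<noteq> 0" using that unfolding p mcarrier_slit_bundle by simp_all
    note t = rperp_tangent[OF R] tangent_neg[OF rperp_tangent[OF R]] tangent_zero R
    show "vf1 p \<in> tangent_space (slit_bundle A) p" "vf2 p \<in> tangent_space (slit_bundle A) p"
      "vf3 p \<in> tangent_space (slit_bundle A) p"
      unfolding p vf1_def vf2_def vf3_def fst_conv snd_conv by (intro lift_vec_tangent t)+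
  qed
  have sm: "smooth_on (snd sc ` (mcarrier (slit_bundle A) \<inter> fst sc)) (\<lambda>z. X (chart_inv sc z) sc)"
    if sc: "sc \<in> slit_bundle A" and X: "X \<in> {vf1, vf2, vf3}" for sc X
  proof -
    obtain c where c: "c \<in> A" "sc = slit_chart A c" using slit_bundle_chart[OF sc] .
    interpret coord_metric "snd c ` fst c" "Gc c" by (rule coord_metric[OF c(1)])
    let ?U = "snd c ` fst c"
    let ?S = "?U \<times> (-{0::real^2})"
    have acc: "accessible ?S" by (intro accessible_open open_Times open_U open_Compl closed_singleton)
    have f: "smooth_on ?S fst" and s: "smooth_on ?S snd"
      using smooth_on_linear[OF bounded_linear_fst acc smooth_on_ident[OF acc]]
        smooth_on_linear[OF bounded_linear_snd acc smooth_on_ident[OF acc]] by simp_all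
    have fU: "fst z \<in> ?U" if "z \<in> ?S" for z using that by auto
    have sN: "snd z \<noteq> 0" if "z \<in> ?S" for z using that by auto
    have vz: "vf1 (chart_inv sc z) sc = (J (fst z) (snd z), - J (fst z) (snd z) - chr (fst z) (J (fst z) (snd z)) (snd z))"
      "vf2 (chart_inv sc z) sc = (0, snd z)"
      "vf3 (chart_inv sc z) sc = (J (fst z) (snd z), - chr (fst z) (J (fst z) (snd z)) (snd z))" if "z \<in> ?S" for z
      using vf_coord[OF c(1) fU[OF that] sN[OF that]] c(2) by simp_all
    have J: "smooth_on ?S (\<lambda>z. J (fst z) (snd z))"
    proof (rule smooth_on_linear_family[where Q = "\<lambda>z. J (fst z)", OF acc _ linear_J[OF fU] s])
      show "smooth_on ?S (\<lambda>z. J (fst z) b)" for b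
        by (rule smooth_on_compose[OF smooth_J f acc]) auto
    qed
    have Ga: "smooth_on ?S (\<lambda>z. chr (fst z) (J (fst z) (snd z)) (snd z))"
      by (rule smooth_on_bilinear_family[OF acc smooth_chr linear_chr1 linear_chr2 fU f J s])
    have im: "snd sc ` (mcarrier (slit_bundle A) \<inter> fst sc) = ?S"
    proof -
      have "mcarrier (slit_bundle A) \<inter> fst sc = fst sc" using sc unfolding mcarrier_def by blast
      then show ?thesis using slit_image[OF c(1)] c(2) by simp
    qed
    have "smooth_on ?S (\<lambda>z. (J (fst z) (snd z), - J (fst z) (snd z) - chr (fst z) (J (fst z) (snd z)) (snd z)))"
      by (intro smooth_on_Pair[OF acc] smooth_on_diff[OF acc] smooth_on_minus[OF acc] J Ga)
    then have 1: "smooth_on ?S (\<lambda>z. vf1 (chart_inv sc z) sc)"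
      by (rule smooth_on_eq) (rule vz(1))
    have "smooth_on ?S (\<lambda>z. (0::real^2, snd z))"
      by (intro smooth_on_Pair[OF acc] smooth_on_const[OF acc] s)
    then have 2: "smooth_on ?S (\<lambda>z. vf2 (chart_inv sc z) sc)"
      by (rule smooth_on_eq) (rule vz(2))
    have "smooth_on ?S (\<lambda>z. (J (fst z) (snd z), - chr (fst z) (J (fst z) (snd z)) (snd z)))"
      by (intro smooth_on_Pair[OF acc] smooth_on_minus[OF acc] J Ga)
    then have 3: "smooth_on ?S (\<lambda>z. vf3 (chart_inv sc z) sc)"
      by (rule smooth_on_eq) (rule vz(3))
    show ?thesis unfolding im using 1 2 3 X by auto
  qed
  show "smooth_vector_field (slit_bundle A) (mcarrier (slit_bundle A)) vf1"
    "smooth_vector_field (slit_bundle A) (mcarrier (slit_bundle A)) vf2"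
    "smooth_vector_field (slit_bundle A) (mcarrier (slit_bundle A)) vf3"
    unfolding smooth_vector_field_def
    by (intro conjI ballI slit.openin_mcarrier tangent; assumption?; rule sm; simp)+
qed

context
  fixes x :: 'p and R :: "('p, real^2) tangent"
  assumes R: "R \<in> tangent_space A x" "R \<noteq> 0"
begin

abbreviation P where "P \<equiv> rperp A g x R"

lemmas P_tangent = rperp_tangent[OF R]

lemma RR_pos: "g x R R > 0"
  using metric_facts(4)[OF tangent_in_carrier[OF R] R(1) R(1) R(2)] .

lemma in_span_vf12:
  "\<xi> \<in> span {vf1 (x, R), vf2 (x, R)} \<longleftrightarrow> (\<exists>a b. \<xi> = lift_vec x R (a *\<^sub>R P) (b *\<^sub>R R - a *\<^sub>R P))"
proof -
  have "\<xi> - a *\<^sub>R vf1 (x, R) = b *\<^sub>R vf2 (x, R) \<longleftrightarrow> \<xi> = lift_vec x R (a *\<^sub>R P) (b *\<^sub>R R - a *\<^sub>R P)" for a b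
    unfolding diff_eq_eq vf1_def vf2_def fst_conv snd_conv lift_vec_scale lift_vec_add by simp
  then show ?thesis unfolding span_insert_iff[of _ "vf1 (x, R)"] span_singleton_iff by simp
qed

lemma RP_cancel:
  assumes "a *\<^sub>R R + b *\<^sub>R P = 0"
  shows "a = 0" "b = 0"
proof -
  note gs = g_simps[OF tangent_in_carrier[OF R]]
  note t = R(1) P_tangent tangent_scale[OF R(1)] tangent_scale[OF P_tangent]
  have "g x (a *\<^sub>R R + b *\<^sub>R P) R = 0" using gs(9)[OF t(1) t(1) t(1)] assms by simp
  then have "a * g x R R = 0"
    unfolding gs(1)[OF t(3) t(4) t(1)] gs(3)[OF t(1) t(1) t(1)] gs(3)[OF t(2) t(1) t(1)] rperp_orthogonal[OF R] by simp
  then show a: "a = 0" using RR_pos by simp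
  then show "b = 0" using assms rperp_nonzero[OF R] by simp
qed

text \<open>The difference of \<open>vf3\<close> and \<open>vf1\<close> has the parts \<open>0\<close> and \<open>P\<close>, so that the three fields give arbitrary
  vertical parts, but only horizontal parts orthogonal to \<open>R\<close>.\<close>

lemma in_span_vf312:
  "\<xi> \<in> span {vf3 (x, R), vf1 (x, R), vf2 (x, R)} \<longleftrightarrow>
    (\<exists>a. \<exists>w\<in>tangent_space A x. \<xi> = lift_vec x R (a *\<^sub>R P) w)"
proof
  assume "\<xi> \<in> span {vf3 (x, R), vf1 (x, R), vf2 (x, R)}"
  then obtain k a b where "\<xi> - k *\<^sub>R vf3 (x, R) = lift_vec x R (a *\<^sub>R P) (b *\<^sub>R R - a *\<^sub>R P)"
    unfolding span_insert_iff[of _ "vf3 (x, R)"] in_span_vf12 by blast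
  then have "\<xi> = lift_vec x R (a *\<^sub>R P) (b *\<^sub>R R - a *\<^sub>R P) + k *\<^sub>R vf3 (x, R)" by (simp add: diff_eq_eq)
  also have "\<dots> = lift_vec x R ((a + k) *\<^sub>R P) (b *\<^sub>R R - a *\<^sub>R P)"
    unfolding vf3_def fst_conv snd_conv lift_vec_scale lift_vec_add by (simp add: scaleR_add_left)
  finally show "\<exists>a. \<exists>w\<in>tangent_space A x. \<xi> = lift_vec x R (a *\<^sub>R P) w"
    using tangent_diff[OF tangent_scale[OF R(1)] tangent_scale[OF P_tangent]] by blast
next
  assume "\<exists>a. \<exists>w\<in>tangent_space A x. \<xi> = lift_vec x R (a *\<^sub>R P) w"
  then obtain a w where w: "w \<in> tangent_space A x" "\<xi> = lift_vec x R (a *\<^sub>R P) w" by blast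
  obtain \<beta> \<delta> where bd: "w = \<beta> *\<^sub>R R + \<delta> *\<^sub>R P" using rperp_decomposition[OF R w(1)] by blast
  have "\<xi> - (a + \<delta>) *\<^sub>R vf3 (x, R) = lift_vec x R ((- \<delta>) *\<^sub>R P) (\<beta> *\<^sub>R R - (- \<delta>) *\<^sub>R P)"
    unfolding w(2) bd vf3_def fst_conv snd_conv lift_vec_scale lift_vec_diff by (simp add: scaleR_add_left)
  then show "\<xi> \<in> span {vf3 (x, R), vf1 (x, R), vf2 (x, R)}"
    unfolding span_insert_iff[of _ "vf3 (x, R)"] in_span_vf12 by blast
qed

lemma vf2_nonzero: "vf2 (x, R) \<noteq> 0"
  using lift_vec_eq_iff[OF R tangent_zero tangent_zero R(1) tangent_zero] R(2)
  by (simp add: vf2_def lift_vec_zero)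

lemma vf1_notin: "vf1 (x, R) \<notin> span {vf2 (x, R)}"
proof
  assume "vf1 (x, R) \<in> span {vf2 (x, R)}"
  then obtain k where "vf1 (x, R) = k *\<^sub>R vf2 (x, R)" unfolding span_singleton_iff by blast
  then have "lift_vec x R P (- P) = lift_vec x R (k *\<^sub>R 0) (k *\<^sub>R R)"
    unfolding vf1_def vf2_def fst_conv snd_conv lift_vec_scale .
  then have "P = k *\<^sub>R 0"
    using lift_vec_eq_iff[OF R P_tangent tangent_scale[OF tangent_zero] tangent_neg[OF P_tangent] tangent_scale[OF R(1)]]
    by blast
  then show False using rperp_nonzero[OF R] by simp
qed

lemma vf3_notin: "vf3 (x, R) \<notin> span {vf1 (x, R), vf2 (x, R)}"
proof
  assume "vf3 (x, R) \<in> span {vf1 (x, R), vf2 (x, R)}"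
  then obtain a b where "lift_vec x R P 0 = lift_vec x R (a *\<^sub>R P) (b *\<^sub>R R - a *\<^sub>R P)"
    unfolding in_span_vf12 vf3_def fst_conv snd_conv by blast
  then have "P = a *\<^sub>R P" "0 = b *\<^sub>R R - a *\<^sub>R P"
    using lift_vec_eq_iff[OF R P_tangent tangent_scale[OF P_tangent] tangent_zero
        tangent_diff[OF tangent_scale[OF R(1)] tangent_scale[OF P_tangent]]] by blast+
  then have "b *\<^sub>R R + (-1) *\<^sub>R P = 0" by simp
  from RP_cancel(2)[OF this] show False by simp
qed

lemma independent_vf12: "independent {vf1 (x, R), vf2 (x, R)}" "vf1 (x, R) \<noteq> vf2 (x, R)"
  "dim (span {vf1 (x, R), vf2 (x, R)}) = 2"
proof -
  have i: "independent {vf2 (x, R)}" using vf2_nonzero by simp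
  note d = dim_span_insert[OF i _ vf1_notin]
  show "independent {vf1 (x, R), vf2 (x, R)}" "vf1 (x, R) \<noteq> vf2 (x, R)"
    "dim (span {vf1 (x, R), vf2 (x, R)}) = 2" using d by simp_all
qed

lemma independent_vf312: "independent {vf3 (x, R), vf1 (x, R), vf2 (x, R)}"
  "card {vf3 (x, R), vf1 (x, R), vf2 (x, R)} = 3"
  "dim (span {vf3 (x, R), vf1 (x, R), vf2 (x, R)}) = 3"
  using dim_span_insert[OF independent_vf12(1) _ vf3_notin] independent_vf12(2) by simp_all

text \<open>By \<open>in_span_vf312\<close> the tangent vectors whose horizontal part is orthogonal to \<open>R\<close> form a hyperplane, and
  any vector outside of it completes the frame.\<close>

lemma dim_full:
  assumes v: "v \<in> tangent_space A x" "g x v R \<noteq> 0" and w: "w \<in> tangent_space A x"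
  shows "dim (tangent_space (slit_bundle A) (x, R)) = 4"
    and "tangent_space (slit_bundle A) (x, R) \<subseteq> span (insert (lift_vec x R v w) {vf3 (x, R), vf1 (x, R), vf2 (x, R)})"
proof -
  interpret slit: atlas "slit_bundle A" by (rule atlas_slit_bundle)
  let ?k = "lift_vec x R v w" and ?B = "{vf3 (x, R), vf1 (x, R), vf2 (x, R)}"
  note gs = g_simps[OF tangent_in_carrier[OF R]]
  have aP: "g x (a *\<^sub>R P) R = 0" for a
    using gs(3)[OF P_tangent R(1) R(1)] rperp_orthogonal[OF R] by simp
  have k: "?k \<notin> span ?B"
  proof
    assume "?k \<in> span ?B"
    then obtain a w' where "w' \<in> tangent_space A x" "?k = lift_vec x R (a *\<^sub>R P) w'"
      unfolding in_span_vf312 by blast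
    then have "v = a *\<^sub>R P" using lift_vec_eq_iff[OF R v(1) tangent_scale[OF P_tangent] w] by blast
    then show False using v(2) aP by simp
  qed
  show sub: "tangent_space (slit_bundle A) (x, R) \<subseteq> span (insert ?k ?B)"
  proof
    fix \<xi> assume "\<xi> \<in> tangent_space (slit_bundle A) (x, R)"
    then obtain v' w' where v': "v' \<in> tangent_space A x" "w' \<in> tangent_space A x" "\<xi> = lift_vec x R v' w'"
      using tangent_is_lift_vec[OF _ R] by metis
    define l where "l = g x v' R / g x v R"
    have t: "v' - l *\<^sub>R v \<in> tangent_space A x" "w' - l *\<^sub>R w \<in> tangent_space A x"
      by (intro tangent_diff tangent_scale v' v w)+
    have "g x (v' - l *\<^sub>R v) R = g x v' R - l * g x v R"
      using gs(2)[OF v'(1) tangent_scale[OF v(1)] R(1)] gs(3)[OF v(1) R(1) R(1)] by simp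
    then have "g x (v' - l *\<^sub>R v) R = 0" using v(2) by (simp add: l_def)
    then obtain a where "v' - l *\<^sub>R v = a *\<^sub>R P"
      using rperp_decomposition[OF R t(1)] by force
    then have "\<xi> - l *\<^sub>R ?k = lift_vec x R (a *\<^sub>R P) (w' - l *\<^sub>R w)"
      unfolding v'(3) lift_vec_scale lift_vec_diff by simp
    then have "\<xi> - l *\<^sub>R ?k \<in> span ?B" unfolding in_span_vf312 using t(2) by blast
    then show "\<xi> \<in> span (insert ?k ?B)" unfolding span_insert_iff[of _ ?k] by blast
  qed
  have P0: "- P \<in> tangent_space A x" by (rule tangent_neg[OF P_tangent])
  have "insert ?k ?B \<subseteq> tangent_space (slit_bundle A) (x, R)"
    unfolding vf1_def vf2_def vf3_def fst_conv snd_conv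
    by (intro insert_subsetI lift_vec_tangent v w P_tangent R tangent_zero P0 empty_subsetI)
  then have "span (insert ?k ?B) \<subseteq> tangent_space (slit_bundle A) (x, R)"
    by (rule span_minimal[OF _ slit.subspace_tangent_space])
  then have "tangent_space (slit_bundle A) (x, R) = span (insert ?k ?B)" using sub by (rule equalityI[rotated])
  then show "dim (tangent_space (slit_bundle A) (x, R)) = 4"
    using dim_span_insert(2)[OF independent_vf312(1) _ k] independent_vf312(2) by simp
qed

end

end

section \<open>Brackets and the Engel property\<close>

lemma directional_derivative:
  assumes "(F has_derivative F') (at z)"
  shows "((\<lambda>t. F (z + t *\<^sub>R h)) has_vector_derivative F' h) (at (0::real))"
proof -
  have "((\<lambda>t. z + t *\<^sub>R h) has_derivative (\<lambda>t. t *\<^sub>R h)) (at (0::real))"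
    by (auto intro!: derivative_eq_intros)
  then have "((\<lambda>t. F (z + t *\<^sub>R h)) has_derivative (\<lambda>t. F' (t *\<^sub>R h))) (at (0::real))"
    by (rule has_derivative_compose[where f = "\<lambda>t. z + t *\<^sub>R h" and g = F]) (simp add: assms)
  then show ?thesis
    unfolding has_vector_derivative_def linear_scale[OF has_derivative_linear[OF assms]] .
qed

context surface
begin

context
  fixes x :: 'p and R :: "('p, real^2) tangent" and c :: "('p, real^2) chart"
  assumes R: "R \<in> tangent_space A x" "R \<noteq> 0" and c: "c \<in> A" "x \<in> fst c"
begin

abbreviation (input) "schart \<equiv> slit_chart A c"
abbreviation (input) "base_pt \<equiv> snd c x"
abbreviation (input) "fib_pt \<equiv> R c"

lemma sc_facts: "(x, R) \<in> fst schart" "schart \<in> slit_bundle A" "(x, R) \<in> mcarrier (slit_bundle A)" "fib_pt \<noteq> 0"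
  "base_pt \<in> snd c ` fst c"
proof -
  show "(x, R) \<in> fst schart" using R c by (simp add: fst_slit_chart)
  then show "(x, R) \<in> mcarrier (slit_bundle A)"
    unfolding mcarrier_def using slit_chart_in[OF c(1)] by blast
  show "fib_pt \<noteq> 0" using tangent_space_nonzero[OF c R(1)] R(2) by simp
  show "schart \<in> slit_bundle A" by (rule slit_chart_in[OF c(1)])
  show "base_pt \<in> snd c ` fst c" using c(2) by (rule imageI)
qed

lemma field_has_derivative:
  assumes "smooth_vector_field (slit_bundle A) W X" "(x, R) \<in> W"
  shows "((\<lambda>z. X (chart_inv schart z) schart) has_derivative
      frechet_derivative (\<lambda>z. X (chart_inv schart z) schart) (at (base_pt, fib_pt))) (at (base_pt, fib_pt))"
proof -
  interpret slit: atlas "slit_bundle A" by (rule atlas_slit_bundle)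
  have W: "openin (manifold_topology (slit_bundle A)) W"
    and sm: "smooth_on (snd schart ` (W \<inter> fst schart)) (\<lambda>z. X (chart_inv schart z) schart)"
    using assms(1) sc_facts(2) unfolding smooth_vector_field_def by auto
  have "(base_pt, fib_pt) \<in> snd schart ` (W \<inter> fst schart)"
    using assms(2) sc_facts(1) by (intro image_eqI[of _ _ "(x, R)"]) auto
  from smooth_on_has_derivative_at[OF sm slit.openin_chart_image[OF W sc_facts(2)] this] show ?thesis .
qed

lemma bracket_at:
  "lie_bracket (slit_bundle A) X Y (x, R) schart
     = frechet_derivative (\<lambda>z. Y (chart_inv schart z) schart) (at (base_pt, fib_pt)) (X (x, R) schart)
     - frechet_derivative (\<lambda>z. X (chart_inv schart z) schart) (at (base_pt, fib_pt)) (Y (x, R) schart)"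
  using sc_facts by (simp add: lie_bracket_def)

lemma vf_at:
  "vf1 (x, R) schart = (Jc c base_pt fib_pt, - Jc c base_pt fib_pt - \<Gamma> c base_pt (Jc c base_pt fib_pt) fib_pt)"
  "vf2 (x, R) schart = (0, fib_pt)"
  "vf3 (x, R) schart = (Jc c base_pt fib_pt, - \<Gamma> c base_pt (Jc c base_pt fib_pt) fib_pt)"
proof -
  interpret slit: atlas "slit_bundle A" by (rule atlas_slit_bundle)
  have "chart_inv schart (base_pt, fib_pt) = (x, R)"
    using slit.chart_inv_chart[OF sc_facts(2,1)] by simp
  then show "vf1 (x, R) schart = (Jc c base_pt fib_pt, - Jc c base_pt fib_pt - \<Gamma> c base_pt (Jc c base_pt fib_pt) fib_pt)"
    "vf2 (x, R) schart = (0, fib_pt)" "vf3 (x, R) schart = (Jc c base_pt fib_pt, - \<Gamma> c base_pt (Jc c base_pt fib_pt) fib_pt)"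
    using vf_coord[OF c(1) sc_facts(5,4)] by simp_all
qed

lemma vf2_derivative:
  "frechet_derivative (\<lambda>z. vf2 (chart_inv schart z) schart) (at (base_pt, fib_pt)) h = (0, snd h)"
proof -
  have o: "open ((snd c ` fst c) \<times> (-{0::real^2}))"
    by (intro open_Times open_chart_image c(1) open_Compl closed_singleton)
  have "((\<lambda>z :: (real^2) \<times> (real^2). (0 :: real^2, snd z)) has_derivative (\<lambda>h. (0, snd h))) (at (base_pt, fib_pt))"
    by (intro bounded_linear_imp_has_derivative bounded_linear_Pair bounded_linear_zero bounded_linear_snd)
  then have "((\<lambda>z. vf2 (chart_inv schart z) schart) has_derivative (\<lambda>h. (0, snd h))) (at (base_pt, fib_pt))"
  proof (rule has_derivative_transform_within_open[OF _ o])
    show "(base_pt, fib_pt) \<in> (snd c ` fst c) \<times> (-{0})" using sc_facts(4,5) by blast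
    show "(0, snd z) = vf2 (chart_inv schart z) schart" if "z \<in> (snd c ` fst c) \<times> (-{0})" for z
      using vf_coord(2)[OF c(1), of "fst z" "snd z"] that by (auto simp: mem_Times_iff)
  qed
  from fun_cong[OF frechet_derivative_at[OF this], of h] show ?thesis by (rule sym)
qed

text \<open>Along the ray \<open>t \<mapsto> (base_pt, (1 + t) fib_pt)\<close> the coordinates of \<open>vf1\<close> are the sum of a part of
  degree one and a part of degree two in \<open>1 + t\<close>.\<close>

lemma vf1_radial_derivative:
  "frechet_derivative (\<lambda>z. vf1 (chart_inv schart z) schart) (at (base_pt, fib_pt)) (0, fib_pt)
     = (Jc c base_pt fib_pt, - Jc c base_pt fib_pt - 2 *\<^sub>R \<Gamma> c base_pt (Jc c base_pt fib_pt) fib_pt)"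
proof -
  interpret coord_metric "snd c ` fst c" "Gc c" by (rule coord_metric[OF c(1)])
  note lJ = linear_scale[OF linear_J[OF sc_facts(5)]]
    and l1 = linear_scale[OF linear_chr1[OF sc_facts(5)]] and l2 = linear_scale[OF linear_chr2[OF sc_facts(5)]]
  have 1: "((\<lambda>t. vf1 (chart_inv schart ((base_pt, fib_pt) + t *\<^sub>R (0, fib_pt))) schart) has_vector_derivative
     frechet_derivative (\<lambda>z. vf1 (chart_inv schart z) schart) (at (base_pt, fib_pt)) (0, fib_pt)) (at (0::real))"
    by (rule directional_derivative[OF field_has_derivative[OF vf_smooth(1) sc_facts(3)]])
  have "((\<lambda>t. ((1 + t) *\<^sub>R J base_pt fib_pt, - ((1 + t) *\<^sub>R J base_pt fib_pt) - ((1 + t) * (1 + t)) *\<^sub>R chr base_pt (J base_pt fib_pt) fib_pt)) has_vector_derivative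
     (J base_pt fib_pt, - J base_pt fib_pt - 2 *\<^sub>R chr base_pt (J base_pt fib_pt) fib_pt)) (at (0::real))"
    by (auto intro!: derivative_eq_intros has_vector_derivative_Pair)
  then have 2: "((\<lambda>t. vf1 (chart_inv schart ((base_pt, fib_pt) + t *\<^sub>R (0, fib_pt))) schart) has_vector_derivative
     (J base_pt fib_pt, - J base_pt fib_pt - 2 *\<^sub>R chr base_pt (J base_pt fib_pt) fib_pt)) (at (0::real))"
  proof (rule has_vector_derivative_transform_within_open)
    show "open {-1<..<1::real}" "0 \<in> {-1<..<1::real}" by auto
    fix t :: real assume t: "t \<in> {-1<..<1}"
    have z: "(base_pt, fib_pt) + t *\<^sub>R (0, fib_pt) = (base_pt, (1 + t) *\<^sub>R fib_pt)" by (simp add: scaleR_add_left)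
    have "(1 + t) *\<^sub>R fib_pt \<noteq> 0" using t sc_facts(4) by simp
    from vf_coord(1)[OF c(1) sc_facts(5) this]
    show "((1 + t) *\<^sub>R J base_pt fib_pt, - ((1 + t) *\<^sub>R J base_pt fib_pt) - ((1 + t) * (1 + t)) *\<^sub>R chr base_pt (J base_pt fib_pt) fib_pt)
       = vf1 (chart_inv schart ((base_pt, fib_pt) + t *\<^sub>R (0, fib_pt))) schart"
      unfolding z lJ l1 l2 by simp
  qed
  show ?thesis by (rule vector_derivative_unique_at[OF 1 2])
qed

text \<open>The bracket with \<open>vf2\<close>, the Euler field of the fibres, multiplies a horizontal coordinate by its
  degree in the fibre, and a vertical one by its degree minus one. It therefore keeps the horizontal
  coordinate of \<open>vf1\<close> and the quadratic part of the vertical one, and removes the linear part.\<close>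

lemma bracket_vf2_vf1: "lie_bracket (slit_bundle A) vf2 vf1 (x, R) = vf3 (x, R)"
proof -
  interpret slit: atlas "slit_bundle A" by (rule atlas_slit_bundle)
  show ?thesis
  proof (rule slit.tangent_eqI[OF sc_facts(2,1) slit.lie_bracket_tangent[OF vf_smooth(2,1) sc_facts(3)]])
    show "vf3 (x, R) \<in> tangent_space (slit_bundle A) (x, R)"
      using vf_smooth(3) sc_facts(3) unfolding smooth_vector_field_def by blast
    show "lie_bracket (slit_bundle A) vf2 vf1 (x, R) schart = vf3 (x, R) schart"
      unfolding bracket_at vf_at vf1_radial_derivative vf2_derivative by (simp add: scaleR_2)
  qed
qed

lemma vf31_horizontal_derivative:
  "fst (frechet_derivative (\<lambda>z. vf3 (chart_inv schart z) schart) (at (base_pt, fib_pt)) h)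
   = fst (frechet_derivative (\<lambda>z. vf1 (chart_inv schart z) schart) (at (base_pt, fib_pt)) h)"
proof -
  have o: "open ((snd c ` fst c) \<times> (-{0::real^2}))"
    by (intro open_Times open_chart_image c(1) open_Compl closed_singleton)
  have d: "((\<lambda>z. fst (X (chart_inv schart z) schart)) has_derivative
      (\<lambda>h. fst (frechet_derivative (\<lambda>z. X (chart_inv schart z) schart) (at (base_pt, fib_pt)) h))) (at (base_pt, fib_pt))"
    if "X = vf1 \<or> X = vf3" for X
    using that field_has_derivative[OF vf_smooth(1) sc_facts(3)] field_has_derivative[OF vf_smooth(3) sc_facts(3)]
      bounded_linear.has_derivative[OF bounded_linear_fst] by metis
  have "((\<lambda>z. fst (vf1 (chart_inv schart z) schart)) has_derivative
      (\<lambda>h. fst (frechet_derivative (\<lambda>z. vf3 (chart_inv schart z) schart) (at (base_pt, fib_pt)) h))) (at (base_pt, fib_pt))"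
  proof (rule has_derivative_transform_within_open[OF d o])
    show "(base_pt, fib_pt) \<in> (snd c ` fst c) \<times> (-{0})" using sc_facts(4,5) by blast
    show "fst (vf3 (chart_inv schart z) schart) = fst (vf1 (chart_inv schart z) schart)"
      if "z \<in> (snd c ` fst c) \<times> (-{0})" for z
    proof -
      have z: "fst z \<in> snd c ` fst c" "snd z \<noteq> 0" using that by (auto simp: mem_Times_iff)
      show ?thesis using vf_coord(1,3)[OF c(1) z] by simp
    qed
  qed simp
  from has_derivative_unique[OF this d[of vf1]] show ?thesis by (simp add: fun_eq_iff)
qed

text \<open>Let \<open>u\<close> and \<open>e\<close> stand for the coordinates of the base point and of the fibre point. Since \<open>vf1\<close> and
  \<open>vf3\<close> have the same horizontal coordinate \<open>J u e\<close>, the horizontal part of their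
  bracket is the derivative of \<open>J u e\<close> in the direction \<open>vf1 - vf3 = (0, - J u e)\<close>, which is
  \<open>- J u (J u e) = e\<close>.\<close>

lemma bracket_vf1_vf3_horizontal: "fst (lie_bracket (slit_bundle A) vf1 vf3 (x, R) schart) = fib_pt"
proof -
  interpret coord_metric "snd c ` fst c" "Gc c" by (rule coord_metric[OF c(1)])
  note lJ = linear_diff[OF linear_J[OF sc_facts(5)]] linear_scale[OF linear_J[OF sc_facts(5)]]
  let ?F = "frechet_derivative (\<lambda>z. vf1 (chart_inv schart z) schart) (at (base_pt, fib_pt))"
  note D = field_has_derivative[OF vf_smooth(1) sc_facts(3)]
  have "fst (lie_bracket (slit_bundle A) vf1 vf3 (x, R) schart) = fst (?F (vf1 (x, R) schart)) - fst (?F (vf3 (x, R) schart))"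
    unfolding bracket_at fst_diff vf31_horizontal_derivative ..
  also have "\<dots> = fst (?F (vf1 (x, R) schart - vf3 (x, R) schart))"
    unfolding linear_diff[OF has_derivative_linear[OF D]] fst_diff ..
  also have "vf1 (x, R) schart - vf3 (x, R) schart = (0, - J base_pt fib_pt)" unfolding vf_at by simp
  also have "fst (?F (0, - J base_pt fib_pt)) = fib_pt"
  proof -
    have 1: "((\<lambda>t. fst (vf1 (chart_inv schart ((base_pt, fib_pt) + t *\<^sub>R (0, - J base_pt fib_pt))) schart)) has_vector_derivative
       fst (?F (0, - J base_pt fib_pt))) (at (0::real))"
      by (rule bounded_linear.has_vector_derivative[OF bounded_linear_fst directional_derivative[OF D]])
    have "((\<lambda>t. J base_pt fib_pt + t *\<^sub>R fib_pt) has_vector_derivative fib_pt) (at (0::real))"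
      by (auto intro!: derivative_eq_intros)
    moreover have "eventually (\<lambda>t. fib_pt - t *\<^sub>R J base_pt fib_pt \<noteq> 0) (nhds (0::real))"
    proof -
      have "isCont (\<lambda>t. fib_pt - t *\<^sub>R J base_pt fib_pt) (0::real)" by (intro continuous_intros)
      then have "((\<lambda>t. fib_pt - t *\<^sub>R J base_pt fib_pt) \<longlongrightarrow> fib_pt) (nhds (0::real))"
        using tendsto_at_iff_tendsto_nhds[of "\<lambda>t. fib_pt - t *\<^sub>R J base_pt fib_pt" "0::real"]
        unfolding continuous_at by simp
      then show ?thesis using sc_facts(4) by (rule tendsto_imp_eventually_ne)
    qed
    then obtain T where T: "open T" "(0::real) \<in> T" "\<And>t. t \<in> T \<Longrightarrow> fib_pt - t *\<^sub>R J base_pt fib_pt \<noteq> 0"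
      unfolding eventually_nhds by blast
    ultimately have 2: "((\<lambda>t. fst (vf1 (chart_inv schart ((base_pt, fib_pt) + t *\<^sub>R (0, - J base_pt fib_pt))) schart)) has_vector_derivative fib_pt) (at (0::real))"
    proof (rule_tac has_vector_derivative_transform_within_open[OF _ T(1,2)])
      fix t assume t: "t \<in> T"
      have z: "(base_pt, fib_pt) + t *\<^sub>R (0, - J base_pt fib_pt) = (base_pt, fib_pt - t *\<^sub>R J base_pt fib_pt)" by simp
      show "J base_pt fib_pt + t *\<^sub>R fib_pt = fst (vf1 (chart_inv schart ((base_pt, fib_pt) + t *\<^sub>R (0, - J base_pt fib_pt))) schart)"
        unfolding z vf_coord(1)[OF c(1) sc_facts(5) T(3)[OF t]] fst_conv lJ J_J[OF sc_facts(5)] by simp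
    qed
    show ?thesis by (rule vector_derivative_unique_at[OF 1 2])
  qed
  finally show ?thesis .
qed

lemma section_coord:
  assumes "\<xi> \<in> span {vf1 (x, R), vf2 (x, R)}"
  obtains a b where "\<xi> schart = (a *\<^sub>R Jc c base_pt fib_pt, b *\<^sub>R fib_pt - a *\<^sub>R Jc c base_pt fib_pt - a *\<^sub>R \<Gamma> c base_pt (Jc c base_pt fib_pt) fib_pt)"
proof -
  obtain a b where ab: "\<xi> = lift_vec x R (a *\<^sub>R rperp A g x R) (b *\<^sub>R R - a *\<^sub>R rperp A g x R)"
    using assms unfolding in_span_vf12[OF R] by blast
  have "\<xi> schart = (a *\<^sub>R Jc c base_pt fib_pt, b *\<^sub>R fib_pt - a *\<^sub>R Jc c base_pt fib_pt - a *\<^sub>R \<Gamma> c base_pt (Jc c base_pt fib_pt) fib_pt)"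
    unfolding ab lift_vec_at[OF c(1) sc_facts(1)] using rperp_coord[OF R c] christoffel_linear(2)[OF c] by simp
  then show thesis by (rule that)
qed

end

text \<open>The horizontal part of a section of the plane field is orthogonal to \<open>R\<close> at every point; this is
  the derivative of that identity.\<close>

lemma section_contact_derivative:
  assumes R: "R \<in> tangent_space A x" "R \<noteq> 0" and c: "c \<in> A" "x \<in> fst c"
    and X: "smooth_vector_field (slit_bundle A) W X" and xW: "(x, R) \<in> W"
    and D: "\<forall>p\<in>W. X p \<in> span {vf1 p, vf2 p}"
  shows "frechet_derivative (\<lambda>p. Gc c p (fst (X (x, R) (slit_chart A c))) (R c)) (at (snd c x)) (fst h)
    + Gc c (snd c x) (fst (frechet_derivative (\<lambda>z. X (chart_inv (slit_chart A c) z) (slit_chart A c)) (at (snd c x, R c)) h)) (R c)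
    + Gc c (snd c x) (fst (X (x, R) (slit_chart A c))) (snd h) = 0"
proof -
  interpret slit: atlas "slit_bundle A" by (rule atlas_slit_bundle)
  interpret coord_metric "snd c ` fst c" "Gc c" by (rule coord_metric[OF c(1)])
  let ?sc = "slit_chart A c" and ?z = "(snd c x, R c)"
  let ?Xs = "\<lambda>z. X (chart_inv ?sc z) ?sc"
  let ?O = "snd ?sc ` (W \<inter> fst ?sc)"
  note f = sc_facts[OF R c]
  have W: "openin (manifold_topology (slit_bundle A)) W" using X unfolding smooth_vector_field_def by blast
  have oO: "open ?O" by (rule slit.openin_chart_image[OF W f(2)])
  have "snd ?sc (x, R) \<in> ?O" by (rule imageI[OF IntI[OF xW f(1)]])
  then have zO: "?z \<in> ?O" by (simp only: snd_slit_chart)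
  have at: "at ?z within ?O = at ?z" by (rule at_within_open[OF zO oO])
  have inv: "chart_inv ?sc ?z = (x, R)" using slit.chart_inv_chart[OF f(2,1)] by simp
  have OU: "fst z \<in> snd c ` fst c" if "z \<in> ?O" for z
  proof -
    obtain p where p: "z = snd ?sc p" "p \<in> W \<inter> fst ?sc" using \<open>z \<in> ?O\<close> by (rule imageE)
    obtain y S where yS: "p = (y, S)" by (cases p)
    show ?thesis using p unfolding yS by (simp add: fst_slit_chart)
  qed
  have "((\<lambda>z. Gc c (fst z) (fst (?Xs z)) (snd z)) has_derivative
     (\<lambda>h. frechet_derivative (\<lambda>p. Gc c p (fst (?Xs ?z)) (snd ?z)) (at (fst ?z)) (fst h)
        + Gc c (fst ?z) (fst (frechet_derivative ?Xs (at ?z) h)) (snd ?z)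
        + Gc c (fst ?z) (fst (?Xs ?z)) (snd h))) (at ?z within ?O)"
  proof (rule has_derivative_bilinear_family[OF open_U smooth lin1 lin2 OU zO])
    show "(fst has_derivative fst) (at ?z within ?O)" "(snd has_derivative snd) (at ?z within ?O)"
      by (intro bounded_linear_imp_has_derivative bounded_linear_fst bounded_linear_snd)+
    show "((\<lambda>z. fst (?Xs z)) has_derivative (\<lambda>h. fst (frechet_derivative ?Xs (at ?z) h))) (at ?z within ?O)"
      unfolding at
      by (rule bounded_linear.has_derivative[OF bounded_linear_fst field_has_derivative[OF R c X xW]])
  qed
  then have 1: "((\<lambda>z. 0) has_derivative
     (\<lambda>h. frechet_derivative (\<lambda>p. Gc c p (fst (?Xs ?z)) (snd ?z)) (at (fst ?z)) (fst h)
        + Gc c (fst ?z) (fst (frechet_derivative ?Xs (at ?z) h)) (snd ?z)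
        + Gc c (fst ?z) (fst (?Xs ?z)) (snd h))) (at ?z)"
    unfolding at
  proof (rule has_derivative_transform_within_open[OF _ oO zO])
    fix z assume "z \<in> ?O"
    then obtain p where p: "z = snd ?sc p" "p \<in> W \<inter> fst ?sc" by (rule imageE)
    obtain y S where yS: "p = (y, S)" by (cases p)
    have y: "(y, S) \<in> W" "(y, S) \<in> fst ?sc" "z = (snd c y, S c)" using p unfolding yS by simp_all
    have S: "S \<in> tangent_space A y" "S \<noteq> 0" "y \<in> fst c" using y(2) by (simp_all add: fst_slit_chart)
    have inv: "chart_inv ?sc z = (y, S)" using slit.chart_inv_chart[OF f(2) y(2)] y(3) by simp
    obtain a b where ab: "X (y, S) ?sc = (a *\<^sub>R J (snd c y) (S c), b *\<^sub>R S c - a *\<^sub>R J (snd c y) (S c)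
        - a *\<^sub>R chr (snd c y) (J (snd c y) (S c)) (S c))"
      using section_coord[OF S(1,2) c(1) S(3) bspec[OF D y(1)]] .
    have u: "snd c y \<in> snd c ` fst c" using S(3) by blast
    show "Gc c (fst z) (fst (?Xs z)) (snd z) = 0"
      unfolding inv ab unfolding y(3) fst_conv snd_conv G_simps(3)[OF u] J_orthogonal[OF u] by simp
  qed
  have 2: "((\<lambda>z. 0) has_derivative (\<lambda>h. 0)) (at ?z)" by simp
  from fun_cong[OF has_derivative_unique[OF 1 2], of h] show ?thesis unfolding inv fst_conv snd_conv .
qed

text \<open>Insert \<open>X\<close> into the derived identity of \<open>Y\<close> and conversely. In the difference everything cancels by
  symmetry except the pairing of \<open>R\<close> with the horizontal part of the bracket.\<close>

lemma bracket_of_sections: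
  assumes X: "smooth_vector_field (slit_bundle A) W X" "\<And>p. p \<in> W \<Longrightarrow> X p \<in> span {vf1 p, vf2 p}"
    and Y: "smooth_vector_field (slit_bundle A) W Y" "\<And>p. p \<in> W \<Longrightarrow> Y p \<in> span {vf1 p, vf2 p}"
    and xW: "(x, R) \<in> W" and R: "R \<in> tangent_space A x" "R \<noteq> 0"
  shows "lie_bracket (slit_bundle A) X Y (x, R) \<in> span {vf3 (x, R), vf1 (x, R), vf2 (x, R)}"
proof -
  interpret slit: atlas "slit_bundle A" by (rule atlas_slit_bundle)
  obtain c where c: "c \<in> A" "x \<in> fst c" using slit_carrier_chart[OF R] .
  interpret coord_metric "snd c ` fst c" "Gc c" by (rule coord_metric[OF c(1)])
  let ?sc = "slit_chart A c" and ?u = "snd c x" and ?e = "R c"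
  note f = sc_facts[OF R c]
  obtain v w where vw: "v \<in> tangent_space A x" "w \<in> tangent_space A x"
    "lie_bracket (slit_bundle A) X Y (x, R) = lift_vec x R v w"
    using tangent_is_lift_vec[OF slit.lie_bracket_tangent[OF X(1) Y(1) xW] R] .
  obtain a b where Xab: "X (x, R) ?sc = (a *\<^sub>R J ?u ?e, b *\<^sub>R ?e - a *\<^sub>R J ?u ?e - a *\<^sub>R chr ?u (J ?u ?e) ?e)"
    using section_coord[OF R c X(2)[OF xW]] .
  obtain a' b' where Yab: "Y (x, R) ?sc = (a' *\<^sub>R J ?u ?e, b' *\<^sub>R ?e - a' *\<^sub>R J ?u ?e - a' *\<^sub>R chr ?u (J ?u ?e) ?e)"
    using section_coord[OF R c Y(2)[OF xW]] .
  have "v c = fst (lie_bracket (slit_bundle A) X Y (x, R) ?sc)"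
    unfolding vw(3) lift_vec_at[OF c(1) f(1)] by simp
  also have "\<dots> = fst (frechet_derivative (\<lambda>z. Y (chart_inv ?sc z) ?sc) (at (?u, ?e)) (X (x, R) ?sc))
      - fst (frechet_derivative (\<lambda>z. X (chart_inv ?sc z) ?sc) (at (?u, ?e)) (Y (x, R) ?sc))"
    unfolding bracket_at[OF R c] fst_diff ..
  finally have vc: "v c = fst (frechet_derivative (\<lambda>z. Y (chart_inv ?sc z) ?sc) (at (?u, ?e)) (X (x, R) ?sc))
      - fst (frechet_derivative (\<lambda>z. X (chart_inv ?sc z) ?sc) (at (?u, ?e)) (Y (x, R) ?sc))" .
  have Xb: "\<forall>p\<in>W. X p \<in> span {vf1 p, vf2 p}" and Yb: "\<forall>p\<in>W. Y p \<in> span {vf1 p, vf2 p}"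
    using X(2) Y(2) by blast+
  note dG_simps = linear_scale[OF linear_dG(2)[OF f(5)]] linear_scale[OF linear_dG(3)[OF f(5)]]
  have 1: "dG ?u (a' *\<^sub>R J ?u ?e) ?e (a *\<^sub>R J ?u ?e)
     + Gc c ?u (fst (frechet_derivative (\<lambda>z. Y (chart_inv ?sc z) ?sc) (at (?u, ?e)) (X (x, R) ?sc))) ?e
     + Gc c ?u (a' *\<^sub>R J ?u ?e) (b *\<^sub>R ?e - a *\<^sub>R J ?u ?e - a *\<^sub>R chr ?u (J ?u ?e) ?e) = 0"
    using section_contact_derivative[OF R c Y(1) xW Yb, of "X (x, R) ?sc"] unfolding Xab Yab fst_conv snd_conv .
  have 2: "dG ?u (a *\<^sub>R J ?u ?e) ?e (a' *\<^sub>R J ?u ?e)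
     + Gc c ?u (fst (frechet_derivative (\<lambda>z. X (chart_inv ?sc z) ?sc) (at (?u, ?e)) (Y (x, R) ?sc))) ?e
     + Gc c ?u (a *\<^sub>R J ?u ?e) (b' *\<^sub>R ?e - a' *\<^sub>R J ?u ?e - a' *\<^sub>R chr ?u (J ?u ?e) ?e) = 0"
    using section_contact_derivative[OF R c X(1) xW Xb, of "Y (x, R) ?sc"] unfolding Xab Yab fst_conv snd_conv .
  have "Gc c ?u (v c) ?e = 0"
    unfolding vc G_simps[OF f(5)]
    using 1 2 unfolding dG_simps G_simps[OF f(5)] J_orthogonal[OF f(5)] by (simp add: algebra_simps)
  then have "g x v R = 0" using metric_coord_at[OF c vw(1) R(1)] by simp
  then obtain k where k: "v = k *\<^sub>R rperp A g x R"
    using rperp_decomposition[OF R vw(1)] by force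
  show ?thesis unfolding vw(3) k in_span_vf312[OF R] using vw(2) by blast
qed

lemma engel_of_frame:
  assumes M: "smooth_manifold A"
    and D: "\<And>p. p \<in> mcarrier (slit_bundle A) \<Longrightarrow> D p = span {vf1 p, vf2 p}"
  shows "engel_distribution (slit_bundle A) D"
proof -
  interpret slit: atlas "slit_bundle A" by (rule atlas_slit_bundle)
  let ?B = "slit_bundle A" and ?M = "mcarrier (slit_bundle A)"
  have vf_tangent: "vf1 p \<in> tangent_space ?B p" "vf2 p \<in> tangent_space ?B p" "vf3 p \<in> tangent_space ?B p"
    if "p \<in> ?M" for p using vf_smooth that unfolding smooth_vector_field_def by blast+
  have Dt: "D p \<subseteq> tangent_space ?B p" if "p \<in> ?M" for p
    unfolding D[OF that] by (rule span_minimal[OF _ slit.subspace_tangent_space]) (use vf_tangent[OF that] in simp)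
  have dist: "smooth_distribution ?B 2 D"
    unfolding smooth_distribution_def
  proof (intro conjI ballI)
    fix p assume p: "p \<in> ?M"
    obtain x R where xR: "p = (x, R)" by (cases p)
    have R: "R \<in> tangent_space A x" "R \<noteq> 0" using p unfolding xR mcarrier_slit_bundle by simp_all
    show "subspace (D p)" unfolding D[OF p] by (rule subspace_span)
    show "D p \<subseteq> tangent_space ?B p" by (rule Dt[OF p])
    show "dim (D p) = 2" unfolding D[OF p] unfolding xR by (rule independent_vf12(3)[OF R])
    define X where "X = (\<lambda>i::nat. if i = 0 then vf1 else vf2)"
    have "(\<lambda>i. X i q) ` {..<2} = {vf1 q, vf2 q}" for q
      by (auto simp: X_def lessThan_Suc numeral_2_eq_2)
    then have "p \<in> ?M \<and> (\<forall>i<2. smooth_vector_field ?B ?M (X i)) \<and> (\<forall>q\<in>?M. D q = span ((\<lambda>i. X i q) ` {..<2}))"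
      using p D vf_smooth(1,2) by (simp add: X_def)
    then show "\<exists>W X. p \<in> W \<and> (\<forall>i<2::nat. smooth_vector_field ?B W (X i)) \<and> (\<forall>q\<in>W. D q = span ((\<lambda>i. X i q) ` {..<2}))"
      by (intro exI)
  qed
  have W_sub: "p \<in> ?M" if "smooth_vector_field ?B W X" "p \<in> W" for W X p
    using that slit.openin_manifold_topology unfolding smooth_vector_field_def by blast
  have brk_tangent: "lie_bracket ?B X Y p \<in> tangent_space ?B p"
    if "p \<in> W" "local_section ?B E W X" "local_section ?B F W Y" for p W X Y E F
    using slit.lie_bracket_tangent that unfolding local_section_def by blast
  have D2: "bracket_sum ?B D D p = span {vf3 p, vf1 p, vf2 p}" if p: "p \<in> ?M" for p
  proof
    obtain x R where xR: "p = (x, R)" by (cases p)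
    have R: "R \<in> tangent_space A x" "R \<noteq> 0" using p unfolding xR mcarrier_slit_bundle by simp_all
    have brk: "lie_bracket ?B X Y p \<in> span {vf3 p, vf1 p, vf2 p}"
      if "p \<in> W" "local_section ?B D W X" "local_section ?B D W Y" for W X Y
    proof -
      have s: "smooth_vector_field ?B W X" "smooth_vector_field ?B W Y"
        and d: "\<And>q. q \<in> W \<Longrightarrow> X q \<in> D q" "\<And>q. q \<in> W \<Longrightarrow> Y q \<in> D q"
        using that(2,3) unfolding local_section_def by blast+
      have "X q \<in> span {vf1 q, vf2 q}" "Y q \<in> span {vf1 q, vf2 q}" if "q \<in> W" for q
        using d[OF that] D[OF W_sub[OF s(1) that]] by simp_all
      then show ?thesis using bracket_of_sections[OF s(1) _ s(2) _ _ R] that(1) unfolding xR by blast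
    qed
    have "span {vf1 p, vf2 p} \<subseteq> span {vf3 p, vf1 p, vf2 p}" by (rule span_mono) blast
    then show "bracket_sum ?B D D p \<subseteq> span {vf3 p, vf1 p, vf2 p}"
      unfolding bracket_sum_def D[OF p] using brk by (intro span_minimal[OF _ subspace_span] Un_least) (auto intro: span_base)
    have ls: "local_section ?B D ?M vf1" "local_section ?B D ?M vf2"
      unfolding local_section_def using vf_smooth D by (auto intro: span_base)
    have "vf3 p = lie_bracket ?B vf2 vf1 p"
      using slit_carrier_chart[OF R] bracket_vf2_vf1[OF R] unfolding xR by metis
    then have "vf3 p \<in> {lie_bracket ?B X Y p |X Y. \<exists>W. p \<in> W \<and> local_section ?B D W X \<and> local_section ?B D W Y}"
      using ls p by blast
    moreover have "vf1 p \<in> D p" "vf2 p \<in> D p" unfolding D[OF p] by (auto intro: span_base)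
    ultimately show "span {vf3 p, vf1 p, vf2 p} \<subseteq> bracket_sum ?B D D p"
      unfolding bracket_sum_def by (intro span_mono) blast
  qed
  have dim2: "dim (bracket_sum ?B D D p) = 3" if p: "p \<in> ?M" for p
  proof -
    obtain x R where xR: "p = (x, R)" by (cases p)
    have R: "R \<in> tangent_space A x" "R \<noteq> 0" using p unfolding xR mcarrier_slit_bundle by simp_all
    show ?thesis unfolding D2[OF p] unfolding xR by (rule independent_vf312(3)[OF R])
  qed
  have dim3: "dim (bracket_sum ?B D (bracket_sum ?B D D) p) = 4" if p: "p \<in> ?M" for p
  proof -
    obtain x R where xR: "p = (x, R)" by (cases p)
    have R: "R \<in> tangent_space A x" "R \<noteq> 0" using p unfolding xR mcarrier_slit_bundle by simp_all
    obtain c where c: "c \<in> A" "x \<in> fst c" using slit_carrier_chart[OF R] .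
    note f = sc_facts[OF R c]
    obtain v w where vw: "v \<in> tangent_space A x" "w \<in> tangent_space A x"
      "lie_bracket ?B vf1 vf3 (x, R) = lift_vec x R v w"
      using tangent_is_lift_vec[OF slit.lie_bracket_tangent[OF vf_smooth(1,3) f(3)] R] .
    have "v c = R c"
      using bracket_vf1_vf3_horizontal[OF R c] unfolding vw(3) lift_vec_at[OF c(1) f(1)] by simp
    then have "v = R" by (rule tangent_eqI[OF c vw(1) R(1)])
    then have v0: "g x v R \<noteq> 0" using RR_pos[OF R] by simp
    let ?E = "bracket_sum ?B D (bracket_sum ?B D D) p"
    have ls: "local_section ?B D ?M vf1" "local_section ?B (bracket_sum ?B D D) ?M vf3"
      unfolding local_section_def using vf_smooth D D2 by (auto intro: span_base)
    have "lift_vec x R v w \<in> {lie_bracket ?B X Y p |X Y. \<exists>W. p \<in> W \<and> local_section ?B D W X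
        \<and> local_section ?B (bracket_sum ?B D D) W Y}"
      unfolding vw(3)[symmetric] using ls p unfolding xR by blast
    moreover have "vf1 p \<in> bracket_sum ?B D D p" "vf2 p \<in> bracket_sum ?B D D p" "vf3 p \<in> bracket_sum ?B D D p"
      unfolding D2[OF p] by (auto intro: span_base)
    ultimately have "span (insert (lift_vec x R v w) {vf3 p, vf1 p, vf2 p}) \<subseteq> ?E"
      unfolding bracket_sum_def[of ?B D "bracket_sum ?B D D"] by (intro span_mono) blast
    then have "tangent_space ?B p \<subseteq> ?E"
      using dim_full(2)[OF R vw(1) v0 vw(2)] unfolding xR by (rule subset_trans[rotated])
    moreover have "?E \<subseteq> tangent_space ?B p"
    proof -
      have sub: "bracket_sum ?B D D p \<subseteq> tangent_space ?B p"
        unfolding D2[OF p] by (rule span_minimal[OF _ slit.subspace_tangent_space]) (use vf_tangent[OF p] in simp)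
      have brs: "{lie_bracket ?B X Y p |X Y. \<exists>W. p \<in> W \<and> local_section ?B D W X
          \<and> local_section ?B (bracket_sum ?B D D) W Y} \<subseteq> tangent_space ?B p"
        using brk_tangent[of p] by blast
      show ?thesis
        unfolding bracket_sum_def[of ?B D "bracket_sum ?B D D"]
        by (rule span_minimal[OF Un_least[OF sub brs] slit.subspace_tangent_space])
    qed
    ultimately have "?E = tangent_space ?B p" by (rule equalityI[rotated])
    then show ?thesis using dim_full(1)[OF R vw(1) v0 vw(2)] unfolding xR by simp
  qed
  show ?thesis
    unfolding engel_distribution_def using smooth_manifold_slit_bundle[OF M] dist dim2 dim3 by simp
qed

end

section \<open>Lifts of curves\<close>

lemma vector_derivative_cong_within:
  assumes "t \<in> I" "\<And>s. s \<in> I \<Longrightarrow> f s = h s"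
  shows "vector_derivative f (at t within I) = vector_derivative h (at t within I)"
proof -
  have "(f has_vector_derivative D) (at t within I) \<longleftrightarrow> (h has_vector_derivative D) (at t within I)" for D
    using has_vector_derivative_transform[of t I f h D] has_vector_derivative_transform[of t I h f D] assms
    by auto
  then show ?thesis unfolding vector_derivative_def by simp
qed

lemma velocity_cong:
  fixes A :: "('p, 'e::euclidean_space) chart set"
  assumes "t \<in> I" "\<And>s. s \<in> I \<Longrightarrow> \<gamma> s = \<eta> s"
  shows "velocity A I \<gamma> t = velocity A I \<eta> t"
proof
  fix c :: "('p, 'e) chart"
  have "vector_derivative (\<lambda>s. snd c (\<gamma> s)) (at t within I) = vector_derivative (\<lambda>s. snd c (\<eta> s)) (at t within I)"
    by (rule vector_derivative_cong_within[OF assms(1)]) (simp add: assms(2))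
  then show "velocity A I \<gamma> t c = velocity A I \<eta> t c"
    using assms by (simp add: velocity_def)
qed

lemma curve_interval_open: "a < b \<Longrightarrow> curve_interval {a<..<b}"
  by (simp add: curve_interval_def is_interval_oo interior_open)

lemma curve_interval_closed: "a < b \<Longrightarrow> curve_interval {a..b}"
  by (simp add: curve_interval_def is_interval_cc interior_atLeastAtMost_real)

context surface_curve
begin

abbreviation vel :: "real \<Rightarrow> ('a, real^2) tangent" where "vel \<equiv> velocity A I \<gamma>"
abbreviation acc :: "real \<Rightarrow> ('a, real^2) tangent" where "acc \<equiv> cov_deriv A g I \<gamma> vel"
abbreviation nacc :: "real \<Rightarrow> ('a, real^2) tangent" where "nacc \<equiv> normal_acceleration A g I \<gamma>"
abbreviation rad :: "real \<Rightarrow> ('a, real^2) tangent" where "rad \<equiv> curvature_radius A g I \<gamma>"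

lemma on_carrier: "t \<in> I \<Longrightarrow> \<gamma> t \<in> mcarrier A"
  by (rule smooth_curve_in_carrier[OF curve])

lemma along_tangent: "smooth_along I \<gamma> V \<Longrightarrow> t \<in> I \<Longrightarrow> V t \<in> tangent_space A (\<gamma> t)"
  unfolding smooth_along_def by blast

lemma vel_tangent: "t \<in> I \<Longrightarrow> vel t \<in> tangent_space A (\<gamma> t)"
  and acc_tangent: "t \<in> I \<Longrightarrow> acc t \<in> tangent_space A (\<gamma> t)"
  using along_tangent[OF velocity_smooth_along] along_tangent[OF cov_deriv_smooth_along[OF velocity_smooth_along]]
  by simp_all

lemma nacc_eq: "nacc t = acc t - (g (\<gamma> t) (acc t) (vel t) / g (\<gamma> t) (vel t) (vel t)) *\<^sub>R vel t"
  by (simp add: normal_acceleration_def proj_perp_def)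

lemma nacc_tangent: "t \<in> I \<Longrightarrow> nacc t \<in> tangent_space A (\<gamma> t)"
  unfolding nacc_eq by (intro tangent_diff tangent_scale vel_tangent acc_tangent)

lemma g_nonneg:
  assumes "t \<in> I" "v \<in> tangent_space A (\<gamma> t)"
  shows "g (\<gamma> t) v v \<ge> 0" "g (\<gamma> t) v v = 0 \<longleftrightarrow> v = 0"
proof -
  note f = metric_facts(4)[OF on_carrier[OF assms(1)] assms(2) assms(2)]
    g_simps(9)[OF on_carrier[OF assms(1)] assms(2) assms(2) assms(2)]
  show "g (\<gamma> t) v v \<ge> 0" "g (\<gamma> t) v v = 0 \<longleftrightarrow> v = 0"
    using f by (cases "v = 0"; force)+
qed

lemma nacc_orthogonal:
  assumes t: "t \<in> I" and v: "vel t \<noteq> 0"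
  shows "g (\<gamma> t) (nacc t) (vel t) = 0"
proof -
  note gs = g_simps[OF on_carrier[OF t]]
  note V = vel_tangent[OF t]
  have "g (\<gamma> t) (vel t) (vel t) \<noteq> 0" using g_nonneg(2)[OF t V] v by simp
  then show ?thesis
    unfolding nacc_eq gs(2)[OF acc_tangent[OF t] tangent_scale[OF V] V] gs(3)[OF V V V] by simp
qed

lemma curvature_nonzero_iff:
  assumes t: "t \<in> I" and v: "vel t \<noteq> 0"
  shows "geodesic_curvature A g I \<gamma> t \<noteq> 0 \<longleftrightarrow> nacc t \<noteq> 0"
  using g_nonneg(2)[OF t vel_tangent[OF t]] g_nonneg(2)[OF t nacc_tangent[OF t]] v
  by (simp add: geodesic_curvature_def gnorm_def)

lemma rad_eq:
  assumes t: "t \<in> I"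
  shows "rad t = (g (\<gamma> t) (vel t) (vel t) / g (\<gamma> t) (nacc t) (nacc t)) *\<^sub>R nacc t"
proof -
  have "(1 / geodesic_curvature A g I \<gamma> t) * (1 / gnorm g (\<gamma> t) (nacc t))
      = (gnorm g (\<gamma> t) (vel t))\<^sup>2 / (gnorm g (\<gamma> t) (nacc t))\<^sup>2"
    by (simp add: geodesic_curvature_def power2_eq_square)
  also have "\<dots> = g (\<gamma> t) (vel t) (vel t) / g (\<gamma> t) (nacc t) (nacc t)"
    using g_nonneg(1)[OF t vel_tangent[OF t]] g_nonneg(1)[OF t nacc_tangent[OF t]] by (simp add: gnorm_def)
  finally show ?thesis by (simp add: curvature_radius_def)
qed

lemma smooth_inner:
  assumes V: "smooth_along I \<gamma> V" and W: "smooth_along I \<gamma> W" and c: "c \<in> A"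
  shows "smooth_on (dom c) (\<lambda>t. g (\<gamma> t) (V t) (W t))"
proof -
  interpret coord_metric "snd c ` fst c" "Gc c" by (rule coord_metric[OF c])
  have "smooth_on (dom c) (\<lambda>t. Gc c (snd c (\<gamma> t)) (V t c) (W t c))"
    by (rule smooth_on_bilinear_family[OF dom_accessible[OF c] smooth lin1 lin2 coord_in_domain
          smooth_curve_coord_smooth[OF curve c] smooth_along_coord[OF V c] smooth_along_coord[OF W c]])
  then show ?thesis
    by (rule smooth_on_eq) (use metric_coord_at[OF c] along_tangent[OF V] along_tangent[OF W] in simp)
qed

lemma smooth_along_scale:
  assumes V: "smooth_along I \<gamma> V" and f: "\<And>c. c \<in> A \<Longrightarrow> smooth_on (dom c) f"
  shows "smooth_along I \<gamma> (\<lambda>t. f t *\<^sub>R V t)"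
  unfolding smooth_along_def
  using tangent_scale[OF along_tangent[OF V]] smooth_on_scaleR[OF dom_accessible f smooth_along_coord[OF V]]
  by simp

lemma smooth_along_diff:
  assumes V: "smooth_along I \<gamma> V" and W: "smooth_along I \<gamma> W"
  shows "smooth_along I \<gamma> (\<lambda>t. V t - W t)"
  unfolding smooth_along_def
  using tangent_diff[OF along_tangent[OF V] along_tangent[OF W]]
    smooth_on_diff[OF dom_accessible smooth_along_coord[OF V] smooth_along_coord[OF W]]
  by simp

lemma nacc_smooth_along:
  assumes v: "\<And>t. t \<in> I \<Longrightarrow> vel t \<noteq> 0"
  shows "smooth_along I \<gamma> nacc"
proof -
  note V = velocity_smooth_along and B = cov_deriv_smooth_along[OF velocity_smooth_along]
  have "smooth_on (dom c) (\<lambda>t. g (\<gamma> t) (acc t) (vel t) / g (\<gamma> t) (vel t) (vel t))" if c: "c \<in> A" for c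
    by (rule smooth_on_divide[OF dom_accessible[OF c] smooth_inner[OF B V c] smooth_inner[OF V V c]])
       (use g_nonneg(2) vel_tangent v in auto)
  then have "smooth_along I \<gamma> (\<lambda>t. acc t - (g (\<gamma> t) (acc t) (vel t) / g (\<gamma> t) (vel t) (vel t)) *\<^sub>R vel t)"
    by (intro smooth_along_diff B smooth_along_scale[OF V])
  then show ?thesis unfolding nacc_eq[symmetric] .
qed

lemma rad_smooth_along:
  assumes v: "\<And>t. t \<in> I \<Longrightarrow> vel t \<noteq> 0" and n: "\<And>t. t \<in> I \<Longrightarrow> nacc t \<noteq> 0"
  shows "smooth_along I \<gamma> rad"
proof -
  note V = velocity_smooth_along and N = nacc_smooth_along[OF v]
  have q: "smooth_on (dom c) (\<lambda>t. g (\<gamma> t) (vel t) (vel t) / g (\<gamma> t) (nacc t) (nacc t))" if c: "c \<in> A" for c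
    by (rule smooth_on_divide[OF dom_accessible[OF c] smooth_inner[OF V V c] smooth_inner[OF N N c]])
       (use g_nonneg(2) nacc_tangent n in auto)
  have s: "smooth_along I \<gamma> (\<lambda>t. (g (\<gamma> t) (vel t) (vel t) / g (\<gamma> t) (nacc t) (nacc t)) *\<^sub>R nacc t)"
    by (rule smooth_along_scale[OF N q])
  have *: "rad t = (g (\<gamma> t) (vel t) (vel t) / g (\<gamma> t) (nacc t) (nacc t)) *\<^sub>R nacc t" if "t \<in> I" for t
    by (rule rad_eq[OF that])
  have "smooth_on (dom c) (\<lambda>t. rad t c)" if "c \<in> A" for c
    by (rule smooth_on_eq[OF smooth_along_coord[OF s that]]) (simp add: *)
  moreover have "rad t \<in> tangent_space A (\<gamma> t)" if "t \<in> I" for t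
    using along_tangent[OF s that] unfolding *[OF that] .
  ultimately show ?thesis unfolding smooth_along_def by simp
qed

lemma rad_facts:
  assumes t: "t \<in> I" and v: "vel t \<noteq> 0" and n: "nacc t \<noteq> 0"
  shows "rad t \<noteq> 0" "g (\<gamma> t) (vel t) (rad t) = 0" "g (\<gamma> t) (acc t) (rad t) = g (\<gamma> t) (vel t) (vel t)"
proof -
  note gs = g_simps[OF on_carrier[OF t]]
  note T = vel_tangent[OF t] acc_tangent[OF t] nacc_tangent[OF t]
  have pos: "g (\<gamma> t) (vel t) (vel t) \<noteq> 0" "g (\<gamma> t) (nacc t) (nacc t) \<noteq> 0"
    using g_nonneg(2)[OF t T(1)] g_nonneg(2)[OF t T(3)] v n by simp_all
  show "rad t \<noteq> 0" unfolding rad_eq[OF t] using pos n by simp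
  have o: "g (\<gamma> t) (nacc t) (vel t) = 0" by (rule nacc_orthogonal[OF t v])
  then have o': "g (\<gamma> t) (vel t) (nacc t) = 0" using metric_facts(1)[OF on_carrier[OF t] T(1,3)] by simp
  show "g (\<gamma> t) (vel t) (rad t) = 0"
    unfolding rad_eq[OF t] gs(7)[OF T(3) T(1) T(1)] o' by simp
  have "g (\<gamma> t) (nacc t) (nacc t) = g (\<gamma> t) (acc t) (nacc t)"
  proof -
    have "g (\<gamma> t) (nacc t) (nacc t) = g (\<gamma> t) (acc t - (g (\<gamma> t) (acc t) (vel t) / g (\<gamma> t) (vel t) (vel t)) *\<^sub>R vel t) (nacc t)"
      by (simp only: nacc_eq[symmetric])
    then show ?thesis
      unfolding gs(2)[OF T(2) tangent_scale[OF T(1)] T(3)] gs(3)[OF T(1) T(3) T(1)] o' by simp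
  qed
  then show "g (\<gamma> t) (acc t) (rad t) = g (\<gamma> t) (vel t) (vel t)"
    unfolding rad_eq[OF t] gs(7)[OF T(3) T(2) T(1)] using pos by simp
qed

lemma derivative_vanishes:
  fixes f :: "real \<Rightarrow> real"
  assumes "t \<in> I" "\<And>s. s \<in> I \<Longrightarrow> f s = 0" "(f has_vector_derivative D) (at t within I)"
  shows "D = 0"
proof -
  have "((\<lambda>s. 0::real) has_vector_derivative D) (at t within I)"
    by (rule has_vector_derivative_transform[OF assms(1) _ assms(3)]) (simp add: assms(2))
  from vector_derivative_interval[OF interval assms(1) this]
  moreover have "((\<lambda>s. 0::real) has_vector_derivative 0) (at t within I)" by simp
  from vector_derivative_interval[OF interval assms(1) this]
  have "vector_derivative (\<lambda>s. 0::real) (at t within I) = 0" .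
  ultimately show ?thesis by simp
qed

lemma orthogonal_derivative:
  assumes R: "smooth_along I \<gamma> R" and o: "\<And>s. s \<in> I \<Longrightarrow> g (\<gamma> s) (vel s) (R s) = 0" and t: "t \<in> I"
  shows "g (\<gamma> t) (acc t) (R t) + g (\<gamma> t) (vel t) (cov_deriv A g I \<gamma> R t) = 0"
  by (rule derivative_vanishes[OF t o metric_compatible[OF velocity_smooth_along R t]])

text \<open>The conditions on \<open>R\<close> are those which \<open>rad_facts\<close> establishes for the radius of curvature. The derivative of
  the orthogonality of \<open>\<gamma>'\<close> and \<open>R\<close> is \<open>\<langle>D\<^sub>t\<gamma>', R\<rangle> + \<langle>\<gamma>', D\<^sub>tR\<rangle> = 0\<close>; with \<open>\<langle>D\<^sub>t\<gamma>', R\<rangle> = |\<gamma>'|\<^sup>2\<close> and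
  \<open>\<gamma>' = a P\<close> it determines the component of \<open>D\<^sub>tR\<close> along \<open>P\<close>.\<close>

lemma lift_velocity_components:
  assumes R: "smooth_along I \<gamma> R" "R t \<noteq> 0" and t: "t \<in> I" and v: "vel t \<noteq> 0"
    and o: "\<And>s. s \<in> I \<Longrightarrow> g (\<gamma> s) (vel s) (R s) = 0"
    and n: "g (\<gamma> t) (acc t) (R t) = g (\<gamma> t) (vel t) (vel t)"
  shows "\<exists>a. vel t = a *\<^sub>R rperp A g (\<gamma> t) (R t) \<and> cov_deriv A g I \<gamma> R t
     = (g (\<gamma> t) (cov_deriv A g I \<gamma> R t) (R t) / g (\<gamma> t) (R t) (R t)) *\<^sub>R R t - a *\<^sub>R rperp A g (\<gamma> t) (R t)"
proof -
  let ?x = "\<gamma> t" and ?D = "cov_deriv A g I \<gamma> R t"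
  note RT = along_tangent[OF R(1) t]
  let ?P = "rperp A g ?x (R t)"
  note gs = g_simps[OF on_carrier[OF t]] and sym = metric_facts(1)[OF on_carrier[OF t]]
  note P = rperp_tangent[OF RT R(2)] and V = vel_tangent[OF t] and DT = cov_deriv_tangent[OF R(1) t]
  have RR: "g ?x (R t) (R t) > 0" by (rule RR_pos[OF RT R(2)])
  define a where "a = g ?x (vel t) ?P / g ?x (R t) (R t)"
  have va: "vel t = a *\<^sub>R ?P"
    using rperp_decomposition[OF RT R(2) V] o[OF t] by (simp add: a_def)
  have a0: "a \<noteq> 0" using v va by auto
  have PP: "g ?x ?P ?P = g ?x (R t) (R t)" by (rule rperp_norm[OF RT R(2)])
  have "g ?x (vel t) (vel t) = a * (a * g ?x (R t) (R t))"
    unfolding va gs(3)[OF P tangent_scale[OF P] P] gs(7)[OF P P P] PP ..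
  moreover have "g ?x (vel t) ?D = a * g ?x ?D ?P"
    unfolding va gs(3)[OF P DT P] sym[OF P DT] ..
  ultimately have "a * (a * g ?x (R t) (R t)) + a * g ?x ?D ?P = 0"
    using orthogonal_derivative[OF R(1) o t] n by simp
  then have "a * (a * g ?x (R t) (R t) + g ?x ?D ?P) = 0" by (simp add: algebra_simps)
  then have "g ?x ?D ?P = - a * g ?x (R t) (R t)" using a0 by simp
  then have "g ?x ?D ?P / g ?x (R t) (R t) = - a" using RR by simp
  then have "?D = (g ?x ?D (R t) / g ?x (R t) (R t)) *\<^sub>R R t - a *\<^sub>R ?P"
    using rperp_decomposition[OF RT R(2) DT] by simp
  then show ?thesis using va by blast
qed

lemma lift_velocity_in_span:
  assumes v: "\<And>t. t \<in> I \<Longrightarrow> vel t \<noteq> 0" and n: "\<And>t. t \<in> I \<Longrightarrow> nacc t \<noteq> 0" and t: "t \<in> I"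
  shows "velocity (slit_bundle A) I (lift_curve A g I \<gamma>) t \<in> span {vf1 (\<gamma> t, rad t), vf2 (\<gamma> t, rad t)}"
proof -
  have R: "smooth_along I \<gamma> rad" by (rule rad_smooth_along[OF v n])
  note f = rad_facts[OF _ v n]
  have "lift_curve A g I \<gamma> = (\<lambda>t. (\<gamma> t, rad t))" by (rule ext) (simp add: lift_curve_def)
  then have eq: "velocity (slit_bundle A) I (lift_curve A g I \<gamma>) t
      = lift_vec (\<gamma> t) (rad t) (vel t) (cov_deriv A g I \<gamma> rad t)"
    using slit_velocity[OF interval curve R t] by simp
  obtain a b where ab: "vel t = a *\<^sub>R rperp A g (\<gamma> t) (rad t)"
    "cov_deriv A g I \<gamma> rad t = b *\<^sub>R rad t - a *\<^sub>R rperp A g (\<gamma> t) (rad t)"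
    using lift_velocity_components[OF R f(1)[OF t t t] t v[OF t] f(2) f(3)[OF t t t]] by blast
  show ?thesis
    unfolding eq in_span_vf12[OF along_tangent[OF R t] f(1)[OF t t t]] ab by blast
qed

text \<open>The same derivative read in the opposite direction: from \<open>\<gamma>' = a P\<close> and \<open>D\<^sub>tR = b R - a P\<close> it follows that
  \<open>\<langle>D\<^sub>t\<gamma>', R\<rangle> = a\<^sup>2 |R|\<^sup>2\<close>. Hence the normal acceleration is \<open>a\<^sup>2 R\<close>, and the radius of curvature is \<open>R\<close>.\<close>

lemma tangent_curve_is_lift:
  assumes R: "smooth_along I \<gamma> R" "\<And>t. t \<in> I \<Longrightarrow> R t \<noteq> 0" and v: "\<And>t. t \<in> I \<Longrightarrow> vel t \<noteq> 0"
    and D: "\<And>t. t \<in> I \<Longrightarrow> velocity (slit_bundle A) I (\<lambda>t. (\<gamma> t, R t)) t \<in> span {vf1 (\<gamma> t, R t), vf2 (\<gamma> t, R t)}"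
    and t: "t \<in> I"
  shows "nacc t \<noteq> 0" "rad t = R t"
proof -
  have comp: "\<exists>a b. vel s = a *\<^sub>R rperp A g (\<gamma> s) (R s) \<and> cov_deriv A g I \<gamma> R s = b *\<^sub>R R s - a *\<^sub>R rperp A g (\<gamma> s) (R s)"
    if s: "s \<in> I" for s
  proof -
    note RT = along_tangent[OF R(1) s] R(2)[OF s]
    note P = rperp_tangent[OF RT]
    obtain a b where "lift_vec (\<gamma> s) (R s) (vel s) (cov_deriv A g I \<gamma> R s)
       = lift_vec (\<gamma> s) (R s) (a *\<^sub>R rperp A g (\<gamma> s) (R s)) (b *\<^sub>R R s - a *\<^sub>R rperp A g (\<gamma> s) (R s))"
      using D[OF s] unfolding in_span_vf12[OF RT] slit_velocity[OF interval curve R(1) s] by blast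
    then show ?thesis
      using lift_vec_eq_iff[OF RT vel_tangent[OF s] tangent_scale[OF P] cov_deriv_tangent[OF R(1) s]
          tangent_diff[OF tangent_scale[OF RT(1)] tangent_scale[OF P]]] by blast
  qed
  have o: "g (\<gamma> s) (vel s) (R s) = 0" if s: "s \<in> I" for s
  proof -
    note RT = along_tangent[OF R(1) s] R(2)[OF s]
    note P = rperp_tangent[OF RT]
    obtain a where "vel s = a *\<^sub>R rperp A g (\<gamma> s) (R s)" using comp[OF s] by blast
    then show ?thesis
      using g_simps(3)[OF on_carrier[OF s] P RT(1) P] rperp_orthogonal[OF RT] by simp
  qed
  let ?x = "\<gamma> t" and ?D = "cov_deriv A g I \<gamma> R t"
  note RT = along_tangent[OF R(1) t] R(2)[OF t]
  let ?P = "rperp A g ?x (R t)"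
  note gs = g_simps[OF on_carrier[OF t]] and sym = metric_facts(1)[OF on_carrier[OF t]]
  note P = rperp_tangent[OF RT] and V = vel_tangent[OF t] and N = nacc_tangent[OF t]
  have RR: "g ?x (R t) (R t) > 0" by (rule RR_pos[OF RT])
  have PR: "g ?x ?P (R t) = 0" and PP: "g ?x ?P ?P = g ?x (R t) (R t)"
    by (rule rperp_orthogonal[OF RT], rule rperp_norm[OF RT])
  obtain a b where ab: "vel t = a *\<^sub>R ?P" "?D = b *\<^sub>R R t - a *\<^sub>R ?P" using comp[OF t] by blast
  have a0: "a \<noteq> 0" using v[OF t] ab(1) by auto
  have VV: "g ?x (vel t) (vel t) = a * (a * g ?x (R t) (R t))"
    unfolding ab(1) gs(3)[OF P tangent_scale[OF P] P] gs(7)[OF P P P] PP ..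
  have "g ?x (vel t) ?D = - (a * (a * g ?x (R t) (R t)))"
    unfolding ab gs(3)[OF P tangent_diff[OF tangent_scale[OF RT(1)] tangent_scale[OF P]] P]
      gs(6)[OF tangent_scale[OF RT(1)] tangent_scale[OF P] P] gs(7)[OF RT(1) P P] gs(7)[OF P P P] PP PR by simp
  then have AR: "g ?x (acc t) (R t) = a * (a * g ?x (R t) (R t))"
    using orthogonal_derivative[OF R(1) o t] by simp
  have "g ?x (nacc t) (R t) = g ?x (acc t) (R t)"
    unfolding nacc_eq gs(2)[OF acc_tangent[OF t] tangent_scale[OF V] RT(1)] gs(3)[OF V RT(1) V] o[OF t] by simp
  then have NR: "g ?x (nacc t) (R t) / g ?x (R t) (R t) = a * a" using AR RR by simp
  have "a * g ?x (nacc t) ?P = 0"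
    using nacc_orthogonal[OF t v[OF t]] unfolding ab(1) gs(7)[OF P N N] .
  then have "g ?x (nacc t) ?P = 0" using a0 by simp
  then have Na: "nacc t = (a * a) *\<^sub>R R t" using rperp_decomposition[OF RT N] NR by simp
  then show "nacc t \<noteq> 0" using a0 RT(2) by simp
  have "g ?x (nacc t) (nacc t) = (a * a) * ((a * a) * g ?x (R t) (R t))"
    unfolding Na gs(3)[OF RT(1) tangent_scale[OF RT(1)] RT(1)] gs(7)[OF RT(1) RT(1) RT(1)] ..
  then show "rad t = R t"
    unfolding rad_eq[OF t] VV using RR a0 by (simp add: Na)
qed

lemma curved_curve_iff:
  "curved_curve A g I \<gamma> \<longleftrightarrow> (\<forall>t\<in>I. vel t \<noteq> 0 \<and> nacc t \<noteq> 0)"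
  unfolding curved_curve_def regular_curve_def using curve curvature_nonzero_iff by blast

end

section \<open>The distribution spanned by velocities of lifts\<close>

context surface
begin

lemma chart_curve:
  assumes c: "c \<in> A" and I: "curve_interval I" and u: "smooth_on I u" "\<And>t. t \<in> I \<Longrightarrow> u t \<in> snd c ` fst c"
    and u': "\<And>t. t \<in> I \<Longrightarrow> (u has_vector_derivative u' t) (at t within I)"
    and u'': "\<And>t. t \<in> I \<Longrightarrow> (u' has_vector_derivative u'' t) (at t within I)"
  defines "\<gamma> \<equiv> \<lambda>t. chart_inv c (u t)"
  shows "smooth_curve A I \<gamma>"
    and "t \<in> I \<Longrightarrow> \<gamma> t \<in> fst c" "t \<in> I \<Longrightarrow> snd c (\<gamma> t) = u t"
    and "t \<in> I \<Longrightarrow> velocity A I \<gamma> t c = u' t"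
    and "t \<in> I \<Longrightarrow> cov_deriv A g I \<gamma> (velocity A I \<gamma>) t c = u'' t + \<Gamma> c (u t) (u' t) (u' t)"
proof -
  show dom: "\<gamma> t \<in> fst c" if "t \<in> I" for t unfolding \<gamma>_def by (rule inv_into_into[OF u(2)[OF that]])
  show coord: "snd c (\<gamma> t) = u t" if "t \<in> I" for t unfolding \<gamma>_def by (rule f_inv_into_f[OF u(2)[OF that]])
  have sm: "smooth_on I (\<lambda>s. snd c (\<gamma> s))" by (rule smooth_on_eq[OF u(1) coord])
  show curve: "smooth_curve A I \<gamma>" by (rule smooth_curve_from_chart[OF I c dom sm])
  show vel: "velocity A I \<gamma> t c = u' t" if t: "t \<in> I" for t
  proof -
    have d: "((\<lambda>s. snd c (\<gamma> s)) has_vector_derivative u' t) (at t within I)"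
      by (rule has_vector_derivative_transform[OF t coord u'[OF t]])
    have "velocity A I \<gamma> t = coord_vec A c (\<gamma> t) (u' t)"
      by (rule velocity_from_chart[OF I openin_subtopology_self t c dom d])
    then show ?thesis using coord_vec_at[OF c dom[OF t]] by simp
  qed
  show "cov_deriv A g I \<gamma> (velocity A I \<gamma>) t c = u'' t + \<Gamma> c (u t) (u' t) (u' t)" if t: "t \<in> I"
  proof -
    have "((\<lambda>s. velocity A I \<gamma> s c) has_vector_derivative u'' t) (at t within I)"
      by (rule has_vector_derivative_transform[OF t vel u''[OF t]])
    from vector_derivative_interval[OF I t this] show ?thesis
      using c dom[OF t] by (simp add: cov_deriv_def christoffel_eq coord[OF t] vel[OF t])
  qed
qed

text \<open>In a chart take a cubic curve with velocity \<open>v = J e\<close> and with second derivative \<open>e - \<Gamma>(v, v)\<close> at time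
  \<open>0\<close>, so that \<open>D\<^sub>t\<gamma>' = R\<close> and the radius of curvature at this time is \<open>R\<close>, for every value \<open>s e\<close> of the
  third derivative. The derivative of \<open>\<langle>D\<^sub>t\<gamma>', R\<rangle> = |\<gamma>'|\<^sup>2\<close> shows that the component of \<open>D\<^sub>tR\<close> along \<open>R\<close> is
  a constant minus \<open>s\<close>. So the velocities of these lifts form an affine line that avoids the origin.\<close>

lemma osculating_curves:
  assumes R: "R \<in> tangent_space A x" "R \<noteq> 0"
  shows "\<exists>\<kappa>. \<forall>s. \<exists>a b \<gamma>. a < 0 \<and> 0 < b \<and> curved_curve A g {a<..<b} \<gamma> \<and> lift_curve A g {a<..<b} \<gamma> 0 = (x, R)
     \<and> velocity (slit_bundle A) {a<..<b} (lift_curve A g {a<..<b} \<gamma>) 0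
       = lift_vec x R (rperp A g x R) ((\<kappa> - s) *\<^sub>R R - rperp A g x R)"
proof -
  obtain c where c: "c \<in> A" "x \<in> fst c" using slit_carrier_chart[OF R] .
  interpret coord_metric "snd c ` fst c" "Gc c" by (rule coord_metric[OF c(1)])
  let ?U = "snd c ` fst c"
  define u0 where "u0 = snd c x"
  define e where "e = R c"
  define v where "v = J u0 e"
  define q where "q = e - chr u0 v v"
  \<comment> \<open>the part of \<open>D\<^sub>t D\<^sub>t \<gamma>'\<close> at time \<open>0\<close> that does not depend on the third derivative\<close>
  define K where "K = frechet_derivative (\<lambda>p. chr p v v) (at u0) v + chr u0 q v + chr u0 v q + chr u0 v e"
  have u0: "u0 \<in> ?U" unfolding u0_def using c(2) by (rule imageI)
  have e0: "e \<noteq> 0" unfolding e_def using tangent_space_nonzero[OF c R(1)] R(2) by simp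
  have v0: "v \<noteq> 0" unfolding v_def by (rule J_nonzero[OF u0 e0])
  have ve: "Gc c u0 v e = 0" "Gc c u0 e v = 0"
    using J_orthogonal[OF u0, of e] G_sym[OF u0, of e v] unfolding v_def by simp_all
  have ee: "Gc c u0 e e = g x R R"
    unfolding u0_def e_def by (rule metric_coord_at[OF c R(1) R(1)])
  have RR: "g x R R > 0" by (rule RR_pos[OF R])
  show ?thesis
  proof (rule exI[of _ "- (Gc c u0 K e / g x R R)"], rule allI)
    fix s :: real
    define u where "u = (\<lambda>t::real. u0 + t *\<^sub>R v + (t * t / 2) *\<^sub>R q + (t * t * t * s / 6) *\<^sub>R e)"
    define u' where "u' = (\<lambda>t::real. v + t *\<^sub>R q + (t * t * s / 2) *\<^sub>R e)"
    define u'' where "u'' = (\<lambda>t::real. q + (t * s) *\<^sub>R e)"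
    have du: "(u has_vector_derivative u' t) (at t within T)" for t T
      unfolding u_def u'_def by (auto intro!: derivative_eq_intros simp: field_simps)
    have du': "(u' has_vector_derivative u'' t) (at t within T)" for t T
      unfolding u'_def u''_def by (auto intro!: derivative_eq_intros simp: field_simps)
    have at0: "u 0 = u0" "u' 0 = v" "u'' 0 = q" by (simp_all add: u_def u'_def u''_def)
    have poly: "smooth_on T u" "smooth_on T u'" "smooth_on T u''" if T: "accessible T" for T
      unfolding u_def u'_def u''_def divide_real_def
      by (intro smooth_on_add smooth_on_scaleR smooth_on_mult smooth_on_const smooth_on_ident T)+
    define S where "S = {t. u t \<in> ?U \<and> u' t \<noteq> 0}"
    have "continuous_on UNIV u" "continuous_on UNIV u'"
      by (rule smooth_on_continuous_on, rule poly, simp add: accessible_open)+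
    then have "open (u -` ?U \<inter> u' -` (-{0}))"
      using open_U by (intro open_Int open_vimage open_Compl closed_singleton) simp_all
    moreover have "S = u -` ?U \<inter> u' -` (-{0})" by (auto simp: S_def)
    ultimately have oS: "open S" by simp
    have accS: "accessible S" by (rule accessible_open[OF oS])
    \<comment> \<open>the coordinates of \<open>D\<^sub>t\<gamma>'\<close> and of the normal acceleration\<close>
    define ac where "ac = (\<lambda>t. u'' t + chr (u t) (u' t) (u' t))"
    define n where "n = (\<lambda>t. ac t - (Gc c (u t) (ac t) (u' t) / Gc c (u t) (u' t) (u' t)) *\<^sub>R u' t)"
    have SU: "u t \<in> ?U" if "t \<in> S" for t using that by (simp add: S_def)
    have ac_smooth: "smooth_on S ac"
      unfolding ac_def
      by (intro smooth_on_add accS poly smooth_on_bilinear_family[OF accS smooth_chr linear_chr1 linear_chr2 SU])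
    have "smooth_on S (\<lambda>t. Gc c (u t) (ac t) (u' t) / Gc c (u t) (u' t) (u' t))"
    proof (rule smooth_on_divide[OF accS])
      show "smooth_on S (\<lambda>t. Gc c (u t) (ac t) (u' t))"
        by (rule smooth_on_bilinear_family[OF accS smooth lin1 lin2 SU poly(1)[OF accS] ac_smooth poly(2)[OF accS]])
      show "smooth_on S (\<lambda>t. Gc c (u t) (u' t) (u' t))"
        by (rule smooth_on_bilinear_family[OF accS smooth lin1 lin2 SU poly(1)[OF accS] poly(2)[OF accS] poly(2)[OF accS]])
      show "Gc c (u t) (u' t) (u' t) \<noteq> 0" if "t \<in> S" for t
        using pos[OF SU[OF that], of "u' t"] that by (simp add: S_def)
    qed
    then have n_smooth: "smooth_on S n"
      unfolding n_def by (intro smooth_on_diff smooth_on_scaleR accS ac_smooth poly)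
    have ac0: "ac 0 = e" by (simp add: ac_def at0 q_def)
    have n0: "n 0 = e" by (simp add: n_def at0 ac0 ve)
    have S0: "0 \<in> S" using u0 v0 by (simp add: S_def at0)
    have "open (S \<inter> n -` (-{0}))"
      by (rule continuous_open_preimage[OF smooth_on_continuous_on[OF n_smooth] oS]) (simp add: open_Compl)
    moreover have "0 \<in> S \<inter> n -` (-{0})" using S0 n0 e0 by simp
    ultimately obtain \<delta> where \<delta>: "\<delta> > 0" "ball 0 \<delta> \<subseteq> S \<inter> n -` (-{0})"
      by (rule openE)
    define I where "I = {-\<delta><..<\<delta>}"
    have IS: "t \<in> S" "n t \<noteq> 0" if "t \<in> I" for t
    proof -
      have "t \<in> ball 0 \<delta>" using that by (auto simp: I_def dist_real_def)
      then show "t \<in> S" "n t \<noteq> 0" using \<delta>(2) by auto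
    qed
    have I: "curve_interval I" unfolding I_def by (rule curve_interval_open) (use \<delta>(1) in simp)
    have I0: "0 \<in> I" using \<delta>(1) by (simp add: I_def)
    define \<gamma> where "\<gamma> = (\<lambda>t. chart_inv c (u t))"
    have cc1: "smooth_curve A I \<gamma>"
      unfolding \<gamma>_def by (rule chart_curve(1)[OF c(1) I poly(1)[OF accessible_interval[OF I]] SU[OF IS(1)] du du'])
    have cc2: "\<gamma> t \<in> fst c" if t: "t \<in> I" for t
      unfolding \<gamma>_def by (rule chart_curve(2)[OF c(1) I poly(1)[OF accessible_interval[OF I]] SU[OF IS(1)] du du' t])
    have cc3: "snd c (\<gamma> t) = u t" if t: "t \<in> I" for t
      unfolding \<gamma>_def by (rule chart_curve(3)[OF c(1) I poly(1)[OF accessible_interval[OF I]] SU[OF IS(1)] du du' t])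
    have cc4: "velocity A I \<gamma> t c = u' t" if t: "t \<in> I" for t
      unfolding \<gamma>_def by (rule chart_curve(4)[OF c(1) I poly(1)[OF accessible_interval[OF I]] SU[OF IS(1)] du du' t])
    have cc5: "cov_deriv A g I \<gamma> (velocity A I \<gamma>) t c = u'' t + chr (u t) (u' t) (u' t)" if t: "t \<in> I" for t
      unfolding \<gamma>_def by (rule chart_curve(5)[OF c(1) I poly(1)[OF accessible_interval[OF I]] SU[OF IS(1)] du du' t])
    note cc = cc1 cc2 cc3 cc4 cc5
    interpret curve: surface_curve A g I \<gamma> by unfold_locales (rule I, rule cc(1))
    have \<gamma>0: "\<gamma> 0 = x" using c by (simp add: \<gamma>_def at0 u0_def)
    have inner: "g (\<gamma> t) V W = Gc c (u t) (V c) (W c)"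
      if "t \<in> I" "V \<in> tangent_space A (\<gamma> t)" "W \<in> tangent_space A (\<gamma> t)" for t V W
      using metric_coord_at[OF c(1) cc(2)[OF that(1)] that(2,3)] cc(3)[OF that(1)] by simp
    have acc_c: "curve.acc t c = ac t" if "t \<in> I" for t
      unfolding cc(5)[OF that] ac_def ..
    have nacc_c: "curve.nacc t c = n t" if t: "t \<in> I" for t
      unfolding curve.nacc_eq n_def
      by (simp add: inner[OF t] curve.vel_tangent[OF t] curve.acc_tangent[OF t] cc(4)[OF t] acc_c[OF t])
    have vel_ne: "curve.vel t \<noteq> 0" if "t \<in> I" for t
      using cc(4)[OF that] IS(1)[OF that] unfolding S_def by force
    have nacc_ne: "curve.nacc t \<noteq> 0" if "t \<in> I" for t
      using nacc_c[OF that] IS(2)[OF that] by force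
    have curved: "curved_curve A g I \<gamma>" unfolding curve.curved_curve_iff using vel_ne nacc_ne by blast
    let ?P = "rperp A g x R"
    have eq_at0: "V = W" if "V \<in> tangent_space A (\<gamma> 0)" "W \<in> tangent_space A x" "V c = W c" for V W
      by (rule tangent_eqI[where v = V and w = W, OF c that(1)[unfolded \<gamma>0] that(2,3)])
    have vel0: "curve.vel 0 = ?P"
      by (rule eq_at0[OF curve.vel_tangent[OF I0] rperp_tangent[OF R]])
         (simp add: cc(4)[OF I0] at0 v_def rperp_coord[OF R c] u0_def e_def)
    have acc0: "curve.acc 0 = R"
      by (rule eq_at0[OF curve.acc_tangent[OF I0] R(1)]) (simp add: acc_c[OF I0] ac0 e_def)
    have nacc0: "curve.nacc 0 = R"
      by (rule eq_at0[OF curve.nacc_tangent[OF I0] R(1)]) (simp add: nacc_c[OF I0] n0 e_def)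
    have rad0: "curve.rad 0 = R"
      unfolding curve.rad_eq[OF I0] nacc0 vel0 \<gamma>0 rperp_norm[OF R] using RR by simp
    have ra: "curve.rad t \<noteq> 0" "g (\<gamma> t) (curve.vel t) (curve.rad t) = 0"
      "g (\<gamma> t) (curve.acc t) (curve.rad t) = g (\<gamma> t) (curve.vel t) (curve.vel t)" if t: "t \<in> I" for t
      by (rule curve.rad_facts[OF t vel_ne[OF t] nacc_ne[OF t]])+
    have rad: "smooth_along I \<gamma> curve.rad" by (rule curve.rad_smooth_along[OF vel_ne nacc_ne])
    note va = curve.velocity_smooth_along and aa = curve.cov_deriv_smooth_along[OF curve.velocity_smooth_along]
    let ?Da = "cov_deriv A g I \<gamma> curve.acc 0" and ?Dr = "cov_deriv A g I \<gamma> curve.rad 0"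
    have Da_t: "?Da \<in> tangent_space A x" and Dr_t: "?Dr \<in> tangent_space A x"
      using curve.cov_deriv_tangent[OF aa I0] curve.cov_deriv_tangent[OF rad I0] \<gamma>0 by simp_all
    have RP: "g x R ?P = 0" "g x ?P R = 0"
      using rperp_orthogonal[OF R] metric_facts(1)[OF tangent_in_carrier[OF R] R(1) rperp_tangent[OF R]] by simp_all
    \<comment> \<open>the derivative of the identity \<open>\<langle>D\<^sub>t\<gamma>', R\<rangle> = |\<gamma>'|\<^sup>2\<close>\<close>
    have "((\<lambda>t. g (\<gamma> t) (curve.acc t) (curve.rad t) - g (\<gamma> t) (curve.vel t) (curve.vel t)) has_vector_derivative
       (g (\<gamma> 0) ?Da (curve.rad 0) + g (\<gamma> 0) (curve.acc 0) ?Dr)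
       - (g (\<gamma> 0) (curve.acc 0) (curve.vel 0) + g (\<gamma> 0) (curve.vel 0) (curve.acc 0))) (at 0 within I)"
      by (intro has_vector_derivative_diff curve.metric_compatible[OF aa rad I0] curve.metric_compatible[OF va va I0])
    then have "(g (\<gamma> 0) ?Da (curve.rad 0) + g (\<gamma> 0) (curve.acc 0) ?Dr)
       - (g (\<gamma> 0) (curve.acc 0) (curve.vel 0) + g (\<gamma> 0) (curve.vel 0) (curve.acc 0)) = 0"
      by (rule curve.derivative_vanishes[OF I0, rotated]) (simp add: ra(3))
    then have gDr: "g x ?Dr R = - g x ?Da R"
      unfolding \<gamma>0 rad0 acc0 vel0 RP using metric_facts(1)[OF tangent_in_carrier[OF R] R(1) Dr_t] by simp
    have "(ac has_vector_derivative s *\<^sub>R e + (frechet_derivative (\<lambda>p. chr p (u' 0) (u' 0)) (at (u 0)) (u' 0)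
        + chr (u 0) (u'' 0) (u' 0) + chr (u 0) (u' 0) (u'' 0))) (at 0 within I)"
      unfolding ac_def
    proof (intro has_vector_derivative_add has_vector_derivative_bilinear_family[OF open_U smooth_chr linear_chr1
          linear_chr2 _ I0 du du' du'])
      show "(u'' has_vector_derivative s *\<^sub>R e) (at 0 within I)"
        unfolding u''_def by (auto intro!: derivative_eq_intros)
      show "u t \<in> ?U" if "t \<in> I" for t by (rule SU[OF IS(1)[OF that]])
    qed
    then have "((\<lambda>t. curve.acc t c) has_vector_derivative s *\<^sub>R e + (frechet_derivative (\<lambda>p. chr p v v) (at u0) v
        + chr u0 q v + chr u0 v q)) (at 0 within I)"
      unfolding at0 by (rule has_vector_derivative_transform[OF I0 acc_c, rotated])
    from vector_derivative_interval[OF I I0 this]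
    have "?Da c = s *\<^sub>R e + K"
      using curve.cov_deriv_coord[OF c(1), of 0 curve.acc] I0 cc(2,3,4)[OF I0] acc_c[OF I0]
      by (simp add: K_def at0 ac0)
    then have "g x ?Da R = s * g x R R + Gc c u0 K e"
      using metric_coord_at[OF c Da_t R(1)] ee by (simp add: u0_def[symmetric] e_def[symmetric] G_simps[OF u0])
    then have coeff: "g x ?Dr R / g x R R = - (Gc c u0 K e / g x R R) - s"
      using gDr RR by (simp add: field_simps)
    obtain a where a: "curve.vel 0 = a *\<^sub>R rperp A g (\<gamma> 0) (curve.rad 0)"
      "?Dr = (g (\<gamma> 0) ?Dr (curve.rad 0) / g (\<gamma> 0) (curve.rad 0) (curve.rad 0)) *\<^sub>R curve.rad 0
         - a *\<^sub>R rperp A g (\<gamma> 0) (curve.rad 0)"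
      using curve.lift_velocity_components[OF rad ra(1)[OF I0] I0 vel_ne[OF I0] ra(2) ra(3)[OF I0]] by blast
    have "(a - 1) *\<^sub>R ?P = 0" using a(1) unfolding vel0 \<gamma>0 rad0 by (simp add: scaleR_diff_left)
    then have "a = 1" using rperp_nonzero[OF R] by simp
    then have Dr: "?Dr = (- (Gc c u0 K e / g x R R) - s) *\<^sub>R R - ?P"
      using a(2) unfolding \<gamma>0 rad0 coeff by simp
    have lc: "lift_curve A g I \<gamma> = (\<lambda>t. (\<gamma> t, curve.rad t))" by (rule ext) (simp add: lift_curve_def)
    have "velocity (slit_bundle A) I (lift_curve A g I \<gamma>) 0
       = lift_vec x R ?P ((- (Gc c u0 K e / g x R R) - s) *\<^sub>R R - ?P)"
      unfolding lc slit_velocity[OF I cc(1) rad I0] \<gamma>0 rad0 vel0 Dr ..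
    moreover have "lift_curve A g I \<gamma> 0 = (x, R)" unfolding lc \<gamma>0 rad0 ..
    ultimately show "\<exists>a b \<gamma>. a < 0 \<and> 0 < b \<and> curved_curve A g {a<..<b} \<gamma> \<and> lift_curve A g {a<..<b} \<gamma> 0 = (x, R)
     \<and> velocity (slit_bundle A) {a<..<b} (lift_curve A g {a<..<b} \<gamma>) 0
       = lift_vec x R ?P ((- (Gc c u0 K e / g x R R) - s) *\<^sub>R R - ?P)"
      using curved \<delta>(1) unfolding I_def by (intro exI[of _ "-\<delta>"] exI[of _ \<delta>] exI[of _ \<gamma>] conjI) simp_all
  qed
qed

text \<open>The velocities of the lifts of two osculating curves with parameters \<open>\<kappa>\<close> and \<open>\<kappa> - 1\<close> are \<open>vf1\<close> and
  \<open>vf1 + vf2\<close>.\<close>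

lemma radius_distribution_eq:
  assumes p: "p \<in> mcarrier (slit_bundle A)"
  shows "radius_distribution A g p = span {vf1 p, vf2 p}"
proof -
  obtain x R where xR: "p = (x, R)" by (cases p)
  have R: "R \<in> tangent_space A x" "R \<noteq> 0" using p unfolding xR mcarrier_slit_bundle by simp_all
  let ?V = "{velocity (slit_bundle A) {a<..<b} (lift_curve A g {a<..<b} \<gamma>) 0 | a b \<gamma>.
        a < 0 \<and> 0 < b \<and> curved_curve A g {a<..<b} \<gamma> \<and> lift_curve A g {a<..<b} \<gamma> 0 = (x, R)}"
  let ?P = "rperp A g x R"
  have "\<xi> \<in> span {vf1 (x, R), vf2 (x, R)}" if \<xi>: "\<xi> \<in> ?V" for \<xi>
  proof -
    obtain a b \<gamma> where ab: "a < 0" "0 < b" "curved_curve A g {a<..<b} \<gamma>" "lift_curve A g {a<..<b} \<gamma> 0 = (x, R)"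
      "\<xi> = velocity (slit_bundle A) {a<..<b} (lift_curve A g {a<..<b} \<gamma>) 0"
      using \<xi> by blast
    interpret surface_curve A g "{a<..<b}" \<gamma>
      using ab curve_interval_open[of a b] by unfold_locales (auto simp: curved_curve_def regular_curve_def)
    have ne: "vel t \<noteq> 0" "nacc t \<noteq> 0" if "t \<in> {a<..<b}" for t
      using ab(3) that unfolding curved_curve_iff by blast+
    have "0 \<in> {a<..<b}" using ab by simp
    from lift_velocity_in_span[OF ne this] show ?thesis using ab(4,5) by (simp add: lift_curve_def)
  qed
  then have "span ?V \<subseteq> span {vf1 (x, R), vf2 (x, R)}"
    by (intro span_minimal subsetI subspace_span)
  moreover have "span {vf1 (x, R), vf2 (x, R)} \<subseteq> span ?V"
  proof -
    obtain \<kappa> where k: "\<forall>s. \<exists>a b \<gamma>. a < 0 \<and> 0 < b \<and> curved_curve A g {a<..<b} \<gamma> \<and> lift_curve A g {a<..<b} \<gamma> 0 = (x, R)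
       \<and> velocity (slit_bundle A) {a<..<b} (lift_curve A g {a<..<b} \<gamma>) 0 = lift_vec x R ?P ((\<kappa> - s) *\<^sub>R R - ?P)"
      using osculating_curves[OF R] by blast
    have mem: "lift_vec x R ?P ((\<kappa> - s) *\<^sub>R R - ?P) \<in> ?V" for s
    proof -
      obtain a b \<gamma> where "a < 0" "0 < b" "curved_curve A g {a<..<b} \<gamma>" "lift_curve A g {a<..<b} \<gamma> 0 = (x, R)"
        "velocity (slit_bundle A) {a<..<b} (lift_curve A g {a<..<b} \<gamma>) 0 = lift_vec x R ?P ((\<kappa> - s) *\<^sub>R R - ?P)"
        using spec[OF k, of s] by blast
      then show ?thesis unfolding mem_Collect_eq by (intro exI[of _ a] exI[of _ b] exI[of _ \<gamma>]) simp
    qed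
    have "vf1 (x, R) = lift_vec x R ?P ((\<kappa> - \<kappa>) *\<^sub>R R - ?P)" by (simp add: vf1_def)
    then have 1: "vf1 (x, R) \<in> span ?V" using span_base[OF mem[of \<kappa>]] by simp
    have "vf2 (x, R) = lift_vec x R ?P ((\<kappa> - (\<kappa> - 1)) *\<^sub>R R - ?P) - vf1 (x, R)"
      unfolding vf1_def vf2_def fst_conv snd_conv lift_vec_diff by simp
    then have "vf2 (x, R) \<in> span ?V" using span_diff[OF span_base[OF mem[of "\<kappa> - 1"]] 1] by simp
    with 1 show ?thesis by (intro span_minimal subspace_span) simp
  qed
  ultimately show ?thesis unfolding radius_distribution_def xR by (rule equalityI)
qed

lemma lift_iff_tangent:
  assumes I: "curve_interval I" and p: "smooth_curve (slit_bundle A) I (\<lambda>t. (\<gamma> t, R t))"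
  shows "(\<exists>\<eta>. curved_curve A g I \<eta> \<and> (\<forall>t\<in>I. (\<gamma> t, R t) = lift_curve A g I \<eta> t)) \<longleftrightarrow>
         (\<forall>t\<in>I. velocity (slit_bundle A) I (\<lambda>t. (\<gamma> t, R t)) t \<in> radius_distribution A g (\<gamma> t, R t))
         \<and> regular_curve A I \<gamma>" (is "?L \<longleftrightarrow> ?T \<and> ?r")
proof -
  interpret slit: atlas "slit_bundle A" by (rule atlas_slit_bundle)
  note pr = slit_curve_projection[OF I p]
  have rd: "radius_distribution A g (\<gamma> t, R t) = span {vf1 (\<gamma> t, R t), vf2 (\<gamma> t, R t)}" if "t \<in> I" for t
    by (rule radius_distribution_eq[OF slit.smooth_curve_in_carrier[OF p that]])
  show ?thesis
  proof
    assume ?L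
    then obtain \<eta> where \<eta>: "curved_curve A g I \<eta>" "\<And>t. t \<in> I \<Longrightarrow> (\<gamma> t, R t) = lift_curve A g I \<eta> t" by blast
    interpret surface_curve A g I \<eta>
      by unfold_locales (use I \<eta>(1) in \<open>auto simp: curved_curve_def regular_curve_def\<close>)
    have eq: "\<gamma> t = \<eta> t" "R t = rad t" if "t \<in> I" for t using \<eta>(2)[OF that] by (simp_all add: lift_curve_def)
    have ne: "vel t \<noteq> 0" "nacc t \<noteq> 0" if "t \<in> I" for t using \<eta>(1) that unfolding curved_curve_iff by blast+
    have ?r
      unfolding regular_curve_def using pr(1) ne(1) velocity_cong[OF _ eq(1), where A = A] by simp
    moreover have ?T
    proof
      fix t assume t: "t \<in> I"
      have "velocity (slit_bundle A) I (\<lambda>t. (\<gamma> t, R t)) t = velocity (slit_bundle A) I (lift_curve A g I \<eta>) t"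
        by (rule velocity_cong[OF t \<eta>(2)])
      then show "velocity (slit_bundle A) I (\<lambda>t. (\<gamma> t, R t)) t \<in> radius_distribution A g (\<gamma> t, R t)"
        unfolding rd[OF t] using lift_velocity_in_span[OF ne t] unfolding eq(1)[OF t] eq(2)[OF t] by simp
    qed
    ultimately show "?T \<and> ?r" by blast
  next
    assume T: "?T \<and> ?r"
    interpret surface_curve A g I \<gamma> by unfold_locales (rule I, rule pr(1))
    have ne: "vel t \<noteq> 0" if "t \<in> I" for t using T that unfolding regular_curve_def by blast
    have D: "velocity (slit_bundle A) I (\<lambda>t. (\<gamma> t, R t)) t \<in> span {vf1 (\<gamma> t, R t), vf2 (\<gamma> t, R t)}"
      if "t \<in> I" for t using T that unfolding rd[OF that, symmetric] by blast
    have L1: "nacc t \<noteq> 0" if t: "t \<in> I" for t by (rule tangent_curve_is_lift(1)[OF pr(2,3) ne D t])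
    have L2: "rad t = R t" if t: "t \<in> I" for t by (rule tangent_curve_is_lift(2)[OF pr(2,3) ne D t])
    have "curved_curve A g I \<gamma>" unfolding curved_curve_iff using ne L1 by blast
    moreover have "(\<gamma> t, R t) = lift_curve A g I \<gamma> t" if "t \<in> I" for t
      using L2[OF that] by (simp add: lift_curve_def)
    ultimately show ?L by blast
  qed
qed

end

section \<open>Integral curves\<close>

lemma smooth_lipschitz_cball:
  fixes F :: "'a::euclidean_space \<Rightarrow> 'b::real_normed_vector"
  assumes "smooth_on \<Omega> F" "open \<Omega>" "cball p r \<subseteq> \<Omega>"
  shows "\<exists>L\<ge>1. \<forall>x\<in>cball p r. \<forall>y\<in>cball p r. norm (F x - F y) \<le> L * norm (x - y)"
proof -
  let ?F' = "\<lambda>x. frechet_derivative F (at x)"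
  let ?B = "\<lambda>x. \<Sum>b\<in>Basis. norm (?F' x b)"
  have "continuous_on (cball p r) ?B"
    by (intro continuous_on_sum continuous_on_norm
        continuous_on_subset[OF smooth_on_continuous_on[OF smooth_on_frechet_derivative[OF assms(1,2)]] assms(3)])
  then have "bounded (?B ` cball p r)"
    by (intro compact_imp_bounded compact_continuous_image compact_cball)
  then obtain L where L: "\<And>x. x \<in> cball p r \<Longrightarrow> norm (?B x) \<le> L"
    unfolding bounded_iff by (metis imageI)
  have "norm (F x - F y) \<le> max 1 L * norm (x - y)" if "x \<in> cball p r" "y \<in> cball p r" for x y
  proof (rule differentiable_bound[OF convex_cball _ _ that])
    fix z assume z: "z \<in> cball p r"
    then have D: "(F has_derivative ?F' z) (at z)"
      using smooth_on_has_derivative_at[OF assms(1,2)] assms(3) by blast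
    then show "(F has_derivative ?F' z) (at z within cball p r)" by (rule has_derivative_at_withinI)
    show "onorm (?F' z) \<le> max 1 L"
    proof (rule onorm_le)
      fix h
      have "norm (?F' z h) = norm (\<Sum>b\<in>Basis. (h \<bullet> b) *\<^sub>R ?F' z b)"
        using linear_basis_expansion[OF has_derivative_linear[OF D], of h] by simp
      also have "\<dots> \<le> (\<Sum>b\<in>Basis. norm h * norm (?F' z b))"
        by (rule sum_norm_le) (simp add: mult_right_mono Basis_le_norm)
      also have "\<dots> = norm h * ?B z" by (simp add: sum_distrib_left)
      also have "\<dots> \<le> norm h * max 1 L"
        using L[OF z] by (intro mult_left_mono) auto
      finally show "norm (?F' z h) \<le> max 1 L * norm h" by (simp add: mult.commute)
    qed
  qed
  then show ?thesis by (intro exI[of _ "max 1 L"] conjI ballI) simp_all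
qed

text \<open>The integral operator is a contraction of the space of bounded continuous functions on the line.
  For this purpose its upper limit of integration is clamped to \<open>{0..\<delta>}\<close>.\<close>

lemma picard_global:
  fixes F :: "'a::euclidean_space \<Rightarrow> 'a"
  assumes cont: "continuous_on UNIV F" and M: "\<And>x. norm (F x) \<le> M"
    and L: "\<And>x y. norm (F x - F y) \<le> L * norm (x - y)" "L \<ge> 1"
    and \<delta>: "0 < \<delta>" "\<delta> * L \<le> 1 / 2"
  shows "\<exists>y. continuous_on UNIV y \<and> (\<forall>t\<in>{0..\<delta>}. y t = p + integral {0..t} (\<lambda>s. F (y s)))"
proof -
  define cl where "cl = (\<lambda>t::real. max 0 (min t \<delta>))"
  have cl: "cl t \<in> {0..\<delta>}" for t using \<delta>(1) by (auto simp: cl_def)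
  have M0: "M \<ge> 0" using M[of undefined] norm_ge_zero order_trans by blast
  define T where "T = (\<lambda>y :: real \<Rightarrow>\<^sub>C 'a. \<lambda>t. p + integral {0..cl t} (\<lambda>s. F (apply_bcontfun y s)))"
  have Fy: "continuous_on S (\<lambda>s. F (apply_bcontfun y s))" for y :: "real \<Rightarrow>\<^sub>C 'a" and S
    by (rule continuous_on_compose2[OF cont continuous_on_apply_bcontfun]) auto
  have Tb: "T y \<in> bcontfun" for y
  proof (rule bcontfun_normI)
    have "continuous_on {0..\<delta>} (\<lambda>t. integral {0..t} (\<lambda>s. F (apply_bcontfun y s)))"
      by (rule indefinite_integral_continuous_1[OF integrable_continuous_interval[OF Fy]])
    moreover have "continuous_on UNIV cl" unfolding cl_def by (intro continuous_intros)
    ultimately have "continuous_on UNIV (\<lambda>t. integral {0..cl t} (\<lambda>s. F (apply_bcontfun y s)))"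
      by (rule continuous_on_compose2) (use cl in auto)
    then show "continuous_on UNIV (T y)" unfolding T_def by (intro continuous_on_add continuous_on_const)
    fix t
    have "norm (integral {0..cl t} (\<lambda>s. F (apply_bcontfun y s))) \<le> M * (cl t - 0)"
      by (rule integral_bound[OF _ Fy M]) (use cl[of t] in auto)
    also have "\<dots> \<le> M * \<delta>" using cl[of t] M0 by (intro mult_left_mono) auto
    finally show "norm (T y t) \<le> norm p + M * \<delta>"
      unfolding T_def using norm_triangle_ineq order_trans add_left_mono by blast
  qed
  define \<Phi> where "\<Phi> = (\<lambda>y. Bcontfun (T y))"
  have \<Phi>: "apply_bcontfun (\<Phi> y) t = T y t" for y t
    unfolding \<Phi>_def using Bcontfun_inverse[OF Tb] by simp
  have "\<exists>!y. \<Phi> y = y"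
  proof (rule banach_fix_type[where c = "1/2"])
    show "\<forall>y z. dist (\<Phi> y) (\<Phi> z) \<le> 1 / 2 * dist y z"
    proof (intro allI dist_bound)
      fix y z t
      have "dist (apply_bcontfun (\<Phi> y) t) (apply_bcontfun (\<Phi> z) t)
        = norm (integral {0..cl t} (\<lambda>s. F (apply_bcontfun y s) - F (apply_bcontfun z s)))"
        unfolding \<Phi> T_def dist_norm
        by (subst integral_diff) (simp_all add: integrable_continuous_interval Fy)
      also have "\<dots> \<le> (L * dist y z) * (cl t - 0)"
      proof (rule integral_bound)
        show "0 \<le> cl t" using cl[of t] by simp
        show "continuous_on {0..cl t} (\<lambda>s. F (apply_bcontfun y s) - F (apply_bcontfun z s))"
          by (intro continuous_on_diff Fy)
        fix s
        have "norm (F (apply_bcontfun y s) - F (apply_bcontfun z s)) \<le> L * dist (apply_bcontfun y s) (apply_bcontfun z s)"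
          using L(1) by (simp add: dist_norm)
        also have "\<dots> \<le> L * dist y z" using L(2) by (intro mult_left_mono dist_bounded) simp
        finally show "norm (F (apply_bcontfun y s) - F (apply_bcontfun z s)) \<le> L * dist y z" .
      qed
      also have "\<dots> \<le> (L * dist y z) * \<delta>"
        using cl[of t] L(2) by (intro mult_left_mono) auto
      also have "\<dots> = (\<delta> * L) * dist y z" by simp
      also have "\<dots> \<le> 1 / 2 * dist y z" using \<delta>(2) by (intro mult_right_mono) auto
      finally show "dist (apply_bcontfun (\<Phi> y) t) (apply_bcontfun (\<Phi> z) t) \<le> 1 / 2 * dist y z" .
    qed
  qed simp_all
  then obtain y where y: "\<Phi> y = y" by blast
  have "apply_bcontfun y t = p + integral {0..t} (\<lambda>s. F (apply_bcontfun y s))" if "t \<in> {0..\<delta>}" for t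
  proof -
    have "apply_bcontfun y t = T y t" using \<Phi>[of y t] unfolding y .
    moreover have "cl t = t" using that by (simp add: cl_def)
    ultimately show ?thesis by (simp add: T_def)
  qed
  then show ?thesis by (intro exI[of _ "apply_bcontfun y"]) simp
qed

text \<open>Composing \<open>F\<close> with the projection to the nearest point of a ball makes it bounded and globally
  Lipschitz, and for a short time the solution stays in the ball, where the projection is the
  identity. Forward time suffices: a one-sided velocity determines the value of a field.\<close>

lemma picard_local:
  fixes F :: "'a::euclidean_space \<Rightarrow> 'a"
  assumes F: "smooth_on \<Omega> F" "open \<Omega>" "p \<in> \<Omega>"
  obtains \<delta> y where "\<delta> > 0" "y 0 = p" "\<And>t. t \<in> {0..\<delta>} \<Longrightarrow> y t \<in> \<Omega>"
    "\<And>t. t \<in> {0..\<delta>} \<Longrightarrow> (y has_vector_derivative F (y t)) (at t within {0..\<delta>})"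
proof -
  obtain r where r: "r > 0" "cball p r \<subseteq> \<Omega>" using F(2,3) open_contains_cball by blast
  let ?C = "cball p r"
  obtain L where L: "L \<ge> 1" "\<And>x y. x \<in> ?C \<Longrightarrow> y \<in> ?C \<Longrightarrow> norm (F x - F y) \<le> L * norm (x - y)"
    using smooth_lipschitz_cball[OF F(1,2) r(2)] by blast
  have "bounded (F ` ?C)"
    by (intro compact_imp_bounded compact_continuous_image compact_cball
        continuous_on_subset[OF smooth_on_continuous_on[OF F(1)] r(2)])
  then obtain M0 where M0: "\<And>x. x \<in> ?C \<Longrightarrow> norm (F x) \<le> M0" unfolding bounded_iff by (metis imageI)
  define M where "M = max 1 M0"
  have M: "M > 0" "\<And>x. x \<in> ?C \<Longrightarrow> norm (F x) \<le> M" using M0 unfolding M_def by (simp, fastforce simp: le_max_iff_disj)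
  have C: "convex ?C" "closed ?C" "?C \<noteq> {}" using r(1) by auto
  define P where "P = closest_point ?C"
  have P: "P x \<in> ?C" for x unfolding P_def by (rule closest_point_in_set[OF C(2,3)])
  have Pl: "norm (P x - P y) \<le> norm (x - y)" for x y
    using closest_point_lipschitz[OF C, of x y] unfolding P_def dist_norm .
  have Ps: "P x = x" if "x \<in> ?C" for x unfolding P_def by (rule closest_point_self[OF that])
  define \<delta> where "\<delta> = min (r / M) (1 / (2 * L))"
  have \<delta>: "\<delta> > 0" "\<delta> * L \<le> 1 / 2" "M * \<delta> \<le> r"
    using r(1) M(1) L(1) by (auto simp: \<delta>_def min_def field_simps)
  have Fcont: "continuous_on UNIV (\<lambda>x. F (P x))"
    by (rule continuous_on_compose2[OF smooth_on_continuous_on[OF F(1)]])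
       (use P r(2) continuous_on_closest_point[OF C] in \<open>auto simp: P_def\<close>)
  have Fl: "norm (F (P x) - F (P y)) \<le> L * norm (x - y)" for x y
  proof -
    have "norm (F (P x) - F (P y)) \<le> L * norm (P x - P y)" by (rule L(2)[OF P P])
    also have "\<dots> \<le> L * norm (x - y)" using L(1) Pl by (intro mult_left_mono) auto
    finally show ?thesis .
  qed
  obtain y where y: "continuous_on UNIV y" "\<And>t. t \<in> {0..\<delta>} \<Longrightarrow> y t = p + integral {0..t} (\<lambda>s. F (P (y s)))"
    using picard_global[OF Fcont M(2)[OF P] Fl L(1) \<delta>(1,2), of p] by blast
  have Fy: "continuous_on S (\<lambda>s. F (P (y s)))" for S
    by (rule continuous_on_compose2[OF Fcont continuous_on_subset[OF y(1)]]) auto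
  have yC: "y t \<in> ?C" if "t \<in> {0..\<delta>}" for t
  proof -
    have "norm (integral {0..t} (\<lambda>s. F (P (y s)))) \<le> M * (t - 0)"
      by (rule integral_bound[OF _ Fy M(2)[OF P]]) (use that in simp)
    also have "\<dots> \<le> M * \<delta>" using that M(1) by (intro mult_left_mono) auto
    finally show ?thesis using \<delta>(3) by (simp add: y(2)[OF that] dist_norm)
  qed
  have "(y has_vector_derivative F (y t)) (at t within {0..\<delta>})" if t: "t \<in> {0..\<delta>}" for t
  proof -
    have "((\<lambda>t. p + integral {0..t} (\<lambda>s. F (P (y s)))) has_vector_derivative 0 + F (P (y t))) (at t within {0..\<delta>})"
      by (intro has_vector_derivative_add has_vector_derivative_const integral_has_vector_derivative[OF Fy t])
    then have "(y has_vector_derivative 0 + F (P (y t))) (at t within {0..\<delta>})"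
      by (rule has_vector_derivative_transform[OF t, rotated]) (rule y(2))
    then show ?thesis using Ps[OF yC[OF t]] by simp
  qed
  moreover have "y 0 = p" using y(2)[of 0] \<delta>(1) by simp
  moreover have "y t \<in> \<Omega>" if "t \<in> {0..\<delta>}" for t using yC[OF that] r(2) by blast
  ultimately show thesis using that \<delta>(1) by blast
qed

lemma smooth_solution:
  fixes F :: "'a::euclidean_space \<Rightarrow> 'a"
  assumes F: "smooth_on \<Omega> F" and I: "accessible I" and y: "\<And>t. t \<in> I \<Longrightarrow> y t \<in> \<Omega>"
    and d: "\<And>t. t \<in> I \<Longrightarrow> (y has_vector_derivative F (y t)) (at t within I)"
  shows "smooth_on I y"
proof (rule smooth_on_bootstrap[OF I, where f' = "\<lambda>t h. h *\<^sub>R F (y t)"])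
  show "(y has_derivative (\<lambda>h. h *\<^sub>R F (y t))) (at t within I)" if "t \<in> I" for t
    using d[OF that] unfolding has_vector_derivative_def .
  fix k v assume k: "C_on k I y"
  have "C_on k \<Omega> F" using F unfolding smooth_on_def by (rule spec)
  then have "C_on k I (\<lambda>t. F (y t))" by (rule C_on_compose[OF I k]) (use y in blast)
  then show "C_on k I (\<lambda>t. v *\<^sub>R F (y t))"
    by (rule C_on_linear[OF bounded_linear_scaleR_right I])
qed

context atlas
begin

lemma integral_curve_exists:
  assumes X: "smooth_vector_field A (mcarrier A) X" and p: "p \<in> mcarrier A"
  obtains \<delta> \<gamma> where "\<delta> > 0" "\<gamma> 0 = p" "integral_curve A X {0..\<delta>} \<gamma>"
proof -
  obtain c where c: "c \<in> A" "p \<in> fst c" using mcarrier_chart[OF p] by metis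
  let ?\<Omega> = "snd c ` fst c"
  define F where "F = (\<lambda>u. X (chart_inv c u) c)"
  have "mcarrier A \<inter> fst c = fst c" using c(1) unfolding mcarrier_def by blast
  then have F: "smooth_on ?\<Omega> F"
    using X c(1) unfolding smooth_vector_field_def F_def by auto
  obtain \<delta> y where y: "\<delta> > 0" "y 0 = snd c p" "\<And>t. t \<in> {0..\<delta>} \<Longrightarrow> y t \<in> ?\<Omega>"
    "\<And>t. t \<in> {0..\<delta>} \<Longrightarrow> (y has_vector_derivative F (y t)) (at t within {0..\<delta>})"
    using picard_local[OF F open_chart_image[OF c(1)] imageI[OF c(2)]] by blast
  have I: "curve_interval {0..\<delta>}" using y(1) by (rule curve_interval_closed)
  define \<gamma> where "\<gamma> = (\<lambda>t. chart_inv c (y t))"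
  have dom: "\<gamma> t \<in> fst c" if "t \<in> {0..\<delta>}" for t unfolding \<gamma>_def by (rule inv_into_into[OF y(3)[OF that]])
  have coord: "snd c (\<gamma> t) = y t" if "t \<in> {0..\<delta>}" for t unfolding \<gamma>_def by (rule f_inv_into_f[OF y(3)[OF that]])
  have sm: "smooth_on {0..\<delta>} (\<lambda>t. snd c (\<gamma> t))"
    by (rule smooth_on_eq[OF smooth_solution[OF F accessible_interval[OF I] y(3,4)] coord])
  have "smooth_curve A {0..\<delta>} \<gamma>" by (rule smooth_curve_from_chart[OF I c(1) dom sm])
  moreover have "velocity A {0..\<delta>} \<gamma> t = X (\<gamma> t)" if t: "t \<in> {0..\<delta>}" for t
  proof -
    have d: "((\<lambda>s. snd c (\<gamma> s)) has_vector_derivative F (y t)) (at t within {0..\<delta>})"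
      by (rule has_vector_derivative_transform[OF t coord y(4)[OF t]])
    have "velocity A {0..\<delta>} \<gamma> t = coord_vec A c (\<gamma> t) (F (y t))"
      by (rule velocity_from_chart[OF I openin_subtopology_self t c(1) dom d])
    also have "F (y t) = X (\<gamma> t) c" by (simp add: F_def \<gamma>_def)
    also have "coord_vec A c (\<gamma> t) (X (\<gamma> t) c) = X (\<gamma> t)"
    proof (rule coord_vec_tangent_eq[OF c(1) dom[OF t]])
      have "\<gamma> t \<in> mcarrier A" using dom[OF t] c(1) unfolding mcarrier_def by blast
      then show "X (\<gamma> t) \<in> tangent_space A (\<gamma> t)" using X unfolding smooth_vector_field_def by blast
    qed
    finally show ?thesis .
  qed
  moreover have "\<gamma> 0 = p" using c by (simp add: \<gamma>_def y(2))
  ultimately show thesis using that[of \<delta> \<gamma>] y(1) unfolding integral_curve_def by blast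
qed

text \<open>Through every point there is an integral curve of \<open>X\<close>. It satisfies \<open>P\<close>, hence is an integral curve
  of \<open>Y\<close> as well, and its initial velocity is the common value of the two fields.\<close>

lemma has_integral_curves_unique:
  assumes X: "has_integral_curves A P X" and Y: "has_integral_curves A P Y" and p: "p \<in> mcarrier A"
  shows "Y p = X p"
proof -
  have "smooth_vector_field A (mcarrier A) X" using X unfolding has_integral_curves_def by (rule conjunct1)
  then obtain \<delta> \<gamma> where \<gamma>: "\<delta> > 0" "\<gamma> 0 = p" "integral_curve A X {0..\<delta>} \<gamma>"
    using integral_curve_exists[OF _ p] by blast
  have c: "curve_interval {0..\<delta>} \<and> smooth_curve A {0..\<delta>} \<gamma>"
    using \<gamma>(3) curve_interval_closed[OF \<gamma>(1)] unfolding integral_curve_def by blast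
  have "P {0..\<delta>} \<gamma>" using X c \<gamma>(3) unfolding has_integral_curves_def by blast
  then have "integral_curve A Y {0..\<delta>} \<gamma>" using Y c unfolding has_integral_curves_def by blast
  then have "velocity A {0..\<delta>} \<gamma> 0 = Y p" "velocity A {0..\<delta>} \<gamma> 0 = X p"
    using \<gamma> unfolding integral_curve_def by auto
  then show ?thesis by simp
qed

text \<open>The curve is locally constant in charts, and intervals are connected.\<close>

lemma zero_velocity_constant:
  assumes I: "curve_interval I" and \<gamma>: "smooth_curve A I \<gamma>" and v: "\<And>t. t \<in> I \<Longrightarrow> velocity A I \<gamma> t = 0"
    and st: "s \<in> I" "t \<in> I"
  shows "\<gamma> s = \<gamma> t"
proof (rule connected_local_const[OF _ st])
  show "connected I" using I by (simp add: curve_interval_def is_interval_connected)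
  show "\<forall>a\<in>I. eventually (\<lambda>b. \<gamma> a = \<gamma> b) (at a within I)"
  proof
    fix a assume a: "a \<in> I"
    obtain c where c: "c \<in> A" "\<gamma> a \<in> fst c"
      using mcarrier_chart[OF smooth_curve_in_carrier[OF \<gamma> a]] by metis
    have o: "openin (top_of_set I) {t \<in> I. \<gamma> t \<in> fst c}" by (rule smooth_curve_preimage_openin[OF \<gamma> c(1)])
    have am: "a \<in> {t \<in> I. \<gamma> t \<in> fst c}" using a c by blast
    obtain r where r: "r > 0" "ball a r \<inter> I \<subseteq> {t \<in> I. \<gamma> t \<in> fst c}"
      using o am unfolding openin_contains_ball by blast
    let ?J = "ball a r \<inter> I"
    have "convex ?J"
      using I by (intro convex_Int convex_ball) (simp add: curve_interval_def is_interval_convex)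
    moreover have "((\<lambda>s. snd c (\<gamma> s)) has_vector_derivative 0) (at b within ?J)" if "b \<in> ?J" for b
    proof -
      have b: "b \<in> I" "\<gamma> b \<in> fst c" using that r(2) by blast+
      have "((\<lambda>s. snd c (\<gamma> s)) has_vector_derivative velocity A I \<gamma> b c) (at b within I)"
        by (rule smooth_curve_has_vector_derivative[OF I \<gamma> c(1) b])
      then show ?thesis unfolding v[OF b(1)]
        by (auto intro: has_vector_derivative_within_subset)
    qed
    ultimately obtain k where k: "\<And>b. b \<in> ?J \<Longrightarrow> snd c (\<gamma> b) = k"
      using has_vector_derivative_zero_constant[of ?J "\<lambda>s. snd c (\<gamma> s)"] by blast
    have "\<gamma> a = \<gamma> b" if "b \<in> ?J" for b
    proof (rule inj_onD[OF inj_chart[OF c(1)]])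
      show "snd c (\<gamma> a) = snd c (\<gamma> b)" using k[of a] k[OF that] a r(1) by simp
    qed (use that a r c in auto)
    then show "eventually (\<lambda>b. \<gamma> a = \<gamma> b) (at a within I)"
      unfolding eventually_at using r(1) by (intro exI[of _ r]) (simp add: dist_commute)
  qed
qed

end

context surface
begin

lemma vf1_integral_curves:
  "has_integral_curves (slit_bundle A) (\<lambda>I c. ode1 A g I (fst \<circ> c) (snd \<circ> c)) vf1"
  unfolding has_integral_curves_def
proof (intro conjI allI impI vf_smooth(1))
  fix I c assume a: "curve_interval I \<and> smooth_curve (slit_bundle A) I c"
  define \<gamma> where "\<gamma> = fst \<circ> c"
  define R where "R = snd \<circ> c"
  have c: "c = (\<lambda>t. (\<gamma> t, R t))" by (simp add: \<gamma>_def R_def)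
  have I: "curve_interval I" and sc: "smooth_curve (slit_bundle A) I (\<lambda>t. (\<gamma> t, R t))" using a c by simp_all
  note pr = slit_curve_projection[OF I sc]
  interpret surface_curve A g I \<gamma> by unfold_locales (rule I, rule pr(1))
  have "velocity (slit_bundle A) I c t = vf1 (c t) \<longleftrightarrow>
      vel t = rperp A g (\<gamma> t) (R t) \<and> cov_deriv A g I \<gamma> R t = - rperp A g (\<gamma> t) (R t)" if t: "t \<in> I" for t
  proof -
    note RT = along_tangent[OF pr(2) t] pr(3)[OF t]
    show ?thesis
      unfolding c slit_velocity[OF I pr(1,2) t] vf1_def fst_conv snd_conv
      by (rule lift_vec_eq_iff[OF RT vel_tangent[OF t] rperp_tangent[OF RT] cov_deriv_tangent[OF pr(2) t]
            tangent_neg[OF rperp_tangent[OF RT]]])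
  qed
  then show "integral_curve (slit_bundle A) vf1 I c \<longleftrightarrow> ode1 A g I (fst \<circ> c) (snd \<circ> c)"
    unfolding integral_curve_def ode1_def \<gamma>_def[symmetric] R_def[symmetric] using a by simp
qed

text \<open>The equation \<open>R' = R\<close> concerns the coordinates of \<open>R\<close> in all charts. Those in charts around the base
  point agree with \<open>D\<^sub>tR\<close> because the base point has velocity zero. In the other charts they vanish at
  all times, because the base point does not move.\<close>

lemma vf2_integral_curves:
  "has_integral_curves (slit_bundle A) (\<lambda>I c. ode2 A I (fst \<circ> c) (snd \<circ> c)) vf2"
  unfolding has_integral_curves_def
proof (intro conjI allI impI vf_smooth(2))
  fix I c assume a: "curve_interval I \<and> smooth_curve (slit_bundle A) I c"
  define \<gamma> where "\<gamma> = fst \<circ> c"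
  define R where "R = snd \<circ> c"
  have c: "c = (\<lambda>t. (\<gamma> t, R t))" by (simp add: \<gamma>_def R_def)
  have I: "curve_interval I" and sc: "smooth_curve (slit_bundle A) I (\<lambda>t. (\<gamma> t, R t))" using a c by simp_all
  note pr = slit_curve_projection[OF I sc]
  interpret surface_curve A g I \<gamma> by unfold_locales (rule I, rule pr(1))
  let ?V = "\<lambda>t d. vector_derivative (\<lambda>s. R s d) (at t within I)"
  have vf2: "velocity (slit_bundle A) I c t = vf2 (c t) \<longleftrightarrow> vel t = 0 \<and> cov_deriv A g I \<gamma> R t = R t"
    if t: "t \<in> I" for t
  proof -
    note RT = along_tangent[OF pr(2) t] pr(3)[OF t]
    show ?thesis
      unfolding c slit_velocity[OF I pr(1,2) t] vf2_def fst_conv snd_conv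
      by (rule lift_vec_eq_iff[OF RT vel_tangent[OF t] tangent_zero cov_deriv_tangent[OF pr(2) t] RT(1)])
  qed
  have cov: "cov_deriv A g I \<gamma> R t d = ?V t d" if "t \<in> I" "vel t = 0" "d \<in> A" "\<gamma> t \<in> fst d" for t d
    using cov_deriv_coord[OF that(3), of t R] that christoffel_linear(3)[OF that(3,4)] by simp
  have "(\<forall>t\<in>I. vel t = 0 \<and> cov_deriv A g I \<gamma> R t = R t) \<longleftrightarrow> (\<forall>t\<in>I. vel t = 0 \<and> ?V t = R t)"
  proof (intro iffI ballI conjI)
    fix t assume L: "\<forall>t\<in>I. vel t = 0 \<and> cov_deriv A g I \<gamma> R t = R t" and t: "t \<in> I"
    show "vel t = 0" using L t by blast
    show "?V t = R t"
    proof
      fix d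
      show "?V t d = R t d"
      proof (cases "d \<in> A \<and> \<gamma> t \<in> fst d")
        case True
        then show ?thesis using cov[OF t, of d] L t by simp
      next
        case False
        have v0: "vel s = 0" if "s \<in> I" for s using L that by blast
        have "\<gamma> s = \<gamma> t" if "s \<in> I" for s
          by (rule zero_velocity_constant[OF I pr(1) v0 that t])
        then have "R s d = 0" if "s \<in> I" for s
          using tangent_space_outside[OF along_tangent[OF pr(2) that], of d] False that by simp
        then have 0: "?V t d = vector_derivative (\<lambda>s. 0) (at t within I)" and "R t d = 0"
          using vector_derivative_cong_within[OF t, of "\<lambda>s. R s d" "\<lambda>s. 0"] t by simp_all
        moreover have "((\<lambda>s. 0 :: real^2) has_vector_derivative 0) (at t within I)" by simp
        from vector_derivative_interval[OF I t this]
        have "vector_derivative (\<lambda>s. 0 :: real^2) (at t within I) = 0" .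
        ultimately show ?thesis by simp
      qed
    qed
  next
    fix t assume L: "\<forall>t\<in>I. vel t = 0 \<and> ?V t = R t" and t: "t \<in> I"
    show v: "vel t = 0" using L t by blast
    have VR: "?V t = R t" using L t by blast
    show "cov_deriv A g I \<gamma> R t = R t"
    proof
      fix d
      show "cov_deriv A g I \<gamma> R t d = R t d"
      proof (cases "d \<in> A \<and> \<gamma> t \<in> fst d")
        case True
        then show ?thesis using cov[OF t v, of d] fun_cong[OF VR, of d] by simp
      next
        case False
        then show ?thesis
          using tangent_space_outside[OF along_tangent[OF pr(2) t] False]
            tangent_space_outside[OF cov_deriv_tangent[OF pr(2) t] False] by simp
      qed
    qed
  qed
  then show "integral_curve (slit_bundle A) vf2 I c \<longleftrightarrow> ode2 A I (fst \<circ> c) (snd \<circ> c)"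
    unfolding integral_curve_def ode2_def \<gamma>_def[symmetric] R_def[symmetric] using a vf2 by simp
qed

end

theorem proposition2p1:
  fixes A :: "('p, real^2) chart set" and g :: "('p, real^2) metric"
  assumes "oriented_surface A" and "riemannian_metric A g"
  shows "engel_distribution (slit_bundle A) (radius_distribution A g)
    \<and> (\<forall>T \<gamma> R. 0 < T \<and> smooth_curve (slit_bundle A) {0..T} (\<lambda>t. (\<gamma> t, R t)) \<longrightarrow>
         (\<exists>\<eta>. curved_curve A g {0..T} \<eta> \<and> (\<forall>t\<in>{0..T}. (\<gamma> t, R t) = lift_curve A g {0..T} \<eta> t))
         \<longleftrightarrow>
         (\<forall>t\<in>{0..T}. velocity (slit_bundle A) {0..T} (\<lambda>t. (\<gamma> t, R t)) t
            \<in> radius_distribution A g (\<gamma> t, R t))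
         \<and> regular_curve A {0..T} \<gamma>)
    \<and> (\<exists>f1 f2.
         characterized_by_integral_curves (slit_bundle A)
           (\<lambda>I c. ode1 A g I (fst \<circ> c) (snd \<circ> c)) f1
         \<and> characterized_by_integral_curves (slit_bundle A)
           (\<lambda>I c. ode2 A I (fst \<circ> c) (snd \<circ> c)) f2
         \<and> (\<forall>p\<in>mcarrier (slit_bundle A). f1 p \<noteq> f2 p \<and> independent {f1 p, f2 p}
              \<and> span {f1 p, f2 p} = radius_distribution A g p))"
proof -
  interpret surface A g by unfold_locales fact+
  interpret slit: atlas "slit_bundle A" by (rule atlas_slit_bundle)
  have M: "smooth_manifold A" using assms(1) unfolding oriented_surface_def by blast
  have engel: "engel_distribution (slit_bundle A) (radius_distribution A g)"
    by (rule engel_of_frame[OF M radius_distribution_eq])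
  have frame: "vf1 p \<noteq> vf2 p \<and> independent {vf1 p, vf2 p} \<and> span {vf1 p, vf2 p} = radius_distribution A g p"
    if p: "p \<in> mcarrier (slit_bundle A)" for p
  proof -
    obtain x R where xR: "p = (x, R)" by (cases p)
    have R: "R \<in> tangent_space A x" "R \<noteq> 0" using p unfolding xR mcarrier_slit_bundle by simp_all
    show ?thesis using independent_vf12(1,2)[OF R] radius_distribution_eq[OF p] unfolding xR by simp
  qed
  have char: "characterized_by_integral_curves (slit_bundle A) Q X"
    if X: "has_integral_curves (slit_bundle A) Q X" for Q X
    unfolding characterized_by_integral_curves_def
    using X slit.has_integral_curves_unique[OF X] by blast
  show ?thesis
  proof (intro conjI allI impI)
    show "engel_distribution (slit_bundle A) (radius_distribution A g)" by (rule engel)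
    show "\<exists>f1 f2.
         characterized_by_integral_curves (slit_bundle A)
           (\<lambda>I c. ode1 A g I (fst \<circ> c) (snd \<circ> c)) f1
         \<and> characterized_by_integral_curves (slit_bundle A)
           (\<lambda>I c. ode2 A I (fst \<circ> c) (snd \<circ> c)) f2
         \<and> (\<forall>p\<in>mcarrier (slit_bundle A). f1 p \<noteq> f2 p \<and> independent {f1 p, f2 p}
              \<and> span {f1 p, f2 p} = radius_distribution A g p)"
      by (rule exI[of _ vf1], rule exI[of _ vf2])
         (intro conjI ballI char[OF vf1_integral_curves] char[OF vf2_integral_curves] frame)
  next
    fix T \<gamma> R
    assume a: "0 < T \<and> smooth_curve (slit_bundle A) {0..T} (\<lambda>t. (\<gamma> t, R t))"
    show "(\<exists>\<eta>. curved_curve A g {0..T} \<eta> \<and> (\<forall>t\<in>{0..T}. (\<gamma> t, R t) = lift_curve A g {0..T} \<eta> t))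
         \<longleftrightarrow>
         (\<forall>t\<in>{0..T}. velocity (slit_bundle A) {0..T} (\<lambda>t. (\<gamma> t, R t)) t
            \<in> radius_distribution A g (\<gamma> t, R t))
         \<and> regular_curve A {0..T} \<gamma>"
      using a lift_iff_tangent[OF curve_interval_closed] by blast
  qed
qed

end
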